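(* The three notions of odd Schur function coincide: for every $n\ge 1$ and every partition $\lambda$ one has, in $\mathrm{OPol}_n$, $$s^K_\lambda=s^p_\lambda,$$ and, if $\lambda$ has at most $n$ parts (so that $s^s_\lambda$ is defined in $n$ variables), also $$s^K_\lambda=s^p_\lambda=s^s_\lambda .$$
   Context: Let $\mathrm{OPol}_n=\mathbb{Z}\langle x_1,\dots,x_n\rangle/(x_ix_j+x_jx_i : i\ne j)$ and $\tilde x_i=(-1)^{i-1}x_i$. For $k\ge 1$ let $h_k=\sum_{1\le i_1\le\dots\le i_k\le n}\tilde x_{i_1}\cdots\tilde x_{i_k}\in \mathrm{OPol}_n$, and $h_0=1$. For a partition $\mu=(\mu_1\ge\dots\ge\mu_r)$ let $h_\mu=h_{\mu_1}\cdots h_{\mu_r}$ (product in this order). Tableaux. Partitions are identified with Young diagrams (English convention: row 1 on top, rows left-justified). A Young tableau is a filling of the boxes of a diagram by positive integers. It is semistandard if entries are non-decreasing along rows (left to right) and strictly increasing down columns. The row word $w_r(T)$ of a tableau is obtained by reading its entries left to right within each row, from the bottom row to the top row. The content of $T$ is $(a_1,a_2,\dots)$ with $a_i$ the number of entries equal to $i$. $SSYT(\lambda)$ is the set of semistandard tableaux of shape $\lambda$ and $SSYT(\lambda,\mu)$ the subset with content $\mu$. $T_\lambda$ is the unique semistandard tableau with shape and content both $\lambda$. $\mathrm{sign}(T)$ is the sign of the minimal length permutation sorting $w_r(T)$ into non-decreasing order, i.e. $(-1)$ to the number of pairs of positions in $w_r(T)$ in which a strictly larger letter occurs to the left of a strictly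 smaller one. For a word $w=i_1\cdots i_m$ in $\{1,\dots,n\}$ put $\tilde x^{w}=\tilde x_{i_1}\cdots\tilde x_{i_m}\in\mathrm{OPol}_n$. For a diagram $\lambda$: $N(\lambda)$ is the sum over boxes $B$ of the number of boxes in rows strictly above that of $B$ (in any column); $dN(\lambda)$ is the sum over boxes $B$ of the number of boxes in the same column as $B$ and strictly above it. (1) Combinatorial (Kostka) odd Schur functions $s^K_\lambda$: the odd Kostka numbers are $K_{\lambda\mu}=\mathrm{sign}(T_\lambda)\sum_{T\in SSYT(\lambda,\mu)}\mathrm{sign}(T)$. For each $k$ the integer matrix $(K_{\lambda\mu})_{\lambda,\mu\vdash k}$ is triangular with respect to the lexicographic order and unimodular, and the $s^K_\lambda$ ($\lambda\vdash k$) are defined by inverting the relations $h_\mu=\sum_{\lambda\vdash k}K_{\lambda\mu}s^K_\lambda$ for all $\mu\vdash k$, that is $s^K_\lambda=\sum_{\mu\vdash k}(K^{-1})_{\mu\lambda}h_\mu$, where $K=(K_{\lambda\mu})$. (2) Plactic odd Schur functions: $s^p_\lambda=(-1)^{dN(\lambda)+N(\lambda)}\sum_{T}\tilde x^{w_r(T)}\in\mathrm{OPol}_n$, the sum being over $T\in SSYT(\lambda)$ with entries in $\{1,\dots,n\}$. (3) Odd-symmetrized Schur functions: let $S_n$ act on $\mathrm{OPol}_n$ by ring automorphisms with the simple transposition $s_i=(i\ i{+}1)$ acting by $s_i(x_i)=-x_{i+1}$, $s_i(x_{i+1})=-x_i$, $s_i(x_j)=-x_j$ for $j\ne i,i+1$.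 The odd divided difference operator $\partial_i:\mathrm{OPol}_n\to\mathrm{OPol}_n$ ($1\le i\le n-1$) is the $\mathbb{Z}$-linear map determined by $\partial_i(x_j)=1$ if $j\in\{i,i+1\}$, $\partial_i(x_j)=0$ otherwise, and $\partial_i(fg)=\partial_i(f)g+s_i(f)\partial_i(g)$. Let $\partial_{w_0}=\partial_1(\partial_2\partial_1)\cdots(\partial_{n-1}\cdots\partial_1)$, and let $f^{w_0}$ denote the result of acting on $f$ by the longest element $w_0\in S_n$. For $\lambda$ with at most $n$ parts (padded with zeros), $$s^s_\lambda=(-1)^{\binom n3}\Bigl(\partial_{w_0}\bigl(x_1^{\lambda_1}\cdots x_n^{\lambda_n}\,x_1^{n-1}x_2^{n-2}\cdots x_{n-1}\bigr)\Bigr)^{w_0}.$$ *)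

theory Defs
  imports
    "HOL-Algebra.QuotRing"
    "HOL-Library.Poly_Mapping"
    "HOL-Library.FuncSet"
begin

section \<open>The ring of odd polynomials\<close>

text \<open>Words under concatenation. Finitely supported integer functions on words, with the
  convolution product of \<^theory>\<open>HOL-Library.Poly_Mapping\<close>, are the free associative ring on
  variables indexed by \<^typ>\<open>nat\<close>.\<close>

datatype fword = FWord (letters: "nat list")

instantiation fword :: monoid_add
begin

definition zero_fword :: fword where "0 = FWord []"

definition plus_fword :: "fword \<Rightarrow> fword \<Rightarrow> fword"
  where "u + v = FWord (letters u @ letters v)"

instance
  by standard (simp_all add: zero_fword_def plus_fword_def)

end

type_synonym free_poly = "fword \<Rightarrow>\<^sub>0 int"

definition free_var :: "nat \<Rightarrow> free_poly"
  where "free_var i = Poly_Mapping.single (FWord [i]) 1"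

definition free_ring :: "nat \<Rightarrow> free_poly ring"
  where "free_ring n =
    \<lparr>carrier = {f. \<forall>w \<in> Poly_Mapping.keys f. set (letters w) \<subseteq> {1..n}},
     mult = (*), one = 1, zero = 0, add = (+)\<rparr>"

definition opol_ideal :: "nat \<Rightarrow> free_poly set"
  where "opol_ideal n = genideal (free_ring n)
    {free_var i * free_var j + free_var j * free_var i | i j.
       i \<in> {1..n} \<and> j \<in> {1..n} \<and> i \<noteq> j}"

definition OPol :: "nat \<Rightarrow> free_poly set ring"
  where "OPol n = free_ring n Quot opol_ideal n"

definition opol_x :: "nat \<Rightarrow> nat \<Rightarrow> free_poly set"
  where "opol_x n i = opol_ideal n +>\<^bsub>free_ring n\<^esub> free_var i"

definition opol_xt :: "nat \<Rightarrow> nat \<Rightarrow> free_poly set"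
  where "opol_xt n i = [((-1 :: int) ^ (i - 1))] \<cdot>\<^bsub>OPol n\<^esub> opol_x n i"

text \<open>\<^const>\<open>OPol\<close> is not commutative, so all products are taken along lists.\<close>

definition ordered_prod :: "('a, 'b) ring_scheme \<Rightarrow> 'a list \<Rightarrow> 'a"
  where "ordered_prod R as = foldr (\<lambda>a b. a \<otimes>\<^bsub>R\<^esub> b) as \<one>\<^bsub>R\<^esub>"

definition opol_xt_word :: "nat \<Rightarrow> nat list \<Rightarrow> free_poly set"
  where "opol_xt_word n w = ordered_prod (OPol n) (map (opol_xt n) w)"

definition opol_h :: "nat \<Rightarrow> nat \<Rightarrow> free_poly set"
  where "opol_h n k =
    (\<Oplus>\<^bsub>OPol n\<^esub> w \<in> {w. length w = k \<and> sorted w \<and> set w \<subseteq> {1..n}}. opol_xt_word n w)"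

definition opol_h_prod :: "nat \<Rightarrow> nat list \<Rightarrow> free_poly set"
  where "opol_h_prod n \<mu> = ordered_prod (OPol n) (map (opol_h n) \<mu>)"


section \<open>Partitions and tableaux\<close>

definition is_partition :: "nat list \<Rightarrow> bool"
  where "is_partition lam \<longleftrightarrow> sorted_wrt (\<ge>) lam \<and> 0 \<notin> set lam"

definition partitions :: "nat \<Rightarrow> nat list set"
  where "partitions k = {lam. is_partition lam \<and> sum_list lam = k}"

text \<open>The parts are numbered from 1 and padded with zeros.\<close>

definition part :: "nat list \<Rightarrow> nat \<Rightarrow> nat"
  where "part lam i = (if 1 \<le> i \<and> i \<le> length lam then lam ! (i - 1) else 0)"

text \<open>Boxes are pairs (row, column), numbered from 0; row 0 is the top row.\<close>

definition boxes :: "nat list \<Rightarrow> (nat \<times> nat) set"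
  where "boxes lam = {(r, c). r < length lam \<and> c < lam ! r}"

definition N_stat :: "nat list \<Rightarrow> nat"
  where "N_stat lam = (\<Sum>B \<in> boxes lam. card {C \<in> boxes lam. fst C < fst B})"

definition dN_stat :: "nat list \<Rightarrow> nat"
  where "dN_stat lam =
    (\<Sum>B \<in> boxes lam. card {C \<in> boxes lam. snd C = snd B \<and> fst C < fst B})"

text \<open>A tableau is given by the list of its rows, from top to bottom.\<close>

definition SSYT :: "nat list \<Rightarrow> nat list list set"
  where "SSYT lam = {T. map length T = lam \<and>
    (\<forall>r \<in> set T. \<forall>a \<in> set r. 1 \<le> a) \<and>
    (\<forall>r \<in> set T. sorted r) \<and>
    (\<forall>r r' c. (r, c) \<in> boxes lam \<and> (r', c) \<in> boxes lam \<and> r < r' \<longrightarrow> T ! r ! c < T ! r' ! c)}"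

definition row_word :: "nat list list \<Rightarrow> nat list"
  where "row_word T = concat (rev T)"

definition SSYT_content :: "nat list \<Rightarrow> nat list \<Rightarrow> nat list list set"
  where "SSYT_content lam \<mu> = {T \<in> SSYT lam. \<forall>i. count_list (row_word T) i = part \<mu> i}"

definition word_sign :: "nat list \<Rightarrow> int"
  where "word_sign w = (-1) ^ card {(p, q). p < q \<and> q < length w \<and> w ! q < w ! p}"

definition tableau_sign :: "nat list list \<Rightarrow> int"
  where "tableau_sign T = word_sign (row_word T)"

definition canonical_tableau :: "nat list \<Rightarrow> nat list list"
  where "canonical_tableau lam = (THE T. T \<in> SSYT_content lam lam)"


section \<open>Combinatorial odd Schur functions\<close>

definition odd_Kostka :: "nat list \<Rightarrow> nat list \<Rightarrow> int"
  where "odd_Kostka lam \<mu> =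
    tableau_sign (canonical_tableau lam) * (\<Sum>T \<in> SSYT_content lam \<mu>. tableau_sign T)"

definition is_odd_Kostka_inverse :: "nat \<Rightarrow> (nat list \<Rightarrow> nat list \<Rightarrow> int) \<Rightarrow> bool"
  where "is_odd_Kostka_inverse k M \<longleftrightarrow>
    (\<forall>lam \<in> partitions k. \<forall>\<nu> \<in> partitions k.
      (\<Sum>\<mu> \<in> partitions k. odd_Kostka lam \<mu> * M \<mu> \<nu>) = (if lam = \<nu> then 1 else 0) \<and>
      (\<Sum>\<mu> \<in> partitions k. M lam \<mu> * odd_Kostka \<mu> \<nu>) = (if lam = \<nu> then 1 else 0))"

text \<open>Only the entries indexed by partitions of \<^term>\<open>k\<close> are determined, and only these are used.\<close>

definition odd_Kostka_inverse :: "nat \<Rightarrow> nat list \<Rightarrow> nat list \<Rightarrow> int"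
  where "odd_Kostka_inverse k = (SOME M. is_odd_Kostka_inverse k M)"

definition schur_K :: "nat \<Rightarrow> nat list \<Rightarrow> free_poly set"
  where "schur_K n lam =
    (\<Oplus>\<^bsub>OPol n\<^esub> \<mu> \<in> partitions (sum_list lam).
       [odd_Kostka_inverse (sum_list lam) \<mu> lam] \<cdot>\<^bsub>OPol n\<^esub> opol_h_prod n \<mu>)"


section \<open>Plactic odd Schur functions\<close>

definition schur_p :: "nat \<Rightarrow> nat list \<Rightarrow> free_poly set"
  where "schur_p n lam =
    [((-1 :: int) ^ (dN_stat lam + N_stat lam))] \<cdot>\<^bsub>OPol n\<^esub>
    (\<Oplus>\<^bsub>OPol n\<^esub> T \<in> {T \<in> SSYT lam. set (row_word T) \<subseteq> {1..n}}. opol_xt_word n (row_word T))"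


section \<open>Odd-symmetrized Schur functions\<close>

text \<open>The functions are required to be extensional so that they are uniquely determined
  as functions on the whole type.\<close>

definition is_opol_s :: "nat \<Rightarrow> nat \<Rightarrow> (free_poly set \<Rightarrow> free_poly set) \<Rightarrow> bool"
  where "is_opol_s n i \<sigma> \<longleftrightarrow>
    \<sigma> \<in> ring_hom (OPol n) (OPol n) \<and> \<sigma> \<in> extensional (carrier (OPol n)) \<and>
    \<sigma> (opol_x n i) = \<ominus>\<^bsub>OPol n\<^esub> opol_x n (i + 1) \<and>
    \<sigma> (opol_x n (i + 1)) = \<ominus>\<^bsub>OPol n\<^esub> opol_x n i \<and>
    (\<forall>j \<in> {1..n} - {i, i + 1}. \<sigma> (opol_x n j) = \<ominus>\<^bsub>OPol n\<^esub> opol_x n j)"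

definition opol_s :: "nat \<Rightarrow> nat \<Rightarrow> free_poly set \<Rightarrow> free_poly set"
  where "opol_s n i = (THE \<sigma>. is_opol_s n i \<sigma>)"

definition is_odd_divided_difference ::
    "nat \<Rightarrow> nat \<Rightarrow> (free_poly set \<Rightarrow> free_poly set) \<Rightarrow> bool"
  where "is_odd_divided_difference n i D \<longleftrightarrow>
    D \<in> carrier (OPol n) \<rightarrow>\<^sub>E carrier (OPol n) \<and>
    (\<forall>f \<in> carrier (OPol n). \<forall>g \<in> carrier (OPol n).
       D (f \<oplus>\<^bsub>OPol n\<^esub> g) = D f \<oplus>\<^bsub>OPol n\<^esub> D g) \<and>
    (\<forall>j \<in> {1..n}. D (opol_x n j) =
       (if j \<in> {i, i + 1} then \<one>\<^bsub>OPol n\<^esub> else \<zero>\<^bsub>OPol n\<^esub>)) \<and>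
    (\<forall>f \<in> carrier (OPol n). \<forall>g \<in> carrier (OPol n).
       D (f \<otimes>\<^bsub>OPol n\<^esub> g) =
         (D f \<otimes>\<^bsub>OPol n\<^esub> g) \<oplus>\<^bsub>OPol n\<^esub> (opol_s n i f \<otimes>\<^bsub>OPol n\<^esub> D g))"

definition odd_divided_difference :: "nat \<Rightarrow> nat \<Rightarrow> free_poly set \<Rightarrow> free_poly set"
  where "odd_divided_difference n i = (THE D. is_odd_divided_difference n i D)"

text \<open>The reduced word 1 (2 1) (3 2 1) ... (n-1 ... 1) of the longest element of the symmetric
  group on n letters. In the composites below the last letter of the word acts first.\<close>

definition w0_word :: "nat \<Rightarrow> nat list"
  where "w0_word n = concat (map (\<lambda>m. rev [1..<Suc m]) [1..<n])"

definition odd_divided_difference_w0 :: "nat \<Rightarrow> free_poly set \<Rightarrow> free_poly set"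
  where "odd_divided_difference_w0 n f = foldr (odd_divided_difference n) (w0_word n) f"

definition opol_w0 :: "nat \<Rightarrow> free_poly set \<Rightarrow> free_poly set"
  where "opol_w0 n f = foldr (opol_s n) (w0_word n) f"

definition opol_monom :: "nat \<Rightarrow> (nat \<Rightarrow> nat) \<Rightarrow> free_poly set"
  where "opol_monom n e =
    ordered_prod (OPol n) (map (\<lambda>i. opol_x n i [^]\<^bsub>OPol n\<^esub> e i) [1..<Suc n])"

definition schur_s :: "nat \<Rightarrow> nat list \<Rightarrow> free_poly set"
  where "schur_s n lam =
    [((-1 :: int) ^ (n choose 3))] \<cdot>\<^bsub>OPol n\<^esub>
    opol_w0 n (odd_divided_difference_w0 n
      (opol_monom n (part lam) \<otimes>\<^bsub>OPol n\<^esub> opol_monom n (\<lambda>i. n - i)))"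

end

theory Submission
  imports Defs "HOL-Combinatorics.Transposition"
begin

text \<open>All three families are compared inside one ring, the odd polynomials in infinitely many variables
with \<open>x\<^sub>i x\<^sub>j = - x\<^sub>j x\<^sub>i\<close> for distinct indices. The ring \<open>OPol n\<close> embeds into it, because setting the
variables outside \<open>1..n\<close> to zero maps the large ideal of relations into the small one. In it, every
word is a sign times a sorted word, and the proof is a matter of matching sums of tableaux or of
monomials together with their signs.

Plactic functions. Deleting all copies of the largest letter \<open>N\<close> from a semistandard tableau leaves a
tableau whose shape differs by a horizontal strip, and moving those letters to the end of the row
word costs a sign that depends only on the two shapes. The sum of the row words (\<open>tab_sum\<close>) and the
signed counts of tableaux of given content (\<open>wkostka\<close>) therefore obey the same recursion over
horizontal strips. The signs of tableaux and strips are values of one bilinear form, \<open>inv_form\<close>.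
A local rule on pairs of horizontal strips (\<open>toggle\<close>), which matches these signs, turns the recursion
into the Pieri rule \<open>S\<^sub>\<lambda> h\<^sub>k = \<Sum> \<plusminus> S\<^sub>\<mu>\<close> over horizontal strips (\<open>tab_sum_hsym\<close>). It plays the part of
the Robinson-Schensted-Knuth correspondence. Iterating it expands \<open>h\<^sub>\<mu>\<close> with coefficients that satisfy
the recursion of the odd Kostka numbers, and the remaining signs are those in the definition of the
plactic functions (\<open>hsym_product_plactic\<close>). The odd Kostka matrix is unitriangular for the dominance
order, so it can be inverted: the combinatorial and the plactic functions agree.

Odd-symmetrized functions. Both the plactic and the odd-symmetrized functions obey the same rule for
right multiplication by the elementary functions \<open>e\<^sub>k\<close> taken over decreasing words. For the plactic
functions it follows from the rule for \<open>h\<^sub>k\<close>, the identity \<open>\<Sum> (-1)\<^sup>i e\<^sub>i h\<^sub>k\<^sub>-\<^sub>i = 0\<close> for \<open>k > 0\<close>, and an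
involution that moves one box (\<open>tab_sum_esym_rev\<close>). For the odd-symmetrized functions it holds because
every odd divided difference annihilates the elementary functions over increasing words, which the
longest element turns into those over decreasing words, up to a sign. The product can therefore be
taken before symmetrization, where it is one with a sum of square-free monomials, and all exponents
that do not come from a partition are annihilated (\<open>sym_schur_esym_rev_shape\<close>). The rule determines the functions: removing the first column of \<open>\<lambda>\<close> and
multiplying by the elementary function of its length returns \<open>\<lambda>\<close>, and every other term has more rows
(\<open>sym_schur_eq_plactic\<close>).\<close>

section \<open>Odd polynomials in infinitely many variables\<close>

text \<open>Evaluation of a noncommutative polynomial at arbitrary elements of a ring. Every map out of the free
ring below is of this form.\<close>

definition free_eval :: "(nat \<Rightarrow> 'a::ring_1) \<Rightarrow> free_poly \<Rightarrow> 'a"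
  where "free_eval v f =
    (\<Sum>w\<in>Poly_Mapping.keys f. of_int (Poly_Mapping.lookup f w) * prod_list (map v (letters w)))"

lemma free_eval_superset:
  assumes "finite K" and "Poly_Mapping.keys f \<subseteq> K"
  shows "free_eval v f = (\<Sum>w\<in>K. of_int (Poly_Mapping.lookup f w) * prod_list (map v (letters w)))"
  unfolding free_eval_def
  by (rule sum.mono_neutral_left) (use assms in \<open>auto simp: in_keys_iff\<close>)

lemma free_eval_zero [simp]: "free_eval v 0 = 0"
  by (simp add: free_eval_def)

lemma free_eval_diff: "free_eval v (f - g) = free_eval v f - free_eval v g"
proof -
  let ?K = "Poly_Mapping.keys f \<union> Poly_Mapping.keys g"
  have "Poly_Mapping.keys (f - g) \<subseteq> ?K"
    by (rule keys_diff)
  then show ?thesis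
    by (simp add: free_eval_superset[of ?K] lookup_minus sum_subtractf left_diff_distrib)
qed

lemma free_eval_uminus: "free_eval v (- f) = - free_eval v f"
  using free_eval_diff[of v 0 f] by simp

lemma free_eval_add: "free_eval v (f + g) = free_eval v f + free_eval v g"
  using free_eval_diff[of v f "- g"] by (simp add: free_eval_uminus)

lemma free_eval_word: "free_eval v (Poly_Mapping.single w 1) = prod_list (map v (letters w))"
  by (simp add: free_eval_def)

lemma free_eval_var [simp]: "free_eval v (free_var i) = v i"
  by (simp add: free_var_def free_eval_word)

lemma free_eval_one [simp]: "free_eval v 1 = 1"
proof -
  have "free_eval v (Poly_Mapping.single 0 1) = 1"
    by (simp only: free_eval_word zero_fword_def fword.sel list.map prod_list.Nil)
  then show ?thesis by (simp only: single_one)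
qed

lemma free_poly_induct [case_names zero word diff]:
  assumes "P 0" and "\<And>w. P (Poly_Mapping.single w 1)" and "\<And>f g. P f \<Longrightarrow> P g \<Longrightarrow> P (f - g)"
  shows "P (f :: free_poly)"
  by (rule frag_induction[of f UNIV]) (use assms in auto)

lemma free_eval_mult: "free_eval v (f * g) = free_eval v f * free_eval v g"
proof (induction f rule: free_poly_induct)
  case (word u)
  show ?case
    by (induction g rule: free_poly_induct)
       (simp_all add: mult_single free_eval_word plus_fword_def right_diff_distrib free_eval_diff)
qed (simp_all add: left_diff_distrib free_eval_diff)

lemma single_word: "Poly_Mapping.single w 1 = prod_list (map free_var (letters w))"
proof (cases w)
  case (FWord xs)
  have "Poly_Mapping.single (FWord xs) (1::int) = prod_list (map free_var xs)"
  proof (induction xs)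
    case Nil
    show ?case by (simp flip: zero_fword_def)
  next
    case (Cons x xs)
    have "Poly_Mapping.single (FWord (x # xs)) (1::int)
        = Poly_Mapping.single (FWord [x]) 1 * Poly_Mapping.single (FWord xs) 1"
      by (simp add: mult_single plus_fword_def)
    then show ?case by (simp add: Cons free_var_def)
  qed
  then show ?thesis by (simp add: FWord)
qed

lemma free_eval_cong:
  assumes "f \<in> carrier (free_ring n)" and "\<And>i. i \<in> {1..n} \<Longrightarrow> v i = v' i"
  shows "free_eval v f = free_eval v' f"
  unfolding free_eval_def
proof (rule sum.cong)
  fix w assume "w \<in> Poly_Mapping.keys f"
  then have "set (letters w) \<subseteq> {1..n}"
    using assms by (auto simp: free_ring_def)
  then have "map v (letters w) = map v' (letters w)"
    using assms(2) by (intro map_cong) auto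
  then show "of_int (Poly_Mapping.lookup f w) * prod_list (map v (letters w)) =
    of_int (Poly_Mapping.lookup f w) * prod_list (map v' (letters w))"
    by (rule arg_cong)
qed simp

lemma free_eval_free_var: "free_eval free_var f = f"
  by (induction f rule: free_poly_induct)
    (simp_all add: free_eval_word free_eval_diff flip: single_word)

text \<open>The two-sided ideal of the skew relations among all variables. It is described inductively, so that a
claim about its members only has to be checked on the relations.\<close>

inductive_set skew_ideal :: "free_poly set" where
  gen: "i \<noteq> j \<Longrightarrow> a * (free_var i * free_var j + free_var j * free_var i) * b \<in> skew_ideal"
| zero: "0 \<in> skew_ideal"
| add: "f \<in> skew_ideal \<Longrightarrow> g \<in> skew_ideal \<Longrightarrow> f + g \<in> skew_ideal"

lemma skew_ideal_lmult: "f \<in> skew_ideal \<Longrightarrow> a * f \<in> skew_ideal"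
proof (induction rule: skew_ideal.induct)
  case (gen i j c b)
  then show ?case using skew_ideal.gen[of i j "a * c" b] by (simp add: mult.assoc)
qed (auto intro: skew_ideal.intros simp: distrib_left)

lemma skew_ideal_rmult: "f \<in> skew_ideal \<Longrightarrow> f * a \<in> skew_ideal"
proof (induction rule: skew_ideal.induct)
  case (gen i j c b)
  then show ?case using skew_ideal.gen[of i j "c" "b * a"] by (simp add: mult.assoc)
qed (auto intro: skew_ideal.intros simp: distrib_right)

lemma skew_ideal_uminus: "f \<in> skew_ideal \<Longrightarrow> - f \<in> skew_ideal"
  using skew_ideal_lmult[of f "-1"] by simp

lemma free_eval_skew_ideal:
  assumes "\<And>i j. i \<noteq> j \<Longrightarrow> v i * v j + v j * v i = 0" and "f \<in> skew_ideal"
  shows "free_eval v f = 0"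
  using assms(2)
  by (induction rule: skew_ideal.induct)
    (simp_all add: free_eval_mult free_eval_add assms(1))

definition skew_eq :: "free_poly \<Rightarrow> free_poly \<Rightarrow> bool"
  where "skew_eq f g \<longleftrightarrow> f - g \<in> skew_ideal"

lemma equivp_skew_eq: "equivp skew_eq"
proof (rule equivpI)
  show "reflp skew_eq"
    by (auto intro!: reflpI simp: skew_eq_def skew_ideal.zero)
  show "symp skew_eq"
    using skew_ideal_uminus by (fastforce intro!: sympI simp: skew_eq_def)
  show "transp skew_eq"
    using skew_ideal.add by (fastforce intro!: transpI simp: skew_eq_def)
qed

quotient_type skew_poly = free_poly / skew_eq
  morphisms rep_skew abs_skew
  by (rule equivp_skew_eq)

instantiation skew_poly :: ring_1
begin

lift_definition zero_skew_poly :: skew_poly is 0 .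
lift_definition one_skew_poly :: skew_poly is 1 .

lift_definition plus_skew_poly :: "skew_poly \<Rightarrow> skew_poly \<Rightarrow> skew_poly" is "(+)"
  unfolding skew_eq_def using skew_ideal.add by (fastforce simp: algebra_simps)

lift_definition minus_skew_poly :: "skew_poly \<Rightarrow> skew_poly \<Rightarrow> skew_poly" is "(-)"
proof -
  fix f f' g g' assume "skew_eq f f'" "skew_eq g g'"
  then have "(f - f') + - (g - g') \<in> skew_ideal"
    unfolding skew_eq_def by (intro skew_ideal.add skew_ideal_uminus)
  then show "skew_eq (f - g) (f' - g')"
    by (simp add: skew_eq_def algebra_simps)
qed

lift_definition uminus_skew_poly :: "skew_poly \<Rightarrow> skew_poly" is uminus
  unfolding skew_eq_def using skew_ideal_uminus by fastforce

lift_definition times_skew_poly :: "skew_poly \<Rightarrow> skew_poly \<Rightarrow> skew_poly" is "(*)"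
proof -
  fix f f' g g' assume "skew_eq f f'" "skew_eq g g'"
  then have "(f - f') * g + f' * (g - g') \<in> skew_ideal"
    unfolding skew_eq_def by (intro skew_ideal.add skew_ideal_lmult skew_ideal_rmult)
  then show "skew_eq (f * g) (f' * g')"
    by (simp add: skew_eq_def algebra_simps)
qed

instance
proof
  show "(0::skew_poly) \<noteq> 1"
  proof (transfer, rule notI)
    assume "skew_eq 0 1"
    then have "free_eval (\<lambda>_. 0 :: int) (0 - 1) = 0"
      unfolding skew_eq_def by (rule free_eval_skew_ideal[rotated]) simp
    then show False by (simp add: free_eval_uminus)
  qed
  fix a b c :: skew_poly
  have eq: "f = g \<Longrightarrow> skew_eq f g" for f g
    by (simp add: skew_eq_def skew_ideal.zero)
  show "a + b + c = a + (b + c)" by transfer (simp add: eq algebra_simps)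
  show "a + b = b + a" by transfer (simp add: eq algebra_simps)
  show "0 + a = a" by transfer (simp add: eq)
  show "- a + a = 0" by transfer (simp add: eq)
  show "a - b = a + - b" by transfer (simp add: eq)
  show "a * b * c = a * (b * c)" by transfer (simp add: eq algebra_simps)
  show "1 * a = a" by transfer (simp add: eq)
  show "a * 1 = a" by transfer (simp add: eq)
  show "(a + b) * c = a * c + b * c" by transfer (simp add: eq algebra_simps)
  show "a * (b + c) = a * b + a * c" by transfer (simp add: eq algebra_simps)
qed

end

lemma abs_skew_rep: "abs_skew (rep_skew p) = p"
  by (rule Quotient3_abs_rep[OF Quotient3_skew_poly])

definition X :: "nat \<Rightarrow> skew_poly"
  where "X i = abs_skew (free_var i)"

lemma abs_skew_hom:
  "abs_skew (f + g) = abs_skew f + abs_skew g"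
  "abs_skew (f - g) = abs_skew f - abs_skew g"
  "abs_skew (f * g) = abs_skew f * abs_skew g"
  "abs_skew 1 = 1" "abs_skew 0 = 0"
  by (simp_all add: plus_skew_poly.abs_eq minus_skew_poly.abs_eq times_skew_poly.abs_eq
      one_skew_poly.abs_eq zero_skew_poly.abs_eq)

lemma abs_skew_eq_0_iff: "abs_skew f = 0 \<longleftrightarrow> f \<in> skew_ideal"
  by (simp add: zero_skew_poly.abs_eq skew_poly.abs_eq_iff skew_eq_def)

lemma X_anticommute: "i \<noteq> j \<Longrightarrow> X i * X j = - (X j * X i)"
proof -
  assume "i \<noteq> j"
  from skew_ideal.gen[OF this, of 1 1] have "X i * X j + X j * X i = 0"
    by (simp add: X_def abs_skew_eq_0_iff flip: abs_skew_hom(1,3))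
  then show ?thesis by (simp add: eq_neg_iff_add_eq_0)
qed

definition skew_eval :: "(nat \<Rightarrow> 'a::ring_1) \<Rightarrow> skew_poly \<Rightarrow> 'a"
  where "skew_eval v p = free_eval v (rep_skew p)"

context
  fixes v :: "nat \<Rightarrow> 'a::ring_1"
  assumes anti: "\<And>i j. i \<noteq> j \<Longrightarrow> v i * v j = - (v j * v i)"
begin

text \<open>The universal property of the ring of odd polynomials: anticommuting elements of any ring define a
ring homomorphism.\<close>

lemma skew_eval_abs: "skew_eval v (abs_skew f) = free_eval v f"
proof -
  have "abs_skew (rep_skew (abs_skew f)) = abs_skew f"
    by (rule abs_skew_rep)
  then have "rep_skew (abs_skew f) - f \<in> skew_ideal"
    by (simp add: skew_poly.abs_eq_iff skew_eq_def)
  then have "free_eval v (rep_skew (abs_skew f) - f) = 0"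
    by (rule free_eval_skew_ideal[rotated]) (metis anti eq_neg_iff_add_eq_0)
  then show ?thesis by (simp add: skew_eval_def free_eval_diff)
qed

lemma skew_eval_hom:
  "skew_eval v (p + q) = skew_eval v p + skew_eval v q"
  "skew_eval v (p - q) = skew_eval v p - skew_eval v q"
  "skew_eval v (p * q) = skew_eval v p * skew_eval v q"
  "skew_eval v 1 = 1" "skew_eval v 0 = 0" "skew_eval v (X i) = v i"
proof -
  obtain f g where p: "p = abs_skew f" and q: "q = abs_skew g"
    using abs_skew_rep by metis
  show "skew_eval v (p + q) = skew_eval v p + skew_eval v q"
    "skew_eval v (p - q) = skew_eval v p - skew_eval v q"
    "skew_eval v (p * q) = skew_eval v p * skew_eval v q"
    unfolding p q
    by (simp_all add: skew_eval_abs free_eval_add free_eval_diff free_eval_mult flip: abs_skew_hom)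
  show "skew_eval v 1 = 1" "skew_eval v 0 = 0" "skew_eval v (X i) = v i"
    by (simp_all add: skew_eval_abs X_def flip: abs_skew_hom)
qed

end

text \<open>Words are built by left multiplication with variables, so an operator identity can be checked by
multiplying with one variable at a time.\<close>

lemma skew_poly_induct [case_names zero one var_mult diff]:
  assumes zero: "P 0" and one: "P 1" and var_mult: "\<And>i p. P p \<Longrightarrow> P (X i * p)"
    and diff: "\<And>p q. P p \<Longrightarrow> P q \<Longrightarrow> P (p - q)"
  shows "P p"
proof -
  have "P (abs_skew f)" for f
  proof (induction f rule: free_poly_induct)
    case (word w)
    have "P (abs_skew (prod_list (map free_var xs)))" for xs
      by (induction xs) (simp_all add: abs_skew_hom one var_mult flip: X_def)
    then show ?case by (simp only: single_word)
  qed (simp_all add: abs_skew_hom zero diff)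
  from this[of "rep_skew p"] show ?thesis
    by (simp only: abs_skew_rep)
qed

section \<open>The symmetric group action and odd divided differences\<close>

text \<open>Upper triangular two-by-two matrices. A twisted derivation \<open>d\<close> over an endomorphism \<open>s\<close>, that is
\<open>d (f g) = d f g + s f d g\<close>, is the same as a ring homomorphism \<open>f \<mapsto> (s f, d f; 0, f)\<close> into such
matrices. The universal property of the odd polynomials thus yields \<open>s\<close> and \<open>d\<close> together.\<close>

datatype 'a tri = Tri (ul: 'a) (ur: 'a) (lr: 'a)

instantiation tri :: (ring_1) ring_1
begin

definition "0 = Tri 0 0 0"
definition "1 = Tri 1 0 1"
definition "p + q = Tri (ul p + ul q) (ur p + ur q) (lr p + lr q)"
definition "p - q = Tri (ul p - ul q) (ur p - ur q) (lr p - lr q)"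
definition "- p = Tri (- ul p) (- ur p) (- lr p)"
definition "p * q = Tri (ul p * ul q) (ul p * ur q + ur p * lr q) (lr p * lr q)"

instance
  by standard
    (simp_all add: zero_tri_def one_tri_def plus_tri_def minus_tri_def uminus_tri_def times_tri_def
      algebra_simps)

end

definition twist_mat :: "nat \<Rightarrow> nat \<Rightarrow> skew_poly tri"
  where "twist_mat i j = Tri (- X (transpose i (i + 1) j)) (if j = i \<or> j = i + 1 then 1 else 0) (X j)"

lemma twist_mat_anticommute: "j \<noteq> k \<Longrightarrow> twist_mat i j * twist_mat i k = - (twist_mat i k * twist_mat i j)"
  using X_anticommute[of j k] X_anticommute[of "transpose i (i+1) j" "transpose i (i+1) k"]
  by (auto simp: twist_mat_def times_tri_def uminus_tri_def transpose_def split: if_splits)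

definition sact :: "nat \<Rightarrow> skew_poly \<Rightarrow> skew_poly"
  where "sact i p = ul (skew_eval (twist_mat i) p)"

definition ddiff :: "nat \<Rightarrow> skew_poly \<Rightarrow> skew_poly"
  where "ddiff i p = ur (skew_eval (twist_mat i) p)"

lemmas twist_eval_hom = skew_eval_hom[of "twist_mat i" for i, OF twist_mat_anticommute]

lemma lr_twist_mat: "lr (twist_mat i j) = X j"
  by (simp add: twist_mat_def)

text \<open>The lower right entry recovers the argument, which is what makes the upper right entry a twisted
derivation.\<close>

lemma lr_twist_eval: "lr (skew_eval (twist_mat i) p) = p"
  by (induction p rule: skew_poly_induct)
    (simp_all add: twist_eval_hom zero_tri_def one_tri_def minus_tri_def times_tri_def lr_twist_mat)

lemma sact_hom [simp]:
  "sact i (p + q) = sact i p + sact i q"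
  "sact i (p - q) = sact i p - sact i q"
  "sact i (p * q) = sact i p * sact i q"
  "sact i 1 = 1" "sact i 0 = 0"
  by (simp_all add: sact_def twist_eval_hom zero_tri_def one_tri_def plus_tri_def minus_tri_def
      times_tri_def)

lemma sact_X: "sact i (X j) = - X (transpose i (i + 1) j)"
  by (simp add: sact_def twist_eval_hom twist_mat_def)

lemma ddiff_linear [simp]:
  "ddiff i (p + q) = ddiff i p + ddiff i q"
  "ddiff i (p - q) = ddiff i p - ddiff i q"
  "ddiff i 1 = 0" "ddiff i 0 = 0"
  by (simp_all add: ddiff_def twist_eval_hom zero_tri_def one_tri_def plus_tri_def minus_tri_def
      times_tri_def)

lemma ddiff_mult: "ddiff i (p * q) = ddiff i p * q + sact i p * ddiff i q"
  by (simp add: ddiff_def sact_def twist_eval_hom times_tri_def lr_twist_eval)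

lemma ddiff_X: "ddiff i (X j) = (if j = i \<or> j = i + 1 then 1 else 0)"
  by (simp add: ddiff_def twist_eval_hom twist_mat_def)

lemma sact_uminus [simp]: "sact i (- p) = - sact i p"
  using sact_hom(2)[of i 0 p] by (simp del: sact_hom(2))

lemma ddiff_uminus [simp]: "ddiff i (- p) = - ddiff i p"
  using ddiff_linear(2)[of i 0 p] by (simp del: ddiff_linear(2))

lemma sact_power [simp]: "sact i (p ^ k) = sact i p ^ k"
  by (induction k) simp_all

lemma ddiff_power_eq_0: "ddiff i p = 0 \<Longrightarrow> ddiff i (p ^ k) = 0"
  by (induction k) (simp_all add: ddiff_mult)

lemma ddiff_sign [simp]: "ddiff i ((-1) ^ k * p) = (-1) ^ k * ddiff i p"
  by (simp add: ddiff_mult ddiff_power_eq_0)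

lemma sign_commute: "p * (-1) ^ k = (-1) ^ k * (p :: 'a::ring_1)"
  by (cases "even k") simp_all

lemma ddiff_ddiff: "ddiff i (ddiff i p) = 0"
  by (induction p rule: skew_poly_induct)
    (auto simp: ddiff_mult sact_X ddiff_X)

text \<open>Odd divided differences with distant indices anticommute, whereas their even counterparts commute.\<close>

lemma ddiff_far:
  assumes "i + 1 < k \<or> k + 1 < i"
  shows "ddiff i (ddiff k p) = - ddiff k (ddiff i p)"
proof (induction p rule: skew_poly_induct)
  case (var_mult j p)
  then show ?case
    using assms by (auto simp: ddiff_mult sact_X ddiff_X transpose_def)
qed simp_all

text \<open>Multiplying by one variable produces only constants as first-order coefficients, so that most of the
terms of the Leibniz expansion vanish, and the rest cancels by \<open>ddiff_ddiff\<close> and induction.\<close>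

lemma ddiff_braid:
  "ddiff i (ddiff (i + 1) (ddiff i p)) = ddiff (i + 1) (ddiff i (ddiff (i + 1) p))"
proof (induction p rule: skew_poly_induct)
  case (var_mult j p)
  then show ?case
    by (auto simp: ddiff_mult sact_X ddiff_X ddiff_ddiff transpose_def)
qed simp_all

definition dw0 :: "nat \<Rightarrow> skew_poly \<Rightarrow> skew_poly"
  where "dw0 n f = foldr ddiff (w0_word n) f"

text \<open>The factor of the longest word that contains the largest index once; it acts with index 1 first.\<close>

definition dchain :: "nat \<Rightarrow> skew_poly \<Rightarrow> skew_poly"
  where "dchain m f = foldr ddiff (rev [1..<Suc m]) f"

lemma w0_word_Suc: "w0_word (Suc n) = w0_word n @ rev [1..<Suc n]"
  by (cases n) (simp_all add: w0_word_def)

lemma w0_word_0 [simp]: "w0_word 0 = []"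
  by (simp add: w0_word_def)

lemma dw0_Suc: "dw0 (Suc n) f = dw0 n (dchain n f)"
  by (simp add: dw0_def dchain_def w0_word_Suc)

lemma dw0_0 [simp]: "dw0 0 f = f"
  by (simp add: dw0_def)

lemma dchain_0 [simp]: "dchain 0 f = f"
  by (simp add: dchain_def)

lemma dchain_Suc: "dchain (Suc m) f = ddiff (Suc m) (dchain m f)"
  by (simp add: dchain_def)

lemma foldr_ddiff_linear:
  "foldr ddiff w (p + q) = foldr ddiff w p + foldr ddiff w q"
  "foldr ddiff w 0 = 0"
  "foldr ddiff w ((-1) ^ k * p) = (-1) ^ k * foldr ddiff w p"
  by (induction w) simp_all

text \<open>Elements that are annihilated by the divided differences behave like constants on the right. On the
left, the twist would interfere.\<close>

lemma foldr_ddiff_rmult: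
  assumes "\<And>i. i \<in> set w \<Longrightarrow> ddiff i e = 0"
  shows "foldr ddiff w (f * e) = foldr ddiff w f * e"
  using assms by (induction w) (simp_all add: ddiff_mult)

lemma set_w0_word: "set (w0_word n) = {1..<n}"
  by (induction n) (auto simp: w0_word_Suc)

lemma ddiff_dchain_far:
  assumes "ddiff i g = 0" and "m + 2 \<le> i"
  shows "ddiff i (dchain m g) = 0"
  using assms(2)
proof (induction m)
  case (Suc m)
  then have "ddiff i (ddiff (Suc m) (dchain m g)) = - ddiff (Suc m) (ddiff i (dchain m g))"
    by (intro ddiff_far) simp
  then show ?case using Suc by (simp add: dchain_Suc)
qed (simp add: assms)

text \<open>The braid relation shifts the index of the divided difference down by one as it passes through the
chain.\<close>

lemma ddiff_dchain:
  assumes "ddiff (Suc i) g = 0" and "Suc i \<le> m" and "1 \<le> i"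
  shows "ddiff i (dchain m g) = 0"
  using assms(2)
proof (induction m rule: dec_induct)
  case base
  obtain t where t: "i = Suc t" using assms(3) by (cases i) auto
  have "ddiff (Suc i) (dchain t g) = 0"
    by (rule ddiff_dchain_far) (use assms t in auto)
  then show ?case
    using ddiff_braid[of i "dchain t g"] by (simp add: t dchain_Suc)
next
  case (step m)
  have "ddiff i (ddiff (Suc m) (dchain m g)) = - ddiff (Suc m) (ddiff i (dchain m g))"
    by (rule ddiff_far) (use step in simp)
  then show ?case using step by (simp add: dchain_Suc)
qed

text \<open>This replaces the exchange of reduced words of the longest element: an element of the kernel is
carried by the successive chains to the kernel of the first index, and there the next chain, which
begins with that index, annihilates it.\<close>

lemma dw0_eq_0:
  assumes "ddiff i g = 0" and "1 \<le> i" and "i < n"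
  shows "dw0 n g = 0"
  using assms
proof (induction n arbitrary: i g)
  case (Suc n)
  show ?case
  proof (cases "i = 1")
    case True
    have "dchain m g = 0" if "1 \<le> m" for m
      using that by (induction m rule: dec_induct) (use Suc.prems True in \<open>simp_all add: dchain_Suc\<close>)
    then show ?thesis
      using Suc.prems True by (simp add: dw0_Suc) (simp add: dw0_def foldr_ddiff_linear)
  next
    case False
    then obtain t where t: "i = Suc t" "1 \<le> t" using Suc.prems by (cases i) auto
    have "ddiff t (dchain n g) = 0"
      by (rule ddiff_dchain) (use Suc.prems t in auto)
    then have "dw0 n (dchain n g) = 0"
      using Suc.IH[of t] Suc.prems t by simp
    then show ?thesis by (simp add: dw0_Suc)
  qed
qed simp

section \<open>Elementary odd symmetric polynomials and the longest element\<close>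

text \<open>With these signs the transposition \<open>s\<^sub>i\<close> exchanges the variables with indices \<open>i\<close> and \<open>i + 1\<close> without
a sign, and negates the others (\<open>sact_xt\<close>).\<close>

definition xt :: "nat \<Rightarrow> skew_poly"
  where "xt i = (-1) ^ (i - 1) * X i"

lemma xt_anticommute: "i \<noteq> j \<Longrightarrow> xt i * xt j = - (xt j * xt i)"
proof -
  assume "i \<noteq> j"
  have "xt i * xt j = (-1) ^ (i - 1) * (-1) ^ (j - 1) * (X i * X j)"
    by (metis xt_def mult.assoc sign_commute)
  moreover have "xt j * xt i = (-1) ^ (i - 1) * (-1) ^ (j - 1) * (X j * X i)"
    by (metis xt_def mult.assoc sign_commute)
  ultimately show ?thesis
    using X_anticommute[OF \<open>i \<noteq> j\<close>] by simp
qed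

lemma sact_xt:
  assumes "1 \<le> i" and "1 \<le> j"
  shows "sact i (xt j) = (if j = i then xt (i + 1) else if j = i + 1 then xt i else - xt j)"
proof -
  obtain k where "i = Suc k" using assms by (cases i) auto
  then show ?thesis
    by (auto simp: xt_def sact_X transpose_def)
qed

lemma sact_xt_other: "1 \<le> i \<Longrightarrow> 1 \<le> j \<Longrightarrow> j \<noteq> i \<Longrightarrow> j \<noteq> i + 1 \<Longrightarrow> sact i (xt j) = - xt j"
  by (simp add: sact_xt)

lemma ddiff_xt: "ddiff i (xt j) = (if j = i \<or> j = i + 1 then (-1) ^ (j - 1) else 0)"
  by (simp add: xt_def ddiff_X)

text \<open>The elementary functions of a list of ring elements, with each product taken in the order of the
list.\<close>

fun elem_sym :: "'a::ring_1 list \<Rightarrow> nat \<Rightarrow> 'a" where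
  "elem_sym vs 0 = 1"
| "elem_sym [] (Suc k) = 0"
| "elem_sym (v # vs) (Suc k) = elem_sym vs (Suc k) + v * elem_sym vs k"

lemma elem_sym_snoc: "elem_sym (vs @ [v]) (Suc k) = elem_sym vs (Suc k) + elem_sym vs k * v"
proof (induction vs arbitrary: k)
  case Nil
  show ?case by (cases k) simp_all
next
  case (Cons u vs)
  then show ?case by (cases k) (simp_all add: algebra_simps)
qed

lemma ddiff_elem_sym_eq_0: "(\<And>v. v \<in> set vs \<Longrightarrow> ddiff i v = 0) \<Longrightarrow> ddiff i (elem_sym vs k) = 0"
  by (induction vs k rule: elem_sym.induct) (simp_all add: ddiff_mult)

definition esym :: "nat \<Rightarrow> nat \<Rightarrow> skew_poly"
  where "esym n k = elem_sym (map xt [1..<Suc n]) k"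

text \<open>The elementary function over decreasing words; the longest element maps the increasing one to it up to
a sign (\<open>sw0_esym\<close>).\<close>

definition esym_rev :: "nat \<Rightarrow> nat \<Rightarrow> skew_poly"
  where "esym_rev n k = elem_sym (rev (map xt [1..<Suc n])) k"

lemma esym_0 [simp]: "esym n 0 = 1"
  by (simp add: esym_def)

lemma esym_Suc: "esym (Suc n) (Suc k) = esym n (Suc k) + esym n k * xt (Suc n)"
  by (simp add: esym_def elem_sym_snoc del: upt_Suc add: upt_Suc_append)

lemma esym_rev_0 [simp]: "esym_rev n 0 = 1" "esym_rev 0 (Suc k) = 0"
  by (simp_all add: esym_rev_def)

lemma esym_rev_Suc: "esym_rev (Suc n) (Suc k) = esym_rev n (Suc k) + xt (Suc n) * esym_rev n k"
  by (simp add: esym_rev_def del: upt_Suc add: upt_Suc_append)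

text \<open>In the variables \<open>i\<close> and \<open>i + 1\<close>, the elementary function contains only their sum and their ordered
product, and both are annihilated.\<close>

lemma ddiff_esym:
  assumes "1 \<le> i" and "i < n"
  shows "ddiff i (esym n k) = 0"
proof -
  have "Suc i \<le> n" using assms by simp
  then show ?thesis
  proof (induction n arbitrary: k rule: dec_induct)
    case base
    obtain t where t: "i = Suc t" using assms by (cases i) auto
    have z: "ddiff i (esym t k) = 0" for k
      unfolding esym_def by (rule ddiff_elem_sym_eq_0) (auto simp: ddiff_xt t)
    show ?case
    proof (cases k)
      case (Suc k')
      show ?thesis
        by (cases k') (simp_all add: Suc esym_Suc t ddiff_mult ddiff_xt sact_xt z[unfolded t] distrib_right
            mult.assoc sign_commute)
    qed simp
  next
    case (step n)
    show ?case
    proof (cases k)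
      case (Suc k')
      then show ?thesis
        using step by (simp add: esym_Suc ddiff_mult ddiff_xt)
    qed simp
  qed
qed

lemma dw0_mult_esym: "dw0 n (f * esym n k) = dw0 n f * esym n k"
  unfolding dw0_def by (rule foldr_ddiff_rmult) (auto simp: set_w0_word ddiff_esym)

definition sw0 :: "nat \<Rightarrow> skew_poly \<Rightarrow> skew_poly"
  where "sw0 n f = foldr sact (w0_word n) f"

lemma foldr_sact_hom:
  "foldr sact w (p + q) = foldr sact w p + foldr sact w q"
  "foldr sact w (p * q) = foldr sact w p * foldr sact w q"
  "foldr sact w 1 = 1" "foldr sact w 0 = 0" "foldr sact w (- p) = - foldr sact w p"
  "foldr sact w (p ^ k) = foldr sact w p ^ k"
  by (induction w) simp_all

lemma foldr_sact_elem_sym: "foldr sact w (elem_sym vs k) = elem_sym (map (foldr sact w) vs) k"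
  by (induction vs k rule: elem_sym.induct) (simp_all add: foldr_sact_hom)

lemma foldr_sact_chain:
  assumes "1 \<le> j"
  shows "foldr sact (rev [1..<Suc m]) (xt j) =
    (if j = 1 then xt (Suc m) else if j \<le> Suc m then (-1) ^ (m - 1) * xt (j - 1)
     else (-1) ^ m * xt j)"
proof (induction m)
  case 0
  then show ?case using assms by simp
next
  case (Suc m)
  have "foldr sact (rev [1..<Suc (Suc m)]) (xt j) = sact (Suc m) (foldr sact (rev [1..<Suc m]) (xt j))"
    by simp
  also note Suc
  also have "sact (Suc m) (if j = 1 then xt (Suc m) else if j \<le> Suc m then (-1) ^ (m - 1) * xt (j - 1)
     else (-1) ^ m * xt j) = (if j = 1 then xt (Suc (Suc m)) else if j \<le> Suc (Suc m)
       then (-1) ^ (Suc m - 1) * xt (j - 1) else (-1) ^ Suc m * xt j)"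
    using assms by (cases m) (auto simp: sact_xt not_le le_Suc_eq[of j "Suc 0"])
  finally show ?case .
qed

lemma foldr_sact_far:
  assumes "\<And>i. i \<in> set w \<Longrightarrow> 1 \<le> i \<and> i + 1 < j"
  shows "foldr sact w (xt j) = (-1) ^ length w * xt j"
  using assms
proof (induction w)
  case (Cons i w)
  then have "sact i (xt j) = - xt j"
    by (intro sact_xt_other) fastforce+
  with Cons show ?case by simp
qed simp

lemma length_w0_word: "length (w0_word n) = n choose 2"
  by (induction n) (simp_all add: w0_word_Suc numeral_2_eq_2)

text \<open>The longest element reverses the variables. Each letter of the word negates the variables that it does
not move, and every variable is moved by exactly \<open>n - 1\<close> of the letters, which leaves one sign that
is common to all variables.\<close>

lemma sw0_xt:
  assumes "1 \<le> j" and "j \<le> n"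
  shows "sw0 n (xt j) = (-1) ^ ((n - 1) choose 2) * xt (n + 1 - j)"
  using assms
proof (induction n arbitrary: j)
  case (Suc n)
  have *: "sw0 (Suc n) (xt j) = sw0 n (foldr sact (rev [1..<Suc n]) (xt j))"
    by (simp add: sw0_def w0_word_Suc)
  show ?case
  proof (cases "j = 1")
    case True
    have "sw0 n (xt (Suc n)) = (-1) ^ (n choose 2) * xt (Suc n)"
      unfolding sw0_def
      by (subst foldr_sact_far) (auto simp: set_w0_word length_w0_word)
    moreover have "sw0 (Suc n) (xt 1) = sw0 n (xt (Suc n))"
      unfolding *[unfolded True] by (subst foldr_sact_chain) simp_all
    ultimately show ?thesis
      by (simp add: True)
  next
    case False
    then obtain t where t: "j = Suc t" "1 \<le> t" using Suc.prems by (cases j) auto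
    have "sw0 (Suc n) (xt j) = sw0 n ((-1) ^ (n - 1) * xt t)"
      unfolding * by (subst foldr_sact_chain) (use t Suc.prems in simp_all)
    also have "\<dots> = (-1) ^ (n - 1) * sw0 n (xt t)"
      by (simp add: sw0_def foldr_sact_hom)
    also have "\<dots> = (-1) ^ ((n - 1) + (n - 1 choose 2)) * xt (n + 1 - t)"
      unfolding power_add mult.assoc using Suc t by simp
    also have "(n - 1) + (n - 1 choose 2) = n choose 2"
      using t Suc.prems by (cases n) (simp_all add: numeral_2_eq_2)
    finally show ?thesis by (simp add: t)
  qed
qed simp

lemma elem_sym_scale:
  assumes "\<And>x. x * c = c * (x :: 'a::ring_1)"
  shows "elem_sym (map (\<lambda>v. c * v) vs) k = c ^ k * elem_sym vs k"
proof (induction vs k rule: elem_sym.induct)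
  case (3 v vs k)
  have "v * c ^ k = c ^ k * v"
    using assms[of v] by (rule power_commuting_commutes[symmetric, OF sym])
  then have "c * v * (c ^ k * elem_sym vs k) = c ^ Suc k * (v * elem_sym vs k)"
    by (metis mult.assoc power_Suc)
  then show ?case by (simp add: 3 distrib_left mult.assoc)
qed simp_all

lemma sw0_esym: "sw0 n (esym n k) = (-1) ^ (((n - 1) choose 2) * k) * esym_rev n k"
proof -
  have "map (foldr sact (w0_word n)) (map xt [1..<Suc n]) =
    map (\<lambda>v. (-1) ^ ((n - 1) choose 2) * v) (rev (map xt [1..<Suc n]))"
    by (rule nth_equalityI)
      (auto simp: rev_nth sw0_xt simp flip: sw0_def simp del: upt_Suc simp add: Suc_diff_Suc)
  then show ?thesis
    by (simp add: sw0_def esym_def esym_rev_def foldr_sact_elem_sym elem_sym_scale[OF sign_commute] power_mult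
        del: upt_Suc map_map)
qed

section \<open>Ordered monomials\<close>

text \<open>The exponents are numbered from 0 like the rows of a shape: \<open>c i\<close> belongs to the variable \<open>X (i + 1)\<close>.\<close>

primrec xmon :: "nat \<Rightarrow> (nat \<Rightarrow> nat) \<Rightarrow> skew_poly" where
  "xmon 0 c = 1"
| "xmon (Suc n) c = xmon n c * X (Suc n) ^ c n"

lemma power_anticommute:
  assumes "a * b = - (b * a :: 'a::ring_1)"
  shows "a ^ p * b ^ q = (-1) ^ (p * q) * b ^ q * a ^ p"
proof -
  have 1: "a * b ^ q = (-1) ^ q * b ^ q * a" for q
  proof (induction q)
    case (Suc q)
    have "a * b ^ Suc q = a * b ^ q * b"
      by (simp add: power_commutes mult.assoc)
    also have "\<dots> = (-1) ^ q * b ^ q * (a * b)"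
      by (simp add: Suc mult.assoc)
    also have "\<dots> = (-1) ^ Suc q * b ^ Suc q * a"
      by (simp add: assms mult.assoc power_commutes) (simp add: power_commutes flip: mult.assoc)
    finally show ?case .
  qed simp
  show ?thesis
  proof (induction p)
    case (Suc p)
    have "a ^ Suc p * b ^ q = a ^ p * (a * b ^ q)"
      by (simp only: power_Suc2 mult.assoc)
    also have "\<dots> = (-1) ^ q * (a ^ p * b ^ q) * a"
      by (simp only: 1 mult.assoc[symmetric] sign_commute[of "a ^ p"])
    also have "\<dots> = (-1) ^ (q + p * q) * b ^ q * (a ^ p * a)"
      by (simp only: Suc power_add mult.assoc)
    finally show ?case by (simp only: power_Suc2 mult_Suc add.commute)
  qed simp
qed

lemma xmon_cong: "(\<And>i. i < n \<Longrightarrow> c i = c' i) \<Longrightarrow> xmon n c = xmon n c'"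
  by (induction n) simp_all

lemma X_power_xmon:
  assumes "n < j"
  shows "X j ^ p * xmon n c = (-1) ^ (p * (\<Sum>i<n. c i)) * xmon n c * X j ^ p"
  using assms
proof (induction n)
  case (Suc n)
  have "X j ^ p * xmon (Suc n) c = (X j ^ p * xmon n c) * X (Suc n) ^ c n"
    by (simp add: mult.assoc)
  also have "\<dots> = (-1) ^ (p * (\<Sum>i<n. c i)) * xmon n c * (X j ^ p * X (Suc n) ^ c n)"
    using Suc by (simp add: mult.assoc)
  also have "X j ^ p * X (Suc n) ^ c n = (-1) ^ (p * c n) * X (Suc n) ^ c n * X j ^ p"
    by (rule power_anticommute, rule X_anticommute) (use Suc.prems in simp)
  also have "(-1) ^ (p * (\<Sum>i<n. c i)) * xmon n c * ((-1) ^ (p * c n) * X (Suc n) ^ c n * X j ^ p)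
    = (-1) ^ (p * (\<Sum>i<n. c i)) * (xmon n c * (-1) ^ (p * c n)) * X (Suc n) ^ c n * X j ^ p"
    by (simp only: mult.assoc)
  also have "\<dots> = (-1) ^ (p * (\<Sum>i<Suc n. c i)) * xmon (Suc n) c * X j ^ p"
    by (simp only: sign_commute[of "xmon n c"] distrib_left power_add mult.assoc sum.lessThan_Suc xmon.simps)
  finally show ?case .
qed simp

text \<open>The number of transpositions that sort the product of two ordered monomials with the given exponents.
The same form counts the inversions between the rows of a tableau, and it gives the signs in both Pieri
rules.\<close>

definition inv_form :: "nat \<Rightarrow> (nat \<Rightarrow> nat) \<Rightarrow> (nat \<Rightarrow> nat) \<Rightarrow> nat"
  where "inv_form n a b = (\<Sum>i<n. a i * (\<Sum>j<i. b j))"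

lemma xmon_mult: "xmon n a * xmon n b = (-1) ^ inv_form n a b * xmon n (\<lambda>i. a i + b i)"
proof (induction n)
  case (Suc n)
  let ?x = "X (Suc n)"
  have "xmon (Suc n) a * xmon (Suc n) b = xmon n a * (?x ^ a n * xmon n b) * ?x ^ b n"
    by (simp add: mult.assoc)
  also have "?x ^ a n * xmon n b = (-1) ^ (a n * (\<Sum>j<n. b j)) * xmon n b * ?x ^ a n"
    by (rule X_power_xmon) simp
  also have "xmon n a * ((-1) ^ (a n * (\<Sum>j<n. b j)) * xmon n b * ?x ^ a n) * ?x ^ b n
    = (xmon n a * (-1) ^ (a n * (\<Sum>j<n. b j))) * xmon n b * (?x ^ a n * ?x ^ b n)"
    by (simp only: mult.assoc)
  also have "\<dots> = (-1) ^ (a n * (\<Sum>j<n. b j)) * (xmon n a * xmon n b) * (?x ^ a n * ?x ^ b n)"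
    by (simp only: sign_commute[of "xmon n a"] mult.assoc)
  also have "\<dots> = (-1) ^ inv_form (Suc n) a b * xmon (Suc n) (\<lambda>i. a i + b i)"
    by (simp add: Suc inv_form_def power_add mult.assoc add.commute)
  finally show ?case .
qed (simp add: inv_form_def)

lemma sact_xmon: "n < i \<Longrightarrow> sact i (xmon n c) = (-1) ^ (\<Sum>j<n. c j) * xmon n c"
proof (induction n)
  case (Suc n)
  have *: "sact i (X (Suc n)) = - X (Suc n)"
    using Suc.prems by (simp add: sact_X transpose_def)
  have "(- X (Suc n)) ^ c n = (-1) ^ c n * X (Suc n) ^ c n"
    by (rule power_minus)
  then have "sact i (xmon (Suc n) c) = (-1) ^ (\<Sum>j<n. c j) * (xmon n c * (-1) ^ c n) * X (Suc n) ^ c n"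
    using Suc by (simp add: * mult.assoc)
  then show ?case
    by (simp only: sign_commute[of "xmon n c"] xmon.simps sum.lessThan_Suc power_add mult.assoc)
qed simp

lemma ddiff_xmon_eq_0: "n < i \<Longrightarrow> ddiff i (xmon n c) = 0"
  by (induction n) (simp_all add: ddiff_mult ddiff_power_eq_0 ddiff_X)

text \<open>Up to a sign the argument is a power of \<open>X i * X (Suc i)\<close>, and that product is annihilated.\<close>

lemma ddiff_X_pair: "ddiff i (X i ^ a * X (Suc i) ^ a) = 0"
proof -
  have *: "X i * X (Suc i) = - (X (Suc i) * X i)"
    by (rule X_anticommute) simp
  have "\<exists>s. X i ^ a * X (Suc i) ^ a = (-1) ^ s * (X i * X (Suc i)) ^ a"
  proof (induction a)
    case 0
    show ?case by (rule exI[of _ 0]) simp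
  next
    case (Suc a)
    then obtain s where s: "X i ^ a * X (Suc i) ^ a = (-1) ^ s * (X i * X (Suc i)) ^ a" by blast
    have "X i ^ Suc a * X (Suc i) ^ Suc a = X i ^ a * (X i ^ 1 * X (Suc i) ^ a) * X (Suc i)"
      by (simp only: power_Suc2 power_one_right mult.assoc power_commutes[of "X (Suc i)"])
    also have "X i ^ 1 * X (Suc i) ^ a = (-1) ^ a * X (Suc i) ^ a * X i"
      using power_anticommute[OF *, of 1 a] by simp
    also have "X i ^ a * ((-1) ^ a * X (Suc i) ^ a * X i) * X (Suc i)
      = (-1) ^ a * (X i ^ a * X (Suc i) ^ a) * (X i * X (Suc i))"
      by (simp only: mult.assoc[symmetric] sign_commute[of "X i ^ a"])
    also have "\<dots> = (-1) ^ (a + s) * (X i * X (Suc i)) ^ Suc a"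
      by (simp only: s power_add mult.assoc power_Suc2)
    finally show ?case by blast
  qed
  then obtain s where "X i ^ a * X (Suc i) ^ a = (-1) ^ s * (X i * X (Suc i)) ^ a" ..
  then show ?thesis
    by (simp add: ddiff_power_eq_0 ddiff_mult ddiff_X sact_X)
qed

lemma ddiff_xmon_pair:
  assumes "Suc (Suc m) \<le> n" and "c m = c (Suc m)"
  shows "ddiff (Suc m) (xmon n c) = 0"
  using assms(1)
proof (induction n rule: dec_induct)
  case base
  have "xmon (Suc (Suc m)) c = xmon m c * (X (Suc m) ^ c m * X (Suc (Suc m)) ^ c m)"
    by (simp add: assms mult.assoc)
  then show ?case
    using ddiff_X_pair[of "Suc m" "c m"] by (simp add: ddiff_mult[of _ "xmon m c"] ddiff_xmon_eq_0)
next
  case (step n)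
  then show ?case
    by (simp add: ddiff_mult ddiff_power_eq_0 ddiff_X)
qed

text \<open>One surplus factor of the first variable is split off: the rest has equal exponents in the two variables
and is annihilated, so that the divided difference only deletes the factor.\<close>

lemma ddiff_xmon_step:
  assumes "Suc (Suc m) \<le> n" and "c m = Suc (c (Suc m))"
  shows "ddiff (Suc m) (xmon n c) = (-1) ^ (\<Sum>j<m. c j) * xmon n (c(m := c (Suc m)))"
  using assms(1)
proof (induction n rule: dec_induct)
  case base
  let ?a = "c (Suc m)"
  let ?G = "X (Suc m) ^ ?a * X (Suc (Suc m)) ^ ?a"
  have "xmon (Suc (Suc m)) c = xmon m c * (X (Suc m) * ?G)"
    by (simp add: assms mult.assoc)
  moreover have "ddiff (Suc m) (X (Suc m) * ?G) = ?G"
    using ddiff_X_pair[of "Suc m" ?a] by (simp add: ddiff_mult[of _ "X (Suc m)"] ddiff_X)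
  ultimately have "ddiff (Suc m) (xmon (Suc (Suc m)) c) = sact (Suc m) (xmon m c) * ?G"
    by (simp add: ddiff_mult[of _ "xmon m c"] ddiff_xmon_eq_0)
  also have "\<dots> = (-1) ^ (\<Sum>j<m. c j) * (xmon m c * ?G)"
    by (simp add: sact_xmon mult.assoc)
  also have "xmon m c = xmon m (c(m := ?a))"
    by (rule xmon_cong) simp
  finally show ?case by (simp add: mult.assoc fun_upd_def)
next
  case (step n)
  then show ?case
    by (simp add: ddiff_mult ddiff_power_eq_0 ddiff_X mult.assoc)
qed

lemma dchain_staircase:
  assumes "m < n"
  shows "dchain m (xmon n (\<lambda>i. n - 1 - i)) = (-1) ^ (\<Sum>t<m. \<Sum>j<t. n - 2 - j) *
    xmon n (\<lambda>i. if i < m then n - 2 - i else n - 1 - i)"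
  using assms
proof (induction m)
  case (Suc m)
  let ?c = "\<lambda>i. if i < m then n - 2 - i else n - 1 - i"
  have "dchain (Suc m) (xmon n (\<lambda>i. n - 1 - i)) =
    (-1) ^ (\<Sum>t<m. \<Sum>j<t. n - 2 - j) * ddiff (Suc m) (xmon n ?c)"
    using Suc by (simp add: dchain_Suc foldr_ddiff_linear)
  also have "ddiff (Suc m) (xmon n ?c) = (-1) ^ (\<Sum>j<m. ?c j) * xmon n (?c(m := ?c (Suc m)))"
    by (rule ddiff_xmon_step) (use Suc.prems in auto)
  also have "(\<Sum>j<m. ?c j) = (\<Sum>j<m. n - 2 - j)"
    by simp
  also have "xmon n (?c(m := ?c (Suc m))) = xmon n (\<lambda>i. if i < Suc m then n - 2 - i else n - 1 - i)"
    by (rule xmon_cong) (auto simp: less_Suc_eq)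
  finally show ?case by (simp add: power_add mult.assoc)
qed (auto intro!: xmon_cong)

lemma sum_sum_lessThan: "(\<Sum>t<N. \<Sum>j<t. g j) = (\<Sum>j<N. (N - 1 - j) * (g j :: nat))"
proof (induction N)
  case (Suc N)
  have "(\<Sum>j<Suc N. (Suc N - 1 - j) * g j) = (\<Sum>j<N. (N - 1 - j) * g j + g j)"
  proof (rule trans[OF sum.lessThan_Suc], simp, rule sum.cong)
    fix j assume "j \<in> {..<N}"
    then have "N - j = Suc (N - Suc j)" by (simp add: Suc_diff_Suc)
    then show "(N - j) * g j = (N - Suc j) * g j + g j" by simp
  qed simp
  then show ?case using Suc by (simp add: sum.distrib)
qed simp

lemma even_sum_cong: "(\<And>i. i \<in> A \<Longrightarrow> even (f i :: nat) = even (g i)) \<Longrightarrow> even (sum f A) = even (sum g A)"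
  by (induction A rule: infinite_finite_induct) auto

lemma minus_one_power_cong: "even a = even b \<Longrightarrow> (-1 :: 'a::ring_1) ^ a = (-1) ^ b"
  by (cases "even a") simp_all

lemma sum_lessThan_choose_2: "(\<Sum>i<N. i) = N choose 2"
  by (induction N) (simp_all add: numeral_2_eq_2)

text \<open>Each chain lowers the staircase by one, with a sign that collects the exponents to the left of the
deleted factors. Modulo 2 these add up to a sum of squares, hence to a sum of consecutive integers.\<close>

lemma dw0_staircase: "dw0 n (xmon n (\<lambda>i. n - 1 - i)) = (-1) ^ (n choose 3)"
proof (induction n)
  case (Suc n)
  have sgn: "even (\<Sum>t<n. \<Sum>j<t. Suc n - 2 - j) = even (n choose 2)"
  proof -
    have "(\<Sum>t<n. \<Sum>j<t. Suc n - 2 - j) = (\<Sum>j<n. (n - 1 - j) * (n - 1 - j))"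
      by (simp add: sum_sum_lessThan)
    also have "even \<dots> = even (\<Sum>j<n. n - 1 - j)"
      by (rule even_sum_cong) simp
    also have "(\<Sum>j<n. n - 1 - j) = (\<Sum>j<n. j)"
      using sum.nat_diff_reindex[of id n] by (simp add: Suc_diff_Suc)
    finally show ?thesis by (simp add: sum_lessThan_choose_2)
  qed
  have "dw0 (Suc n) (xmon (Suc n) (\<lambda>i. Suc n - 1 - i)) =
    dw0 n (dchain n (xmon (Suc n) (\<lambda>i. Suc n - 1 - i)))"
    by (rule dw0_Suc)
  also have "dchain n (xmon (Suc n) (\<lambda>i. Suc n - 1 - i)) = (-1) ^ (n choose 2) *
    xmon (Suc n) (\<lambda>i. if i < n then Suc n - 2 - i else Suc n - 1 - i)"
    by (simp only: dchain_staircase[OF lessI] minus_one_power_cong[OF sgn])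
  also have "xmon (Suc n) (\<lambda>i. if i < n then Suc n - 2 - i else Suc n - 1 - i) = xmon n (\<lambda>i. n - 1 - i)"
    by (auto intro: xmon_cong)
  also have "dw0 n ((-1) ^ (n choose 2) * xmon n (\<lambda>i. n - 1 - i)) = (-1) ^ (n choose 2) * (-1) ^ (n choose 3)"
    using Suc by (simp add: dw0_def foldr_ddiff_linear)
  also have "\<dots> = (-1) ^ (Suc n choose 3)"
    by (simp add: numeral_3_eq_3 numeral_2_eq_2 flip: power_add)
  finally show ?case .
qed (simp add: numeral_3_eq_3)

lemma card_subsets_Suc:
  "{A. A \<subseteq> {..<Suc n} \<and> card A = Suc k} =
    {A. A \<subseteq> {..<n} \<and> card A = Suc k} \<union> insert n ` {A. A \<subseteq> {..<n} \<and> card A = k}"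
  (is "?L = ?R1 \<union> ?R2")
proof (intro equalityI subsetI)
  fix A assume "A \<in> ?L"
  then have A: "A \<subseteq> {..<Suc n}" "card A = Suc k" by auto
  have fin: "finite A" using A(1) finite_subset by blast
  show "A \<in> ?R1 \<union> ?R2"
  proof (cases "n \<in> A")
    case True
    then have "A - {n} \<in> {A. A \<subseteq> {..<n} \<and> card A = k}"
      using A fin by auto
    moreover have "insert n (A - {n}) = A" using True by blast
    ultimately show ?thesis by (metis (no_types, lifting) UnI2 imageI)
  next
    case False
    with A show ?thesis by (auto simp: less_Suc_eq)
  qed
next
  fix A assume "A \<in> ?R1 \<union> ?R2"
  then show "A \<in> ?L"
    using finite_subset[of _ "{..<n}"] by (auto simp: card_insert_if)
qed

lemma sum_card_subsets_Suc:
  "(\<Sum>A | A \<subseteq> {..<Suc n} \<and> card A = Suc k. F A) =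
    (\<Sum>A | A \<subseteq> {..<n} \<and> card A = Suc k. F A) + (\<Sum>A | A \<subseteq> {..<n} \<and> card A = k. F (insert n A))"
proof -
  have fin: "finite {A. A \<subseteq> {..<n} \<and> card A = j}" for j
    by (rule finite_subset[of _ "Pow {..<n}"]) auto
  have inj: "inj_on (insert n) {A. A \<subseteq> {..<n} \<and> card A = k}"
    by (rule inj_onI) (metis (mono_tags, lifting) insert_ident lessThan_iff less_irrefl mem_Collect_eq subsetD)
  show ?thesis
    unfolding card_subsets_Suc
    by (subst sum.union_disjoint) (use fin inj in \<open>auto simp: sum.reindex\<close>)
qed

text \<open>Sets of rows are numbered from 0, so the sign \<open>(-1)\<^sup>i\<^sup>-\<^sup>1\<close> in \<open>xt i\<close> contributes the sum of the members
of \<open>A\<close>.\<close>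

lemma esym_eq_sum_xmon:
  "esym n k = (\<Sum>A | A \<subseteq> {..<n} \<and> card A = k. (-1) ^ \<Sum>A * xmon n (\<lambda>i. of_bool (i \<in> A)))"
proof (induction n arbitrary: k)
  case 0
  show ?case
  proof (cases k)
    case 0
    have "{A :: nat set. A \<subseteq> {..<0} \<and> card A = 0} = {{}}" by auto
    then show ?thesis by (simp only: 0) simp
  next
    case (Suc k')
    have "{A :: nat set. A \<subseteq> {..<0} \<and> card A = Suc k'} = {}" by auto
    then show ?thesis by (simp only: Suc) (simp add: esym_def)
  qed
next
  case (Suc n)
  show ?case
  proof (cases k)
    case 0
    have "{A. A \<subseteq> {..<Suc n} \<and> card A = 0} = {{}}"
      using finite_subset[of _ "{..<Suc n}"] by auto
    moreover have "xmon m (\<lambda>i. 0) = 1" for m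
      by (induction m) simp_all
    ultimately show ?thesis by (simp add: 0)
  next
    case (Suc k')
    let ?F = "\<lambda>m A. (-1) ^ \<Sum>A * xmon m (\<lambda>i. of_bool (i \<in> A))"
    have "?F (Suc n) A = ?F n A" if "A \<subseteq> {..<n}" for A
      using that by auto
    then have 1: "(\<Sum>A | A \<subseteq> {..<n} \<and> card A = Suc k'. ?F (Suc n) A) = esym n (Suc k')"
      by (simp add: Suc.IH)
    have "?F (Suc n) (insert n A) = ?F n A * xt (Suc n)" if A: "A \<subseteq> {..<n}" for A
    proof -
      have "n \<notin> A" "finite A" using A finite_subset by auto
      then have "\<Sum>(insert n A) = n + \<Sum>A" by simp
      moreover have "xmon n (\<lambda>i. of_bool (i \<in> insert n A)) = xmon n (\<lambda>i. of_bool (i \<in> A))"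
        by (rule xmon_cong) simp
      ultimately show ?thesis
        by (simp add: xt_def power_add mult.assoc)
          (simp only: sign_commute[of "xmon n c" n for c] sign_commute[of "(-1) ^ m" n for m] flip: mult.assoc)
    qed
    then have 2: "(\<Sum>A | A \<subseteq> {..<n} \<and> card A = k'. ?F (Suc n) (insert n A)) = esym n k' * xt (Suc n)"
      by (simp add: Suc.IH sum_distrib_right)
    show ?thesis
      by (simp only: Suc esym_Suc sum_card_subsets_Suc 1 2)
  qed
qed

section \<open>Odd-symmetrized functions times elementary functions\<close>

lemma inv_form_symmetrize:
  "inv_form n a b + inv_form n b a + (\<Sum>i<n. a i * b i) = (\<Sum>i<n. a i) * (\<Sum>i<n. b i)"
  by (induction n) (simp_all add: inv_form_def algebra_simps)

lemma inv_form_add_left: "inv_form n (\<lambda>i. a i + b i) c = inv_form n a c + inv_form n b c"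
  by (simp add: inv_form_def distrib_right sum.distrib)

lemma inv_form_add_right: "inv_form n c (\<lambda>i. a i + b i) = inv_form n c a + inv_form n c b"
  by (simp add: inv_form_def distrib_left sum.distrib)

lemma inv_form_cong:
  "(\<And>i. i < n \<Longrightarrow> a i = a' i) \<Longrightarrow> (\<And>i. i < n \<Longrightarrow> b i = b' i) \<Longrightarrow> inv_form n a b = inv_form n a' b'"
  by (auto simp: inv_form_def intro!: sum.cong arg_cong2[of _ _ _ _ "(*)"])

text \<open>The exponents of a square-free monomial, equivalently the vertical strip that adds one box to each row
in \<open>A\<close>.\<close>

abbreviation ind :: "nat set \<Rightarrow> nat \<Rightarrow> nat"
  where "ind A \<equiv> \<lambda>i. of_bool (i \<in> A)"

abbreviation add_strip :: "(nat \<Rightarrow> nat) \<Rightarrow> nat set \<Rightarrow> nat \<Rightarrow> nat"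
  where "add_strip lam A \<equiv> \<lambda>i. lam i + ind A i"

lemma sum_mult_ind: "A \<subseteq> {..<n} \<Longrightarrow> (\<Sum>i<n. f i * ind A i) = sum f A"
  by (simp add: Int_absorb1 sum.If_cases of_bool_def if_distrib[of "(*) x" for x] cong: if_cong)

text \<open>The odd-symmetrized function for arbitrary exponents. Exponents that do not form a partition occur as
intermediate terms of the rule for elementary functions.\<close>

definition sym_schur :: "nat \<Rightarrow> (nat \<Rightarrow> nat) \<Rightarrow> skew_poly"
  where "sym_schur n lam =
    (-1) ^ (n choose 3) * sw0 n (dw0 n (xmon n lam * xmon n (\<lambda>i. n - 1 - i)))"

lemma sw0_hom:
  "sw0 n (p * q) = sw0 n p * sw0 n q"
  "sw0 n ((-1) ^ k * p) = (-1) ^ k * sw0 n p"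
  "sw0 n ((-1) ^ k) = (-1) ^ k"
  by (simp_all add: sw0_def foldr_sact_hom)

lemma sw0_dw0_sum:
  "finite I \<Longrightarrow> sw0 n (dw0 n (\<Sum>i\<in>I. f i)) = (\<Sum>i\<in>I. sw0 n (dw0 n (f i)))"
  by (induction I rule: finite_induct)
    (simp_all add: sw0_def dw0_def foldr_sact_hom foldr_ddiff_linear)

lemma sw0_dw0_sign: "sw0 n (dw0 n ((-1) ^ k * p)) = (-1) ^ k * sw0 n (dw0 n p)"
  by (simp add: dw0_def foldr_ddiff_linear sw0_hom)

lemma finite_card_subsets: "finite {A. A \<subseteq> {..<n :: nat} \<and> card A = k}"
  by (rule finite_subset[of _ "Pow {..<n}"]) auto

lemma sign_mult_cancel: "(-1) ^ k * p = (-1) ^ k * q \<Longrightarrow> p = (q :: 'a::ring_1)"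
  by (cases "even k") simp_all

lemma sign_left_commute: "p * ((-1) ^ k * q) = (-1) ^ k * (p * q :: 'a::ring_1)"
  by (cases "even k") simp_all

text \<open>The three contributions are the signs in the variables \<open>xt\<close> and the signs from moving the square-free
monomial past the staircase. Together they cancel the sign with which the longest element acts on the
elementary function.\<close>

lemma staircase_parity:
  assumes "A \<subseteq> {..<n}" and "card A = k"
  shows "even (\<Sum>A + inv_form n (\<lambda>i. n - 1 - i) (ind A) + inv_form n (ind A) (\<lambda>i. n - 1 - i))
    = even (((n - 1) choose 2) * k)"
proof -
  let ?d = "\<lambda>i. n - 1 - i"
  have "(\<Sum>i<n. ?d i) = (\<Sum>i<n. i)"
    using sum.nat_diff_reindex[of id n] by (simp add: Suc_diff_Suc)
  then have d: "(\<Sum>i<n. ?d i) = n choose 2"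
    by (simp add: sum_lessThan_choose_2)
  have c: "(\<Sum>i<n. ind A i) = k"
    using sum_mult_ind[OF assms(1), of "\<lambda>_. 1"] assms by simp
  have "inv_form n ?d (ind A) + inv_form n (ind A) ?d + sum ?d A = (n choose 2) * k"
    using inv_form_symmetrize[of n ?d "ind A"] by (simp only: d c sum_mult_ind[OF assms(1)])
  moreover have "\<Sum>A + sum ?d A = (\<Sum>i\<in>A. n - 1)"
    unfolding sum.distrib[symmetric] by (rule sum.cong) (use assms in auto)
  then have "\<Sum>A + sum ?d A = k * (n - 1)"
    using assms by simp
  moreover have "n choose 2 = (n - 1) + ((n - 1) choose 2)"
    by (cases n) (simp_all add: numeral_2_eq_2)
  ultimately show ?thesis
    by (metis (no_types, lifting) even_add even_mult_iff)
qed

text \<open>Divided differences are linear over elementary functions on the right, so the product can be moved inside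
the symmetrization, where the elementary function is a sum of square-free monomials.\<close>

lemma sym_schur_esym_rev:
  "sym_schur n lam * esym_rev n k = (\<Sum>A | A \<subseteq> {..<n} \<and> card A = k.
    (-1) ^ inv_form n lam (ind A) * sym_schur n (add_strip lam A))"
proof -
  let ?d = "\<lambda>i. n - 1 - i" and ?c = "((n - 1) choose 2) * k"
  let ?As = "{A. A \<subseteq> {..<n} \<and> card A = k}"
  let ?sg = "\<lambda>j. (-1 :: skew_poly) ^ j"
  have expand: "xmon n lam * xmon n ?d * (?sg (\<Sum>A) * xmon n (ind A)) =
      ?sg ?c * (?sg (inv_form n lam (ind A)) * (xmon n (add_strip lam A) * xmon n ?d))"
    if A: "A \<in> ?As" for A
  proof -
    have "xmon n lam * xmon n ?d * (?sg (\<Sum>A) * xmon n (ind A))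
      = ?sg (\<Sum>A) * (xmon n lam * (xmon n ?d * xmon n (ind A)))"
      by (simp only: mult.assoc[symmetric] sign_commute[of "xmon n lam * xmon n ?d"])
    also have "xmon n ?d * xmon n (ind A) = ?sg (inv_form n ?d (ind A)) * xmon n (\<lambda>i. ind A i + ?d i)"
      by (simp only: xmon_mult add.commute[of "ind A i" for i])
    also have "xmon n (\<lambda>i. ind A i + ?d i) = ?sg (inv_form n (ind A) ?d) * (xmon n (ind A) * xmon n ?d)"
      by (simp only: xmon_mult mult.assoc[symmetric]) (simp flip: power_add)
    also have "?sg (\<Sum>A) * (xmon n lam * (?sg (inv_form n ?d (ind A)) *
        (?sg (inv_form n (ind A) ?d) * (xmon n (ind A) * xmon n ?d)))) =
      ?sg (\<Sum>A + inv_form n ?d (ind A) + inv_form n (ind A) ?d) * (xmon n lam * xmon n (ind A) * xmon n ?d)"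
      by (simp only: power_add mult.assoc sign_left_commute[of "xmon n lam"])
    also have "?sg (\<Sum>A + inv_form n ?d (ind A) + inv_form n (ind A) ?d) = ?sg ?c"
      by (rule minus_one_power_cong, rule staircase_parity) (use A in auto)
    finally show ?thesis
      by (simp only: xmon_mult[of n lam] mult.assoc)
  qed
  have "xmon n lam * xmon n ?d * esym n k =
      (\<Sum>A\<in>?As. ?sg ?c * (?sg (inv_form n lam (ind A)) * (xmon n (add_strip lam A) * xmon n ?d)))"
    unfolding esym_eq_sum_xmon sum_distrib_left by (rule sum.cong[OF refl expand])
  then have "sw0 n (dw0 n (xmon n lam * xmon n ?d * esym n k)) =
      ?sg ?c * (\<Sum>A\<in>?As. ?sg (inv_form n lam (ind A)) * sw0 n (dw0 n (xmon n (add_strip lam A) * xmon n ?d)))"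
    by (simp only: sw0_dw0_sum[OF finite_card_subsets] sw0_dw0_sign sum_distrib_left)
  moreover have "sw0 n (dw0 n (xmon n lam * xmon n ?d * esym n k)) =
      ?sg ?c * (sw0 n (dw0 n (xmon n lam * xmon n ?d)) * esym_rev n k)"
    by (simp only: dw0_mult_esym sw0_hom sw0_esym mult.assoc[symmetric]
        sign_commute[of "sw0 n (dw0 n (xmon n lam * xmon n ?d))"])
  ultimately have *: "sw0 n (dw0 n (xmon n lam * xmon n ?d)) * esym_rev n k =
      (\<Sum>A\<in>?As. ?sg (inv_form n lam (ind A)) * sw0 n (dw0 n (xmon n (add_strip lam A) * xmon n ?d)))"
    by - (rule sign_mult_cancel[of ?c], simp only:)
  have swap: "?sg c * (?sg (inv_form n lam (ind A)) * p) = ?sg (inv_form n lam (ind A)) * (?sg c * p)" for c A p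
    by (simp only: mult.assoc[symmetric] sign_commute[of "?sg c"])
  show ?thesis
    unfolding sym_schur_def mult.assoc * sum_distrib_left by (rule sum.cong[OF refl swap])
qed

lemma sym_schur_0: "sym_schur n (\<lambda>_. 0) = 1"
proof -
  have "xmon n (\<lambda>_. 0) = 1"
    by (induction n) simp_all
  then show ?thesis
    by (simp only: sym_schur_def mult_1_left dw0_staircase sw0_hom) (simp flip: power_add)
qed

lemma sym_schur_eq_0:
  assumes "Suc m < n" and "lam (Suc m) = Suc (lam m)"
  shows "sym_schur n lam = 0"
proof -
  let ?c = "\<lambda>i. lam i + (n - 1 - i)"
  have "ddiff (Suc m) (xmon n ?c) = 0"
    by (rule ddiff_xmon_pair) (use assms in auto)
  then have "dw0 n (xmon n ?c) = 0"
    by (rule dw0_eq_0) (use assms in auto)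
  then show ?thesis
    by (simp add: sym_schur_def xmon_mult sw0_dw0_sign) (simp add: sw0_def foldr_sact_hom)
qed

section \<open>Shapes, horizontal strips and tableau sums\<close>

text \<open>Partitions with at most \<open>L\<close> rows, as functions that are eventually zero. The bound \<open>L\<close> makes sums over rows
finite; enlarging it changes neither the tableau sums nor the Kostka numbers (\<open>tab_sum_extend\<close>,
\<open>wkostka_extend\<close>).\<close>

definition shape :: "nat \<Rightarrow> (nat \<Rightarrow> nat) \<Rightarrow> bool"
  where "shape L lam \<longleftrightarrow> (\<forall>i. lam (Suc i) \<le> lam i) \<and> (\<forall>i\<ge>L. lam i = 0)"

abbreviation size_upto :: "nat \<Rightarrow> (nat \<Rightarrow> nat) \<Rightarrow> nat"
  where "size_upto L lam \<equiv> \<Sum>i<L. lam i"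

text \<open>The rows of \<open>nu\<close> and \<open>lam\<close> interlace, i.e. \<open>lam / nu\<close> is a horizontal strip.\<close>

definition hstrip :: "(nat \<Rightarrow> nat) \<Rightarrow> (nat \<Rightarrow> nat) \<Rightarrow> bool"
  where "hstrip nu lam \<longleftrightarrow> (\<forall>i. lam (Suc i) \<le> nu i \<and> nu i \<le> lam i)"

definition hstrips_on :: "nat \<Rightarrow> (nat \<Rightarrow> nat) \<Rightarrow> nat \<Rightarrow> (nat \<Rightarrow> nat) set"
  where "hstrips_on L lam k =
    {mu. hstrip lam mu \<and> (\<forall>i\<ge>L. mu i = 0) \<and> size_upto L mu = size_upto L lam + k}"

text \<open>The inversions in a row word between the boxes of a horizontal strip, all filled with the largest
letter, and the rows of \<open>nu\<close> above them, which come later in the word.\<close>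

abbreviation skew_sign :: "nat \<Rightarrow> (nat \<Rightarrow> nat) \<Rightarrow> (nat \<Rightarrow> nat) \<Rightarrow> nat"
  where "skew_sign L lam nu \<equiv> inv_form L (\<lambda>i. lam i - nu i) nu"

text \<open>The sign of inserting a weakly increasing word row by row: a letter that is bumped through a row of length
\<open>l\<close> contributes \<open>l - 1\<close>, independently of the entries, and \<open>l + 1\<close> has the same parity.\<close>

abbreviation pieri_sign :: "nat \<Rightarrow> (nat \<Rightarrow> nat) \<Rightarrow> (nat \<Rightarrow> nat) \<Rightarrow> nat"
  where "pieri_sign L lam mu \<equiv> inv_form L (\<lambda>i. mu i - lam i) (\<lambda>i. lam i + 1)"

text \<open>The sum of the row words of all tableaux of a shape with entries in \<open>1..n\<close> (\<open>sum_tableaux_xt_word\<close>),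
described by the strips that the letters \<open>n, n - 1, ...\<close> occupy.\<close>

primrec tab_sum :: "nat \<Rightarrow> nat \<Rightarrow> (nat \<Rightarrow> nat) \<Rightarrow> skew_poly" where
  "tab_sum L 0 lam = of_bool (lam = (\<lambda>_. 0))"
| "tab_sum L (Suc n) lam = (\<Sum>nu | hstrip nu lam. (-1) ^ skew_sign L lam nu * tab_sum L n nu *
    xt (Suc n) ^ (size_upto L lam - size_upto L nu))"

primrec hsym :: "nat \<Rightarrow> nat \<Rightarrow> skew_poly" where
  "hsym 0 k = of_bool (k = 0)"
| "hsym (Suc n) k = (\<Sum>j\<le>k. hsym n (k - j) * xt (Suc n) ^ j)"

lemma finite_bounded_fun: "finite {f :: nat \<Rightarrow> nat. (\<forall>i. f i \<le> b) \<and> (\<forall>i\<ge>L. f i = 0)}"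
proof -
  have "finite {f. \<forall>x. (x \<in> {..<L} \<longrightarrow> f x \<in> {..b}) \<and> (x \<notin> {..<L} \<longrightarrow> f x = 0)}"
    by (rule finite_set_of_finite_funs) auto
  then show ?thesis
    by (rule rev_finite_subset) auto
qed

lemma finite_hstrip:
  assumes "shape L lam"
  shows "finite {nu. hstrip nu lam}"
proof (rule finite_subset[OF _ finite_bounded_fun])
  have "lam i \<le> lam 0" for i
    using assms by (induction i) (auto simp: shape_def intro: order.trans)
  then show "{nu. hstrip nu lam} \<subseteq> {f. (\<forall>i. f i \<le> lam 0) \<and> (\<forall>i\<ge>L. f i = 0)}"
    using assms unfolding hstrip_def shape_def by (auto intro: order.trans) (metis le_zero_eq)
qed

lemma finite_hstrips_on: "finite (hstrips_on L lam k)"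
proof (rule finite_subset[OF _ finite_bounded_fun])
  show "hstrips_on L lam k \<subseteq> {f. (\<forall>i. f i \<le> size_upto L lam + k) \<and> (\<forall>i\<ge>L. f i = 0)}"
  proof (clarsimp simp: hstrips_on_def)
    fix mu :: "nat \<Rightarrow> nat" and i assume mu: "\<forall>i\<ge>L. mu i = 0" "size_upto L mu = size_upto L lam + k"
    show "mu i \<le> size_upto L lam + k"
      using mu member_le_sum[of i "{..<L}" mu] by (cases "i < L") auto
  qed
qed

lemma hstrip_le: "hstrip nu lam \<Longrightarrow> nu i \<le> lam i"
  by (simp add: hstrip_def)

lemma hstrip_size: "hstrip nu lam \<Longrightarrow> size_upto L nu \<le> size_upto L lam"
  by (simp add: hstrip_def sum_mono)

lemma hstrip_shape_lower: "hstrip nu lam \<Longrightarrow> shape L lam \<Longrightarrow> shape L nu"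
  unfolding hstrip_def shape_def by (metis le_trans le_zero_eq)

lemma hstrips_on_shape: "mu \<in> hstrips_on L lam k \<Longrightarrow> shape L mu"
  unfolding hstrips_on_def hstrip_def shape_def by (metis (mono_tags, lifting) le_trans mem_Collect_eq)

text \<open>A column with more than \<open>n\<close> boxes cannot be filled.\<close>

lemma tab_sum_eq_0: "0 < lam n \<Longrightarrow> tab_sum L n lam = 0"
proof (induction n arbitrary: lam)
  case (Suc n)
  have "tab_sum L n nu = 0" if "hstrip nu lam" for nu
    using Suc that by (intro Suc.IH) (auto simp: hstrip_def intro: less_le_trans)
  then show ?case by simp
qed auto

lemma xt_power_hsym: "n < j \<Longrightarrow> xt j ^ a * hsym n k = (-1) ^ (a * k) * hsym n k * xt j ^ a"
proof (induction n arbitrary: k)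
  case (Suc n)
  have "xt j ^ a * hsym (Suc n) k = (\<Sum>i\<le>k. (xt j ^ a * hsym n (k - i)) * xt (Suc n) ^ i)"
    by (simp add: sum_distrib_left mult.assoc)
  also have "\<dots> = (\<Sum>i\<le>k. (-1) ^ (a * k) * (hsym n (k - i) * xt (Suc n) ^ i) * xt j ^ a)"
  proof (rule sum.cong[OF refl])
    fix i assume i: "i \<in> {..k}"
    have anti: "xt j ^ a * xt (Suc n) ^ i = (-1) ^ (a * i) * xt (Suc n) ^ i * xt j ^ a"
      by (rule power_anticommute, rule xt_anticommute) (use Suc.prems in simp)
    have "(xt j ^ a * hsym n (k - i)) * xt (Suc n) ^ i =
        (-1) ^ (a * (k - i)) * (hsym n (k - i) * (xt j ^ a * xt (Suc n) ^ i))"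
      using Suc by (simp add: mult.assoc)
    also have "\<dots> = (-1) ^ (a * (k - i) + a * i) * (hsym n (k - i) * xt (Suc n) ^ i) * xt j ^ a"
      by (simp only: anti power_add mult.assoc sign_left_commute[of "hsym n (k - i)"])
    also have "a * (k - i) + a * i = a * k"
      using i by (simp flip: distrib_left)
    finally show "(xt j ^ a * hsym n (k - i)) * xt (Suc n) ^ i =
      (-1) ^ (a * k) * (hsym n (k - i) * xt (Suc n) ^ i) * xt j ^ a" .
  qed
  finally show ?case
    by (simp add: sum_distrib_left sum_distrib_right mult.assoc)
qed simp

section \<open>The Pieri rule for complete functions\<close>

lemma toggle_size:
  fixes lam kap nu mu :: "nat \<Rightarrow> nat"
  assumes "mu 0 = j + max (lam 0) (kap 0)"
    and "\<And>i. mu (Suc i) + nu i = min (lam i) (kap i) + max (lam (Suc i)) (kap (Suc i))"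
  shows "size_upto (Suc m) mu + size_upto m nu + min (lam m) (kap m) =
    j + size_upto (Suc m) lam + size_upto (Suc m) kap"
proof (induction m)
  case 0
  then show ?case using assms(1) by simp
next
  case (Suc m)
  then show ?case using assms(2)[of m] by simp
qed

text \<open>The induction is over the rows. The last summand is the defect of the truncated sums: it measures the
part of row \<open>m\<close> of \<open>mu\<close> that is determined by row \<open>m - 1\<close> of \<open>nu\<close>, it telescopes, and it disappears
when the last rows of \<open>nu\<close> and \<open>kap\<close> are empty.\<close>

lemma toggle_sign:
  fixes lam kap nu mu :: "nat \<Rightarrow> nat"
  assumes mu0: "mu 0 = j + max (lam 0) (kap 0)"
    and mu_Suc: "\<And>i. mu (Suc i) + nu i = min (lam i) (kap i) + max (lam (Suc i)) (kap (Suc i))"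
    and le: "\<And>i. nu i \<le> lam i" "\<And>i. nu i \<le> kap i" "\<And>i. lam i \<le> mu i" "\<And>i. kap i \<le> mu i"
  shows "even (skew_sign m lam nu + pieri_sign m nu kap + pieri_sign m lam mu + skew_sign m mu kap
    + (size_upto m lam + size_upto m nu) * (size_upto m kap + size_upto m nu)
    + (case m of 0 \<Rightarrow> j | Suc i \<Rightarrow> min (lam i) (kap i) + nu i) * (size_upto m lam + size_upto m kap + m))"
proof (induction m)
  case 0
  show ?case by (simp add: inv_form_def)
next
  case (Suc m)
  let ?q = "case m of 0 \<Rightarrow> j | Suc i \<Rightarrow> min (lam i) (kap i) + nu i"
  have mu: "even (mu m) = even (?q + max (lam m) (kap m))"
  proof (cases m)
    case (Suc i)
    have "even (mu (Suc i) + nu i) = even (min (lam i) (kap i) + max (lam (Suc i)) (kap (Suc i)))"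
      by (simp only: mu_Suc)
    then show ?thesis using Suc by (auto simp del: mu_Suc)
  qed (simp add: mu0)
  have diff: "even (a - b) = even (a + b)" if "b \<le> a" for a b :: nat
    using that by simp
  have cases: "max (lam m) (kap m) = lam m \<and> min (lam m) (kap m) = kap m
      \<or> max (lam m) (kap m) = kap m \<and> min (lam m) (kap m) = lam m"
    by linarith
  have sums: "even (\<Sum>j<m. nu j + 1) = even (size_upto m nu + m)"
    "even (\<Sum>j<m. lam j + 1) = even (size_upto m lam + m)"
    by (simp_all only: sum.distrib) simp_all
  note parities = diff[OF le(1)] diff[OF le(2)] diff[OF le(3)] diff[OF le(4)] sums
    even_add even_mult_iff even_Suc
  from cases show ?case
  proof (elim disjE conjE)
    assume "max (lam m) (kap m) = lam m" "min (lam m) (kap m) = kap m"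
    then show ?thesis
      using Suc mu unfolding inv_form_def sum.lessThan_Suc nat.case parities by (smt (verit))
  next
    assume "max (lam m) (kap m) = kap m" "min (lam m) (kap m) = lam m"
    then show ?thesis
      using Suc mu unfolding inv_form_def sum.lessThan_Suc nat.case parities by (smt (verit))
  qed
qed

text \<open>The local rule. If \<open>nu\<close> is obtained from \<open>lam\<close> by removing a horizontal strip and \<open>kap\<close> from \<open>nu\<close> by adding
one, then row \<open>i\<close> of \<open>nu\<close> ranges over an interval that depends only on \<open>lam\<close> and \<open>kap\<close>. If instead \<open>mu\<close>
contains both with horizontal strips as differences, row \<open>i + 1\<close> of \<open>mu\<close> ranges over the same
interval. Reflecting the interval exchanges the two situations; the first row of \<open>mu\<close>, which is bounded
only from below, absorbs the number \<open>j\<close>.\<close>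

definition toggle :: "(nat \<Rightarrow> nat) \<Rightarrow> (nat \<Rightarrow> nat) \<Rightarrow> nat \<Rightarrow> (nat \<Rightarrow> nat) \<Rightarrow> nat \<Rightarrow> nat"
  where "toggle lam kap j nu i = (case i of 0 \<Rightarrow> j + max (lam 0) (kap 0)
    | Suc i \<Rightarrow> min (lam i) (kap i) + max (lam (Suc i)) (kap (Suc i)) - nu i)"

definition untoggle :: "(nat \<Rightarrow> nat) \<Rightarrow> (nat \<Rightarrow> nat) \<Rightarrow> (nat \<Rightarrow> nat) \<Rightarrow> nat \<Rightarrow> nat"
  where "untoggle lam kap mu i = min (lam i) (kap i) + max (lam (Suc i)) (kap (Suc i)) - mu (Suc i)"

text \<open>The number \<open>j\<close> is the part of \<open>k\<close> that is taken up by the letter \<open>n + 1\<close> in \<open>h\<^sub>k\<close>.\<close>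

definition down_up :: "nat \<Rightarrow> (nat \<Rightarrow> nat) \<Rightarrow> nat \<Rightarrow> ((nat \<Rightarrow> nat) \<times> nat \<times> (nat \<Rightarrow> nat)) set"
  where "down_up L lam k = {(nu, j, kap). hstrip nu lam \<and> j \<le> k \<and> kap \<in> hstrips_on L nu (k - j)}"

definition up_down :: "nat \<Rightarrow> (nat \<Rightarrow> nat) \<Rightarrow> nat \<Rightarrow> ((nat \<Rightarrow> nat) \<times> (nat \<Rightarrow> nat)) set"
  where "up_down L lam k = {(mu, kap). mu \<in> hstrips_on L lam k \<and> hstrip kap mu}"

lemma toggle_facts:
  assumes "shape L lam" and "(nu, j, kap) \<in> down_up L lam k" and "kap (L - 1) = 0" and "0 < L"
  defines "mu \<equiv> toggle lam kap j nu"
  shows "mu 0 = j + max (lam 0) (kap 0)"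
    and "mu (Suc i) + nu i = min (lam i) (kap i) + max (lam (Suc i)) (kap (Suc i))"
    and "nu i \<le> lam i" "nu i \<le> kap i" "lam i \<le> mu i" "kap i \<le> mu i"
    and "(mu, kap) \<in> up_down L lam k"
    and "untoggle lam kap mu = nu"
    and "size_upto L mu + size_upto L nu = j + size_upto L lam + size_upto L kap"
proof -
  have b: "nu i \<le> lam i" "nu i \<le> kap i" "lam (Suc i) \<le> nu i" "kap (Suc i) \<le> nu i" for i
    using assms(2) by (auto simp: down_up_def hstrip_def hstrips_on_def)
  have z: "lam i = 0" "kap i = 0" if "L \<le> i" for i
    using that assms(1,2) by (auto simp: shape_def down_up_def hstrips_on_def)
  show mu0: "mu 0 = j + max (lam 0) (kap 0)"
    by (simp add: mu_def toggle_def)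
  show mu: "mu (Suc i) + nu i = min (lam i) (kap i) + max (lam (Suc i)) (kap (Suc i))" for i
    using b[of i] by (simp add: mu_def toggle_def)
  show "nu i \<le> lam i" "nu i \<le> kap i" for i by (rule b)+
  have up: "lam (Suc i) \<le> mu (Suc i)" "kap (Suc i) \<le> mu (Suc i)"
    "mu (Suc i) \<le> lam i" "mu (Suc i) \<le> kap i" for i
    using b[of i] mu[of i] by linarith+
  show le: "lam i \<le> mu i" "kap i \<le> mu i" for i
    using up mu0 by (cases i; simp)+
  show untog: "untoggle lam kap mu = nu"
    by (rule ext) (simp add: untoggle_def flip: mu)
  obtain m where m: "L = Suc m" using \<open>0 < L\<close> by (cases L) auto
  have last: "kap m = 0" "nu m = 0" using assms(3) m b(2)[of m] by auto
  show size: "size_upto L mu + size_upto L nu = j + size_upto L lam + size_upto L kap"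
    using toggle_size[of mu j lam kap nu m, OF mu0 mu] last by (simp add: m)
  have zero: "mu i = 0" if Li: "L \<le> i" for i
  proof -
    obtain i' where i': "i = Suc i'" "m \<le> i'" using Li m by (cases i) auto
    have "kap i' = 0" using i'(2) last z(2)[of i'] m by (cases "i' = m") auto
    then show ?thesis using up(4)[of i'] i' by simp
  qed
  have "size_upto L kap = size_upto L nu + (k - j)" "j \<le> k"
    using assms(2) by (auto simp: down_up_def hstrips_on_def)
  then have "size_upto L mu = size_upto L lam + k"
    using size by linarith
  then show "(mu, kap) \<in> up_down L lam k"
    using zero le up by (auto simp: up_down_def hstrips_on_def hstrip_def)
qed

lemma untoggle_facts:
  assumes "shape L lam" and "(mu, kap) \<in> up_down L lam k" and "kap (L - 1) = 0" and "0 < L"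
  defines "nu \<equiv> untoggle lam kap mu" and "j \<equiv> mu 0 - max (lam 0) (kap 0)"
  shows "(nu, j, kap) \<in> down_up L lam k" and "toggle lam kap j nu = mu"
proof -
  have b: "lam i \<le> mu i" "kap i \<le> mu i" "mu (Suc i) \<le> lam i" "mu (Suc i) \<le> kap i" for i
    using assms(2) by (auto simp: up_down_def hstrip_def hstrips_on_def)
  have z: "mu i = 0" "lam i = 0" "kap i = 0" if "L \<le> i" for i
    using that assms(1,2) b(2)[of i] by (auto simp: shape_def up_down_def hstrips_on_def)
  have mu0: "mu 0 = j + max (lam 0) (kap 0)"
    using b[of 0] by (simp add: j_def)
  have mu: "mu (Suc i) + nu i = min (lam i) (kap i) + max (lam (Suc i)) (kap (Suc i))" for i
    using b(3,4)[of i] by (simp add: nu_def untoggle_def)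
  have dn: "nu i \<le> lam i" "nu i \<le> kap i" "lam (Suc i) \<le> nu i" "kap (Suc i) \<le> nu i" for i
    using mu[of i] b(3,4)[of i] b(1,2)[of "Suc i"] by linarith+
  show tog: "toggle lam kap j nu = mu"
  proof
    fix i show "toggle lam kap j nu i = mu i"
      by (cases i) (simp_all add: toggle_def mu0 flip: mu)
  qed
  obtain m where m: "L = Suc m" using \<open>0 < L\<close> by (cases L) auto
  have last: "kap m = 0" "nu m = 0" using assms(3) m dn(2)[of m] by auto
  have size: "size_upto L mu + size_upto L nu = j + size_upto L lam + size_upto L kap"
    using toggle_size[of mu j lam kap nu m, OF mu0 mu] last by (simp add: m)
  have "size_upto L mu = size_upto L lam + k"
    using assms(2) by (auto simp: up_down_def hstrips_on_def)
  moreover have "size_upto L nu \<le> size_upto L kap"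
    by (rule sum_mono) (rule dn)
  ultimately have "j \<le> k" "size_upto L kap = size_upto L nu + (k - j)"
    using size by linarith+
  then show "(nu, j, kap) \<in> down_up L lam k"
    using z dn by (auto simp: down_up_def hstrips_on_def hstrip_def)
qed

lemma down_up_sum:
  assumes "shape L lam"
  shows "(\<Sum>nu | hstrip nu lam. \<Sum>j\<le>k. \<Sum>kap\<in>hstrips_on L nu (k - j). F nu j kap) =
    (\<Sum>(nu, j, kap)\<in>down_up L lam k. F nu j kap)"
proof -
  have "(\<Sum>nu | hstrip nu lam. \<Sum>j\<le>k. \<Sum>kap\<in>hstrips_on L nu (k - j). F nu j kap) =
    (\<Sum>(nu, j, kap)\<in>(SIGMA nu : {nu. hstrip nu lam}. SIGMA j : {..k}. hstrips_on L nu (k - j)). F nu j kap)"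
    by (simp add: sum.Sigma finite_hstrip[OF assms] finite_hstrips_on)
  also have "(SIGMA nu : {nu. hstrip nu lam}. SIGMA j : {..k}. hstrips_on L nu (k - j)) = down_up L lam k"
    by (auto simp: down_up_def)
  finally show ?thesis .
qed

lemma up_down_sum:
  "(\<Sum>mu\<in>hstrips_on L lam k. \<Sum>kap | hstrip kap mu. F mu kap) = (\<Sum>(mu, kap)\<in>up_down L lam k. F mu kap)"
proof -
  have "(\<Sum>mu\<in>hstrips_on L lam k. \<Sum>kap | hstrip kap mu. F mu kap) =
    (\<Sum>(mu, kap)\<in>(SIGMA mu : hstrips_on L lam k. {kap. hstrip kap mu}). F mu kap)"
    by (rule sum.Sigma) (auto simp: finite_hstrips_on finite_hstrip[OF hstrips_on_shape])
  also have "(SIGMA mu : hstrips_on L lam k. {kap. hstrip kap mu}) = up_down L lam k"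
    by (auto simp: up_down_def)
  finally show ?thesis .
qed

lemma finite_down_up:
  assumes "shape L lam"
  shows "finite (down_up L lam k)"
proof -
  have "down_up L lam k = (SIGMA nu : {nu. hstrip nu lam}. SIGMA j : {..k}. hstrips_on L nu (k - j))"
    by (auto simp: down_up_def)
  then show ?thesis
    using finite_hstrip[OF assms] finite_hstrips_on by (auto intro!: finite_SigmaI)
qed

lemma finite_up_down: "finite (up_down L lam k)"
proof -
  have "up_down L lam k = (SIGMA mu : hstrips_on L lam k. {kap. hstrip kap mu})"
    by (auto simp: up_down_def)
  then show ?thesis
    using finite_hstrip[OF hstrips_on_shape] finite_hstrips_on by (auto intro!: finite_SigmaI)
qed

lemma shape_antimono: "shape L lam \<Longrightarrow> i \<le> j \<Longrightarrow> lam j \<le> lam i"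
  by (rule lift_Suc_antimono_le[of lam]) (simp_all add: shape_def)

text \<open>The Pieri rule, by induction on the number of variables. Splitting off the last variable on both sides
gives sums over paths \<open>lam, nu, kap\<close> and \<open>lam, mu, kap\<close>, which \<open>toggle\<close> matches together with their
signs.\<close>

lemma tab_sum_hsym:
  assumes "shape L lam" and "n \<le> L"
  shows "tab_sum L n lam * hsym n k =
    (\<Sum>mu\<in>hstrips_on L lam k. (-1) ^ pieri_sign L lam mu * tab_sum L n mu)"
  using assms
proof (induction n arbitrary: lam k)
  case 0
  show ?case
  proof (cases "k = 0")
    case True
    have "mu = lam" if "mu \<in> hstrips_on L lam 0" "mu = (\<lambda>_. 0)" for mu
      using that by (auto simp: hstrips_on_def hstrip_def)
    moreover have "lam \<in> hstrips_on L lam 0"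
      using 0 by (auto simp: hstrips_on_def hstrip_def shape_def)
    ultimately have "(\<Sum>mu\<in>hstrips_on L lam 0. (-1) ^ pieri_sign L lam mu * tab_sum L 0 mu) =
      (\<Sum>mu\<in>{lam}. (-1) ^ pieri_sign L lam mu * tab_sum L 0 mu)"
      by (intro sum.mono_neutral_right) (auto simp: finite_hstrips_on)
    then show ?thesis
      by (simp add: True inv_form_def)
  next
    case False
    have "tab_sum L 0 mu = 0" if "mu \<in> hstrips_on L lam k" for mu
      using that False by (auto simp: hstrips_on_def)
    then show ?thesis
      using False by simp
  qed
next
  case (Suc n)
  let ?x = "xt (Suc n)"
  let ?s = "size_upto L"
  define F where "F kap = tab_sum L n kap * ?x ^ (?s lam + k - ?s kap)" for kap
  define f where "f = (\<lambda>(nu, j, kap).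
    (-1) ^ (skew_sign L lam nu + (?s lam - ?s nu) * (k - j) + pieri_sign L nu kap) * F kap)"
  define g where "g = (\<lambda>(mu, kap). (-1) ^ (pieri_sign L lam mu + skew_sign L mu kap) * F kap)"
  have "tab_sum L (Suc n) lam * hsym (Suc n) k =
    (\<Sum>nu | hstrip nu lam. \<Sum>j\<le>k. (-1) ^ skew_sign L lam nu * tab_sum L n nu *
      ?x ^ (?s lam - ?s nu) * (hsym n (k - j) * ?x ^ j))"
    by (simp only: tab_sum.simps hsym.simps sum_product)
  also have "\<dots> = (\<Sum>nu | hstrip nu lam. \<Sum>j\<le>k. \<Sum>kap\<in>hstrips_on L nu (k - j).
      f (nu, j, kap))"
    unfolding f_def prod.case
  proof (intro sum.cong refl)
    fix nu j assume "nu \<in> {nu. hstrip nu lam}" and j: "j \<in> {..k}"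
    then have nu: "hstrip nu lam" by simp
    have "(-1) ^ skew_sign L lam nu * tab_sum L n nu * ?x ^ (?s lam - ?s nu) * (hsym n (k - j) * ?x ^ j)
      = (-1) ^ skew_sign L lam nu * tab_sum L n nu * (?x ^ (?s lam - ?s nu) * hsym n (k - j)) * ?x ^ j"
      by (simp only: mult.assoc)
    also have "?x ^ (?s lam - ?s nu) * hsym n (k - j) =
        (-1) ^ ((?s lam - ?s nu) * (k - j)) * hsym n (k - j) * ?x ^ (?s lam - ?s nu)"
      by (rule xt_power_hsym) simp
    also have "(-1) ^ skew_sign L lam nu * tab_sum L n nu *
        ((-1) ^ ((?s lam - ?s nu) * (k - j)) * hsym n (k - j) * ?x ^ (?s lam - ?s nu)) * ?x ^ j =
      (-1) ^ (skew_sign L lam nu + (?s lam - ?s nu) * (k - j)) * (tab_sum L n nu * hsym n (k - j)) *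
        ?x ^ (?s lam - ?s nu + j)"
      by (simp only: power_add mult.assoc sign_left_commute[of "tab_sum L n nu"])
    also have "tab_sum L n nu * hsym n (k - j) =
        (\<Sum>kap\<in>hstrips_on L nu (k - j). (-1) ^ pieri_sign L nu kap * tab_sum L n kap)"
      using Suc.prems nu by (intro Suc.IH) (auto intro: hstrip_shape_lower)
    also have "(-1) ^ (skew_sign L lam nu + (?s lam - ?s nu) * (k - j)) * \<dots> * ?x ^ (?s lam - ?s nu + j) =
      (\<Sum>kap\<in>hstrips_on L nu (k - j).
        (-1) ^ (skew_sign L lam nu + (?s lam - ?s nu) * (k - j) + pieri_sign L nu kap) * F kap)"
      unfolding sum_distrib_left sum_distrib_right
    proof (rule sum.cong[OF refl])
      fix kap assume "kap \<in> hstrips_on L nu (k - j)"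
      then have "?s kap = ?s nu + (k - j)" by (simp add: hstrips_on_def)
      then have e: "?s lam - ?s nu + j = ?s lam + k - ?s kap"
        using j hstrip_size[OF nu, of L] by simp
      show "(-1) ^ (skew_sign L lam nu + (?s lam - ?s nu) * (k - j)) *
          ((-1) ^ pieri_sign L nu kap * tab_sum L n kap) * ?x ^ (?s lam - ?s nu + j) =
        (-1) ^ (skew_sign L lam nu + (?s lam - ?s nu) * (k - j) + pieri_sign L nu kap) * F kap"
        by (simp only: e F_def power_add mult.assoc)
    qed
    finally show "(-1) ^ skew_sign L lam nu * tab_sum L n nu * ?x ^ (?s lam - ?s nu) * (hsym n (k - j) * ?x ^ j)
      = (\<Sum>kap\<in>hstrips_on L nu (k - j).
        (-1) ^ (skew_sign L lam nu + (?s lam - ?s nu) * (k - j) + pieri_sign L nu kap) * F kap)" .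
  qed
  also have "\<dots> = sum f (down_up L lam k)"
    using down_up_sum[OF Suc.prems(1), where k = k and F = "\<lambda>nu j kap. f (nu, j, kap)"] by simp
  finally have left: "tab_sum L (Suc n) lam * hsym (Suc n) k = sum f (down_up L lam k)" .
  \<comment> \<open>With at most \<open>L\<close> rows allowed, the last row of \<open>nu\<close> has no partner in \<open>mu\<close>. It is empty if the last
    row of \<open>kap\<close> is, and otherwise \<open>kap\<close> has more rows than there are variables and contributes nothing.\<close>
  define A where "A = {t \<in> down_up L lam k. snd (snd t) (L - 1) = 0}"
  define B where "B = {t \<in> up_down L lam k. snd t (L - 1) = 0}"
  have vanish: "F kap = 0" if "kap (L - 1) \<noteq> 0" "shape L kap" for kap
  proof -
    have "kap (L - 1) \<le> kap n"
      by (rule shape_antimono[OF that(2)]) (use Suc.prems(2) in simp)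
    then show ?thesis using that(1) by (simp add: F_def tab_sum_eq_0)
  qed
  have "sum f (down_up L lam k) = sum f A"
  proof (rule sum.mono_neutral_right)
    show "\<forall>t\<in>down_up L lam k - A. f t = 0"
    proof
      fix t assume "t \<in> down_up L lam k - A"
      then obtain nu j kap where t: "t = (nu, j, kap)"
        and kap: "kap (L - 1) \<noteq> 0" "kap \<in> hstrips_on L nu (k - j)"
        by (cases t) (auto simp: A_def down_up_def)
      show "f t = 0"
        using vanish[OF kap(1) hstrips_on_shape[OF kap(2)]] by (simp add: t f_def)
    qed
  qed (auto simp: A_def finite_down_up[OF Suc.prems(1)])
  also have "\<dots> = sum g B"
  proof (rule sum.reindex_bij_witness[where
        i = "\<lambda>(mu, kap). (untoggle lam kap mu, mu 0 - max (lam 0) (kap 0), kap)" and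
        j = "\<lambda>(nu, j, kap). (toggle lam kap j nu, kap)"])
    fix a assume "a \<in> A"
    then obtain nu j kap where a: "a = (nu, j, kap)" and d: "(nu, j, kap) \<in> down_up L lam k" "kap (L - 1) = 0"
      by (cases a) (auto simp: A_def)
    have L: "0 < L" using Suc.prems by simp
    note tf = toggle_facts[OF Suc.prems(1) d L]
    let ?mu = "toggle lam kap j nu"
    show "(case (case a of (nu, j, kap) \<Rightarrow> (toggle lam kap j nu, kap)) of
      (mu, kap) \<Rightarrow> (untoggle lam kap mu, mu 0 - max (lam 0) (kap 0), kap)) = a"
      by (simp add: a tf)
    show "(case a of (nu, j, kap) \<Rightarrow> (toggle lam kap j nu, kap)) \<in> B"
      using tf(7) d by (simp add: a B_def)
    obtain m where m: "L = Suc m" using L by (cases L) auto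
    have "kap m = 0" "nu m = 0" using d(2) m tf(4)[of m] by auto
    then have "even (skew_sign L lam nu + pieri_sign L nu kap + pieri_sign L lam ?mu + skew_sign L ?mu kap
        + (?s lam + ?s nu) * (?s kap + ?s nu))"
      using toggle_sign[OF tf(1-6), of L] by (simp add: m)
    moreover have "?s nu \<le> ?s lam" "?s kap = ?s nu + (k - j)"
      using d(1) hstrip_size by (auto simp: down_up_def hstrips_on_def)
    then have "even (?s lam + ?s nu) = even (?s lam - ?s nu)" "even (?s kap + ?s nu) = even (k - j)"
      by (simp, simp only: even_add, blast)
    ultimately have par: "even (pieri_sign L lam ?mu + skew_sign L ?mu kap) =
        even (skew_sign L lam nu + (?s lam - ?s nu) * (k - j) + pieri_sign L nu kap)"
      unfolding even_add even_mult_iff by (smt (verit))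
    show "g (case a of (nu, j, kap) \<Rightarrow> (toggle lam kap j nu, kap)) = f a"
      by (simp only: a f_def g_def prod.case minus_one_power_cong[OF par])
  next
    fix b assume "b \<in> B"
    then obtain mu kap where b: "b = (mu, kap)" and d: "(mu, kap) \<in> up_down L lam k" "kap (L - 1) = 0"
      by (cases b) (auto simp: B_def)
    have L: "0 < L" using Suc.prems by simp
    note tf = untoggle_facts[OF Suc.prems(1) d L]
    show "(case (case b of (mu, kap) \<Rightarrow> (untoggle lam kap mu, mu 0 - max (lam 0) (kap 0), kap)) of
      (nu, j, kap) \<Rightarrow> (toggle lam kap j nu, kap)) = b"
      by (simp add: b tf)
    show "(case b of (mu, kap) \<Rightarrow> (untoggle lam kap mu, mu 0 - max (lam 0) (kap 0), kap)) \<in> A"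
      using tf(1) d by (simp add: b A_def)
  qed
  also have "\<dots> = sum g (up_down L lam k)"
  proof (rule sum.mono_neutral_left)
    show "\<forall>t\<in>up_down L lam k - B. g t = 0"
    proof
      fix t assume "t \<in> up_down L lam k - B"
      then obtain mu kap where t: "t = (mu, kap)"
        and kap: "kap (L - 1) \<noteq> 0" "mu \<in> hstrips_on L lam k" "hstrip kap mu"
        by (cases t) (auto simp: B_def up_down_def)
      show "g t = 0"
        using vanish[OF kap(1) hstrip_shape_lower[OF kap(3) hstrips_on_shape[OF kap(2)]]]
        by (simp add: t g_def)
    qed
  qed (auto simp: B_def finite_up_down)
  also have "\<dots> = (\<Sum>mu\<in>hstrips_on L lam k. \<Sum>kap | hstrip kap mu.
      (-1) ^ (pieri_sign L lam mu + skew_sign L mu kap) * F kap)"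
    using up_down_sum[where F = "\<lambda>mu kap. g (mu, kap)"] by (simp add: g_def)
  also have "\<dots> = (\<Sum>mu\<in>hstrips_on L lam k. (-1) ^ pieri_sign L lam mu * tab_sum L (Suc n) mu)"
    unfolding tab_sum.simps sum_distrib_left
    by (intro sum.cong refl) (simp add: F_def hstrips_on_def power_add mult.assoc)
  finally show ?case
    unfolding left .
qed

section \<open>The Pieri rule for elementary functions\<close>

lemma hsym_Suc_Suc: "hsym (Suc n) (Suc k) = hsym n (Suc k) + hsym (Suc n) k * xt (Suc n)"
proof -
  have "hsym (Suc n) (Suc k) = hsym n (Suc k) + (\<Sum>j\<le>k. hsym n (k - j) * xt (Suc n) ^ Suc j)"
    by (simp only: hsym.simps sum.atMost_Suc_shift) simp
  also have "(\<Sum>j\<le>k. hsym n (k - j) * xt (Suc n) ^ Suc j) = hsym (Suc n) k * xt (Suc n)"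
    by (simp only: hsym.simps sum_distrib_right power_Suc2 mult.assoc)
  finally show ?thesis .
qed

lemma hsym_0 [simp]: "hsym n 0 = 1"
  by (induction n) simp_all

text \<open>Prefixing a weakly increasing word by a decreasing one: the largest letter can be moved between the two
words, which changes the sign. The recursion in the largest letter expresses this.\<close>

lemma esym_rev_hsym: "(\<Sum>i\<le>k. (-1) ^ i * esym_rev n i * hsym n (k - i)) = of_bool (k = 0)"
proof (induction n arbitrary: k)
  case 0
  show ?case
  proof (cases k)
    case (Suc k')
    have "(\<Sum>i\<le>Suc k'. (-1) ^ i * esym_rev 0 i * hsym 0 (Suc k' - i)) = 0"
      by (subst sum.atMost_Suc_shift) simp
    then show ?thesis using Suc by simp
  qed simp
next
  case (Suc n)
  let ?x = "xt (Suc n)"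
  \<comment> \<open>The largest letter is admitted only in the weakly increasing part; then just its powers remain.\<close>
  define Y where "Y k = (\<Sum>i\<le>k. (-1) ^ i * esym_rev n i * hsym (Suc n) (k - i))" for k
  have Y_Suc: "Y (Suc k) = Y k * ?x" for k
  proof -
    have "Y (Suc k) = (\<Sum>i\<le>k. (-1) ^ i * esym_rev n i * hsym (Suc n) (Suc (k - i))) + (-1) ^ Suc k * esym_rev n (Suc k)"
      by (simp add: Y_def Suc_diff_le)
    also have "(\<Sum>i\<le>k. (-1) ^ i * esym_rev n i * hsym (Suc n) (Suc (k - i))) =
      (\<Sum>i\<le>k. (-1) ^ i * esym_rev n i * hsym n (Suc k - i)) + Y k * ?x"
      unfolding Y_def sum_distrib_right sum.distrib[symmetric]
      by (rule sum.cong) (simp_all add: hsym_Suc_Suc distrib_left mult.assoc Suc_diff_le del: hsym.simps)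
    finally have "Y (Suc k) = (\<Sum>i\<le>Suc k. (-1) ^ i * esym_rev n i * hsym n (Suc k - i)) + Y k * ?x"
      by simp
    then show ?thesis by (simp only: Suc.IH) simp
  qed
  have Y: "Y k = ?x ^ k" for k
    by (induction k) (simp_all add: Y_Suc power_commutes, simp add: Y_def)
  show ?case
  proof (cases k)
    case (Suc k')
    have "(\<Sum>i\<le>Suc k'. (-1) ^ i * esym_rev (Suc n) i * hsym (Suc n) (Suc k' - i)) =
      hsym (Suc n) (Suc k') + (\<Sum>i\<le>k'. (-1) ^ Suc i * esym_rev (Suc n) (Suc i) * hsym (Suc n) (k' - i))"
      by (subst sum.atMost_Suc_shift) (simp del: hsym.simps)
    also have "(\<Sum>i\<le>k'. (-1) ^ Suc i * esym_rev (Suc n) (Suc i) * hsym (Suc n) (k' - i)) =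
      (\<Sum>i\<le>k'. (-1) ^ Suc i * esym_rev n (Suc i) * hsym (Suc n) (k' - i)) - ?x * Y k'"
      unfolding Y_def sum_distrib_left sum_subtractf[symmetric]
    proof (rule sum.cong[OF refl])
      fix i
      show "(-1) ^ Suc i * esym_rev (Suc n) (Suc i) * hsym (Suc n) (k' - i) =
        (-1) ^ Suc i * esym_rev n (Suc i) * hsym (Suc n) (k' - i) -
        ?x * ((-1) ^ i * esym_rev n i * hsym (Suc n) (k' - i))"
        by (simp add: esym_rev_Suc algebra_simps sign_left_commute[of ?x] del: hsym.simps)
    qed
    also have "hsym (Suc n) (Suc k') +
        ((\<Sum>i\<le>k'. (-1) ^ Suc i * esym_rev n (Suc i) * hsym (Suc n) (k' - i)) - ?x * Y k') =
      Y (Suc k') - ?x * Y k'"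
      unfolding Y_def[of "Suc k'"] by (subst sum.atMost_Suc_shift) (simp del: hsym.simps)
    finally show ?thesis
      using Suc by (simp add: Y del: hsym.simps)
  qed simp
qed

definition vstrips :: "nat \<Rightarrow> (nat \<Rightarrow> nat) \<Rightarrow> nat \<Rightarrow> nat set set"
  where "vstrips L lam k = {A. A \<subseteq> {..<L} \<and> card A = k \<and> shape L (add_strip lam A)}"

lemma finite_vstrips: "finite (vstrips L lam k)"
  by (rule finite_subset[of _ "Pow {..<L}"]) (auto simp: vstrips_def)

abbreviation column_sign :: "nat \<Rightarrow> (nat \<Rightarrow> nat) \<Rightarrow> nat set \<Rightarrow> nat"
  where "column_sign L lam A \<equiv> inv_form L (ind A) (\<lambda>i. add_strip lam A i + 1)"

text \<open>Pairs of a vertical strip \<open>A\<close> on \<open>lam\<close> followed by a horizontal strip, with \<open>k\<close> boxes in total.\<close>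

definition strip_pairs :: "nat \<Rightarrow> (nat \<Rightarrow> nat) \<Rightarrow> nat \<Rightarrow> (nat set \<times> (nat \<Rightarrow> nat)) set"
  where "strip_pairs L lam k = {(A, mu). card A \<le> k \<and> A \<in> vstrips L lam (card A) \<and>
    mu \<in> hstrips_on L (add_strip lam A) (k - card A)}"

lemma size_add_strip: "A \<subseteq> {..<L} \<Longrightarrow> size_upto L (add_strip lam A) = size_upto L lam + card A"
  using sum_mult_ind[of A L "\<lambda>_. 1"] by (simp add: sum.distrib)

text \<open>The union of the two strips does not depend on how many boxes belong to \<open>A\<close>. In this form a box can be
moved from one strip to the other.\<close>

lemma strip_pairs_iff:
  assumes "shape L lam"
  shows "(A, mu) \<in> strip_pairs L lam k \<longleftrightarrow> A \<subseteq> {..<L} \<and> hstrip (add_strip lam A) mu \<and>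
    (\<forall>i\<ge>L. mu i = 0) \<and> size_upto L mu = size_upto L lam + k"
proof
  assume "(A, mu) \<in> strip_pairs L lam k"
  then show "A \<subseteq> {..<L} \<and> hstrip (add_strip lam A) mu \<and>
    (\<forall>i\<ge>L. mu i = 0) \<and> size_upto L mu = size_upto L lam + k"
    by (auto simp: strip_pairs_def vstrips_def hstrips_on_def size_add_strip)
next
  assume r: "A \<subseteq> {..<L} \<and> hstrip (add_strip lam A) mu \<and>
    (\<forall>i\<ge>L. mu i = 0) \<and> size_upto L mu = size_upto L lam + k"
  have "add_strip lam A (Suc i) \<le> add_strip lam A i" for i
    by (rule order.trans[of _ "mu (Suc i)"]) (use r in \<open>simp_all add: hstrip_def\<close>)
  then have "shape L (add_strip lam A)"
    using r assms by (auto simp: shape_def)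
  moreover have "size_upto L lam + card A \<le> size_upto L mu"
    using r hstrip_size[of "add_strip lam A" mu L] by (simp add: size_add_strip)
  ultimately show "(A, mu) \<in> strip_pairs L lam k"
    using r by (auto simp: strip_pairs_def vstrips_def hstrips_on_def size_add_strip)
qed

definition last_row :: "(nat \<Rightarrow> nat) \<Rightarrow> (nat \<Rightarrow> nat) \<Rightarrow> nat"
  where "last_row lam mu = Max {i. lam i < mu i}"

lemma last_row:
  assumes "\<And>i. i \<ge> L \<Longrightarrow> mu i = 0" and "size_upto L lam < size_upto L mu"
  shows "last_row lam mu < L" and "lam (last_row lam mu) < mu (last_row lam mu)"
    and "last_row lam mu < i \<Longrightarrow> mu i \<le> lam i"
proof -
  let ?I = "{i. lam i < mu i}"
  have sub: "?I \<subseteq> {..<L}"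
  proof
    fix i assume "i \<in> ?I"
    then have "mu i \<noteq> 0" by simp
    then show "i \<in> {..<L}" using assms(1)[of i] by (cases "i < L") auto
  qed
  then have fin: "finite ?I" using finite_subset by blast
  have "?I \<noteq> {}"
  proof
    assume "?I = {}"
    then have "size_upto L mu \<le> size_upto L lam" by (intro sum_mono) (auto simp: not_less)
    then show False using assms(2) by simp
  qed
  then have "last_row lam mu \<in> ?I"
    unfolding last_row_def using fin by (rule Max_in[rotated])
  then show "last_row lam mu < L" "lam (last_row lam mu) < mu (last_row lam mu)"
    using sub by auto
  show "mu i \<le> lam i" if "last_row lam mu < i"
  proof (rule ccontr)
    assume "\<not> mu i \<le> lam i"
    then have "i \<le> last_row lam mu"
      unfolding last_row_def using fin by (intro Max_ge) auto
    with that show False by simp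
  qed
qed

text \<open>The exponents combine into one expression that depends on \<open>A\<close> only through the rows that precede the last
nonempty row of the union.\<close>

lemma strip_pairs_sign:
  assumes "A \<subseteq> {..<L}" and "hstrip (add_strip lam A) mu"
  shows "column_sign L lam A + pieri_sign L (add_strip lam A) mu =
    inv_form L (\<lambda>i. mu i - lam i) (\<lambda>i. add_strip lam A i + 1)"
proof -
  have "mu i - lam i = ind A i + (mu i - add_strip lam A i)" for i
    using assms(2)[unfolded hstrip_def, rule_format, of i] by simp
  then have "inv_form L (\<lambda>i. mu i - lam i) (\<lambda>i. add_strip lam A i + 1) =
    inv_form L (\<lambda>i. ind A i + (mu i - add_strip lam A i)) (\<lambda>i. add_strip lam A i + 1)"
    by presburger
  then show ?thesis by (simp only: inv_form_add_left)
qed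

text \<open>In the last nonempty row of the union, the first added box may belong to either strip. Moving it changes
the size of \<open>A\<close> by one and leaves the exponent of \<open>strip_pairs_sign\<close> unchanged. The pairs are
matched instead of halving the sum, since the ring is not known to be free of torsion.\<close>

lemma strip_pairs_cancel:
  assumes "shape L lam" and "0 < k"
  shows "(\<Sum>(A, mu)\<in>strip_pairs L lam k.
    (-1) ^ (card A + (column_sign L lam A + pieri_sign L (add_strip lam A) mu)) * F mu) = (0 :: skew_poly)"
proof -
  define f where "f = (\<lambda>(A, mu).
    (-1) ^ (card A + (column_sign L lam A + pieri_sign L (add_strip lam A) mu)) * F mu)"
  define W0 where "W0 = {t \<in> strip_pairs L lam k. last_row lam (snd t) \<notin> fst t}"
  define W1 where "W1 = {t \<in> strip_pairs L lam k. last_row lam (snd t) \<in> fst t}"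
  have fin: "finite (strip_pairs L lam k)"
  proof (rule finite_subset)
    show "strip_pairs L lam k \<subseteq> (SIGMA A : Pow {..<L}. hstrips_on L (add_strip lam A) (k - card A))"
      by (auto simp: strip_pairs_def vstrips_def)
  qed (auto intro!: finite_SigmaI finite_hstrips_on)
  have pairs: "A \<subseteq> {..<L}" "hstrip (add_strip lam A) mu"
      "last_row lam mu < L" "lam (last_row lam mu) < mu (last_row lam mu)"
      "\<And>i. last_row lam mu < i \<Longrightarrow> mu i \<le> lam i"
    if "(A, mu) \<in> strip_pairs L lam k" for A mu
  proof -
    note p = that[unfolded strip_pairs_iff[OF assms(1)]]
    show "A \<subseteq> {..<L}" "hstrip (add_strip lam A) mu" using p by auto
    have "\<And>i. i \<ge> L \<Longrightarrow> mu i = 0" "size_upto L lam < size_upto L mu" using p assms(2) by auto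
    note lr = last_row[OF this]
    show "last_row lam mu < L" "lam (last_row lam mu) < mu (last_row lam mu)"
      "\<And>i. last_row lam mu < i \<Longrightarrow> mu i \<le> lam i" by (rule lr; assumption?)+
  qed
  have flip: "(A', mu) \<in> strip_pairs L lam k"
    if "(A, mu) \<in> strip_pairs L lam k" and A': "A' = insert (last_row lam mu) A \<or> A' = A - {last_row lam mu}"
    for A A' mu
  proof -
    let ?m = "last_row lam mu"
    note p = that(1)[unfolded strip_pairs_iff[OF assms(1)]]
    note q = pairs[OF that(1)]
    have h: "mu (Suc i) \<le> add_strip lam A i" "add_strip lam A i \<le> mu i" for i
      using q(2) by (auto simp: hstrip_def)
    have "mu (Suc ?m) \<le> lam (Suc ?m)" using q(5) by simp
    also have "\<dots> \<le> lam ?m" using assms(1) by (simp add: shape_def)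
    finally have m: "mu (Suc ?m) \<le> lam ?m" .
    have "mu (Suc i) \<le> add_strip lam A' i \<and> add_strip lam A' i \<le> mu i" for i
    proof (cases "i = ?m")
      case True
      then show ?thesis using m q(4) by auto
    next
      case False
      then have "ind A' i = ind A i" using A' by auto
      then show ?thesis using h[of i] by simp
    qed
    then show ?thesis
      unfolding strip_pairs_iff[OF assms(1)] hstrip_def using p A' q(3) by auto
  qed
  have neg: "f (insert (last_row lam mu) A, mu) = - f (A, mu)"
    if t: "(A, mu) \<in> strip_pairs L lam k" and m: "last_row lam mu \<notin> A" for A mu
  proof -
    let ?m = "last_row lam mu" and ?A' = "insert (last_row lam mu) A"
    note t' = flip[OF t disjI1[OF refl]]
    have inv: "inv_form L (\<lambda>i. mu i - lam i) (\<lambda>i. add_strip lam ?A' i + 1) =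
      inv_form L (\<lambda>i. mu i - lam i) (\<lambda>i. add_strip lam A i + 1)"
      unfolding inv_form_def
    proof (rule sum.cong[OF refl])
      fix i
      show "(mu i - lam i) * (\<Sum>j<i. add_strip lam ?A' j + 1) =
        (mu i - lam i) * (\<Sum>j<i. add_strip lam A j + 1)"
      proof (cases "?m < i")
        case True
        then have "mu i - lam i = 0" using pairs(5)[OF t] by simp
        then show ?thesis by simp
      next
        case False
        then have "(\<Sum>j<i. add_strip lam ?A' j + 1) = (\<Sum>j<i. add_strip lam A j + 1)"
          by (intro sum.cong) auto
        then show ?thesis by simp
      qed
    qed
    have "finite A" using pairs(1)[OF t] finite_subset by blast
    then have "card ?A' = Suc (card A)" using m by simp
    then show ?thesis
      unfolding f_def prod.case strip_pairs_sign[OF pairs(1,2)[OF t]] strip_pairs_sign[OF pairs(1,2)[OF t']] inv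
      by simp
  qed
  have "sum f W1 = (\<Sum>t\<in>W0. - f t)"
  proof (rule sum.reindex_bij_witness[where
        i = "\<lambda>(A, mu). (insert (last_row lam mu) A, mu)" and
        j = "\<lambda>(A, mu). (A - {last_row lam mu}, mu)"])
    fix t assume "t \<in> W1"
    then obtain A mu where t: "t = (A, mu)" "(A, mu) \<in> strip_pairs L lam k" "last_row lam mu \<in> A"
      by (cases t) (auto simp: W1_def)
    note fl = flip[OF t(2) disjI2[OF refl]]
    show "(case (case t of (A, mu) \<Rightarrow> (A - {last_row lam mu}, mu)) of
      (A, mu) \<Rightarrow> (insert (last_row lam mu) A, mu)) = t"
      using t by auto
    show "(case t of (A, mu) \<Rightarrow> (A - {last_row lam mu}, mu)) \<in> W0"
      using t fl by (simp add: W0_def)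
    show "- f (case t of (A, mu) \<Rightarrow> (A - {last_row lam mu}, mu)) = f t"
      using neg[OF fl] t by (simp add: insert_absorb)
  next
    fix t assume "t \<in> W0"
    then obtain A mu where t: "t = (A, mu)" "(A, mu) \<in> strip_pairs L lam k" "last_row lam mu \<notin> A"
      by (cases t) (auto simp: W0_def)
    note fl = flip[OF t(2) disjI1[OF refl]]
    show "(case (case t of (A, mu) \<Rightarrow> (insert (last_row lam mu) A, mu)) of
      (A, mu) \<Rightarrow> (A - {last_row lam mu}, mu)) = t"
      using t by auto
    show "(case t of (A, mu) \<Rightarrow> (insert (last_row lam mu) A, mu)) \<in> W1"
      using t fl by (simp add: W1_def)
  qed
  moreover have "sum f (strip_pairs L lam k) = sum f (W0 \<union> W1)"
    by (rule arg_cong[of _ _ "sum f"]) (auto simp: W0_def W1_def)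
  moreover have "sum f (W0 \<union> W1) = sum f W0 + sum f W1"
    by (rule sum.union_disjoint) (use fin in \<open>auto simp: W0_def W1_def\<close>)
  ultimately show ?thesis by (simp add: sum_negf f_def)
qed

text \<open>Both sides satisfy the same recursion in \<open>k\<close>: the left one by \<open>esym_rev_hsym\<close>, the right one by the Pieri
rule for complete functions and \<open>strip_pairs_cancel\<close>.\<close>

lemma tab_sum_esym_rev:
  assumes "shape L lam" and "n \<le> L"
  shows "tab_sum L n lam * esym_rev n k =
    (\<Sum>A\<in>vstrips L lam k. (-1) ^ column_sign L lam A * tab_sum L n (add_strip lam A))"
  using assms(1)
proof (induction k arbitrary: lam rule: less_induct)
  case (less k)
  let ?S = "tab_sum L n"
  define E where "E i = (\<Sum>A\<in>vstrips L lam i. (-1) ^ column_sign L lam A * ?S (add_strip lam A))" for i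
  show ?case
  proof (cases "k = 0")
    case True
    have "vstrips L lam 0 = {{}}"
      using less.prems finite_subset[of _ "{..<L}"] by (auto simp: vstrips_def)
    then show ?thesis by (simp add: True inv_form_def)
  next
    case False
    have "E i * hsym n (k - i) = (\<Sum>A\<in>vstrips L lam i. \<Sum>mu\<in>hstrips_on L (add_strip lam A) (k - i).
      (-1) ^ (column_sign L lam A + pieri_sign L (add_strip lam A) mu) * ?S mu)" for i
      unfolding E_def sum_distrib_right
    proof (rule sum.cong[OF refl])
      fix A assume "A \<in> vstrips L lam i"
      then have "?S (add_strip lam A) * hsym n (k - i) = (\<Sum>mu\<in>hstrips_on L (add_strip lam A) (k - i).
        (-1) ^ pieri_sign L (add_strip lam A) mu * ?S mu)"
        using assms(2) by (intro tab_sum_hsym) (simp_all add: vstrips_def)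
      then show "(-1) ^ column_sign L lam A * ?S (add_strip lam A) * hsym n (k - i) =
        (\<Sum>mu\<in>hstrips_on L (add_strip lam A) (k - i).
          (-1) ^ (column_sign L lam A + pieri_sign L (add_strip lam A) mu) * ?S mu)"
        by (simp only: mult.assoc power_add sum_distrib_left)
    qed
    then have "(\<Sum>i\<le>k. (-1) ^ i * (E i * hsym n (k - i))) =
      (\<Sum>i\<le>k. \<Sum>A\<in>vstrips L lam i. \<Sum>mu\<in>hstrips_on L (add_strip lam A) (k - i).
      (-1) ^ (card A + (column_sign L lam A + pieri_sign L (add_strip lam A) mu)) * ?S mu)"
      by (simp add: sum_distrib_left mult.assoc power_add vstrips_def)
    also have "\<dots> = (\<Sum>(i, A, mu)\<in>(SIGMA i : {..k}. SIGMA A : vstrips L lam i. hstrips_on L (add_strip lam A) (k - i)).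
      (-1) ^ (card A + (column_sign L lam A + pieri_sign L (add_strip lam A) mu)) * ?S mu)"
      by (simp add: sum.Sigma finite_vstrips finite_hstrips_on)
    also have "\<dots> = (\<Sum>(A, mu)\<in>strip_pairs L lam k.
      (-1) ^ (card A + (column_sign L lam A + pieri_sign L (add_strip lam A) mu)) * ?S mu)"
      by (rule sum.reindex_bij_witness[where i = "\<lambda>(A, mu). (card A, A, mu)" and j = "\<lambda>(i, A, mu). (A, mu)"])
        (auto simp: strip_pairs_def vstrips_def)
    also have "\<dots> = 0"
      by (rule strip_pairs_cancel) (use less.prems False in auto)
    finally have comb: "(\<Sum>i\<le>k. (-1) ^ i * (E i * hsym n (k - i))) = 0" .
    have "(\<Sum>i\<le>k. (-1) ^ i * (?S lam * esym_rev n i * hsym n (k - i))) =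
        ?S lam * (\<Sum>i\<le>k. (-1) ^ i * esym_rev n i * hsym n (k - i))"
      by (simp only: sum_distrib_left mult.assoc sign_left_commute[of "?S lam"])
    then have alg: "(\<Sum>i\<le>k. (-1) ^ i * (?S lam * esym_rev n i * hsym n (k - i))) = 0"
      using False by (simp add: esym_rev_hsym)
    have "(\<Sum>i<k. (-1) ^ i * (?S lam * esym_rev n i * hsym n (k - i))) = (\<Sum>i<k. (-1) ^ i * (E i * hsym n (k - i)))"
      by (rule sum.cong) (use less in \<open>auto simp: E_def\<close>)
    then have "(-1) ^ k * (?S lam * esym_rev n k) = (-1) ^ k * E k"
      using alg comb by (simp add: lessThan_Suc_atMost[symmetric]) (metis add_left_imp_eq)
    then show ?thesis unfolding E_def by (rule sign_mult_cancel)
  qed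
qed

section \<open>The odd-symmetrized functions are the plactic functions\<close>

text \<open>The exponent is \<open>dN + N\<close> of the shape: the part of the form in \<open>lam\<close> is \<open>N_stat\<close>, the part in the constant 1
is \<open>dN_stat\<close>.\<close>

definition plactic :: "nat \<Rightarrow> nat \<Rightarrow> (nat \<Rightarrow> nat) \<Rightarrow> skew_poly"
  where "plactic L n lam = (-1) ^ inv_form L lam (\<lambda>i. lam i + 1) * tab_sum L n lam"

text \<open>By bilinearity the normalization of the plactic functions absorbs the sign of the vertical strip, up to
the sign that also occurs for the odd-symmetrized functions.\<close>

lemma plactic_esym_rev:
  assumes "shape L lam" and "n \<le> L"
  shows "plactic L n lam * esym_rev n k =
    (\<Sum>A\<in>vstrips L lam k. (-1) ^ inv_form L lam (ind A) * plactic L n (add_strip lam A))"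
proof -
  have "plactic L n lam * esym_rev n k = (\<Sum>A\<in>vstrips L lam k.
      (-1) ^ (inv_form L lam (\<lambda>i. lam i + 1) + column_sign L lam A) * tab_sum L n (add_strip lam A))"
    by (simp only: plactic_def mult.assoc tab_sum_esym_rev[OF assms] sum_distrib_left power_add)
  also have "\<dots> = (\<Sum>A\<in>vstrips L lam k. (-1) ^ inv_form L lam (ind A) * plactic L n (add_strip lam A))"
  proof (rule sum.cong[OF refl])
    fix A
    let ?r = "\<lambda>i. add_strip lam A i + 1"
    have "inv_form L (add_strip lam A) ?r = inv_form L lam ?r + column_sign L lam A"
      by (rule inv_form_add_left)
    also have "inv_form L lam ?r = inv_form L lam (\<lambda>i. (lam i + 1) + ind A i)"
      by (rule inv_form_cong) simp_all
    also have "\<dots> = inv_form L lam (\<lambda>i. lam i + 1) + inv_form L lam (ind A)"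
      by (rule inv_form_add_right)
    finally have "even (inv_form L lam (\<lambda>i. lam i + 1) + column_sign L lam A) =
        even (inv_form L lam (ind A) + inv_form L (add_strip lam A) ?r)"
      by (simp only: even_add) blast
    note sign = minus_one_power_cong[OF this, where 'a = skew_poly]
    show "(-1) ^ (inv_form L lam (\<lambda>i. lam i + 1) + column_sign L lam A) * tab_sum L n (add_strip lam A) =
      (-1) ^ inv_form L lam (ind A) * plactic L n (add_strip lam A)"
      by (simp only: plactic_def sign flip: mult.assoc power_add)
  qed
  finally show ?thesis .
qed

lemma hstrip_zero [simp]: "hstrip nu (\<lambda>_. 0) \<longleftrightarrow> nu = (\<lambda>_. 0)"
  by (auto simp: hstrip_def)

lemma inv_form_zero [simp]: "inv_form L (\<lambda>_. 0) b = 0" "inv_form L a (\<lambda>_. 0) = 0"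
  by (simp_all add: inv_form_def)

lemma tab_sum_zero: "tab_sum L n (\<lambda>_. 0) = 1"
  by (induction n) simp_all

lemma shape_nonzero_above: "shape L lam \<Longrightarrow> lam j \<noteq> 0 \<Longrightarrow> i \<le> j \<Longrightarrow> lam i \<noteq> 0"
  using shape_antimono[of L lam i j] by simp

definition rows :: "nat \<Rightarrow> (nat \<Rightarrow> nat) \<Rightarrow> nat"
  where "rows n lam = card {i. i < n \<and> lam i \<noteq> 0}"

lemma rows_le: "rows n lam \<le> n"
  using card_mono[of "{..<n}" "{i. i < n \<and> lam i \<noteq> 0}"] by (auto simp: rows_def)

lemma less_rows_iff:
  assumes "shape n lam"
  shows "i < rows n lam \<longleftrightarrow> lam i \<noteq> 0"
proof
  assume "lam i \<noteq> 0"
  then have i: "i < n" using assms by (metis shape_def not_le)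
  have "{..i} \<subseteq> {i. i < n \<and> lam i \<noteq> 0}"
    using i shape_nonzero_above[OF assms \<open>lam i \<noteq> 0\<close>] by auto
  from card_mono[OF _ this] show "i < rows n lam" by (simp add: rows_def)
next
  assume i: "i < rows n lam"
  show "lam i \<noteq> 0"
  proof
    assume "lam i = 0"
    then have "{j. j < n \<and> lam j \<noteq> 0} \<subseteq> {..<i}"
      using shape_nonzero_above[OF assms, of _ i] by (metis (mono_tags, lifting) lessThan_iff mem_Collect_eq not_le subsetI)
    from card_mono[OF _ this] i show False by (simp add: rows_def)
  qed
qed

text \<open>If adding \<open>A\<close> does not give a partition, then two adjacent rows of equal length become \<open>l\<close> and \<open>l + 1\<close>;
adding the staircase makes the exponents equal, and the symmetrization vanishes.\<close>

lemma sym_schur_esym_rev_shape: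
  assumes "shape n nu"
  shows "sym_schur n nu * esym_rev n k =
    (\<Sum>A\<in>vstrips n nu k. (-1) ^ inv_form n nu (ind A) * sym_schur n (add_strip nu A))"
  unfolding sym_schur_esym_rev
proof (rule sum.mono_neutral_right)
  show "finite {A. A \<subseteq> {..<n} \<and> card A = k}" by (rule finite_card_subsets)
  show "vstrips n nu k \<subseteq> {A. A \<subseteq> {..<n} \<and> card A = k}" by (auto simp: vstrips_def)
  show "\<forall>A\<in>{A. A \<subseteq> {..<n} \<and> card A = k} - vstrips n nu k.
    (-1) ^ inv_form n nu (ind A) * sym_schur n (add_strip nu A) = 0"
  proof
    fix A assume "A \<in> {A. A \<subseteq> {..<n} \<and> card A = k} - vstrips n nu k"
    then have A: "A \<subseteq> {..<n}" "\<not> shape n (add_strip nu A)" by (auto simp: vstrips_def)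
    have "add_strip nu A i = 0" if "n \<le> i" for i
      using A(1) assms that by (auto simp: shape_def)
    then obtain i where i: "add_strip nu A i < add_strip nu A (Suc i)"
      using A(2) by (auto simp: shape_def not_le)
    have le: "nu (Suc i) \<le> nu i" using assms by (simp add: shape_def)
    with i have "Suc i \<in> A" "i \<notin> A" "nu (Suc i) = nu i"
      by (auto split: if_splits simp: of_bool_def)
    then have "Suc i < n" "add_strip nu A (Suc i) = Suc (add_strip nu A i)"
      using A by auto
    then show "(-1) ^ inv_form n nu (ind A) * sym_schur n (add_strip nu A) = 0"
      by (simp add: sym_schur_eq_0)
  qed
qed

text \<open>Let \<open>k\<close> be the number of rows of \<open>lam\<close> and \<open>nu\<close> the shape without its first column. Both families have the
same expansion of the product of the function of \<open>nu\<close> with the elementary function of degree \<open>k\<close>. One of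
the terms is \<open>lam\<close>, and all the others have the same size but more rows.\<close>

theorem sym_schur_eq_plactic:
  assumes "shape n lam"
  shows "sym_schur n lam = plactic n n lam"
  using assms
\<comment> \<open>The measure orders by size first and then by decreasing number of rows, which is at most \<open>n\<close>.\<close>
proof (induction lam rule: measure_induct_rule[where f = "\<lambda>lam. size_upto n lam * Suc n + (n - rows n lam)"])
  case (less lam)
  define k where "k = rows n lam"
  show ?case
  proof (cases "k = 0")
    case True
    then have "lam = (\<lambda>_. 0)"
      using less_rows_iff[OF less.prems] by (auto simp: k_def)
    then show ?thesis
      by (simp add: sym_schur_0 plactic_def tab_sum_zero)
  next
    case False
    define nu where "nu i = lam i - 1" for i
    have nu: "shape n nu" using less.prems by (auto simp: shape_def nu_def diff_le_mono)
    have lam: "lam = add_strip nu {..<k}"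
      using less_rows_iff[OF less.prems] by (auto simp: k_def nu_def fun_eq_iff)
    have kn: "{..<k} \<subseteq> {..<n}" using rows_le[of n lam] by (auto simp: k_def)
    have A0: "{..<k} \<in> vstrips n nu k"
      using kn less.prems by (simp only: vstrips_def mem_Collect_eq lam[symmetric] card_lessThan simp_thms)
    have size: "size_upto n lam = size_upto n nu + k"
      using size_add_strip[OF kn, of nu] by (simp only: lam[symmetric] card_lessThan)
    have small: "sym_schur n kap = plactic n n kap"
      if "shape n kap" "size_upto n kap < size_upto n lam \<or> size_upto n kap = size_upto n lam \<and> k < rows n kap" for kap
    proof (rule less.IH[OF _ that(1)])
      show "size_upto n kap * Suc n + (n - rows n kap) < size_upto n lam * Suc n + (n - rows n lam)"
        using that(2)
      proof
        assume "size_upto n kap < size_upto n lam"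
        then have "Suc (size_upto n kap) * Suc n \<le> size_upto n lam * Suc n"
          by (intro mult_le_mono1) simp
        then show ?thesis by simp
      next
        assume *: "size_upto n kap = size_upto n lam \<and> k < rows n kap"
        then have "n - rows n kap < n - rows n lam" using rows_le[of n kap] unfolding k_def by linarith
        then show ?thesis using * by simp
      qed
    qed
    have eq: "sym_schur n (add_strip nu A) = plactic n n (add_strip nu A)" if A: "A \<in> vstrips n nu k" "A \<noteq> {..<k}" for A
    proof (rule small)
      have A': "A \<subseteq> {..<n}" "card A = k" "shape n (add_strip nu A)" using A by (auto simp: vstrips_def)
      show "shape n (add_strip nu A)" by fact
      have "\<not> A \<subseteq> {..<k}"
        using A(2) A'(2) card_subset_eq[of "{..<k}" A] by auto
      then obtain i where i: "i \<in> A" "k \<le> i" by (meson lessThan_iff not_less subsetI)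
      then have "i < rows n (add_strip nu A)"
        using less_rows_iff[OF A'(3), of i] by simp
      then show "size_upto n (add_strip nu A) < size_upto n lam \<or>
          size_upto n (add_strip nu A) = size_upto n lam \<and> k < rows n (add_strip nu A)"
        using i size size_add_strip[OF A'(1), of nu] A'(2) by simp
    qed
    have "sym_schur n nu = plactic n n nu"
      by (rule small) (use nu size False in auto)
    then have "(\<Sum>A\<in>vstrips n nu k. (-1) ^ inv_form n nu (ind A) * sym_schur n (add_strip nu A)) =
      (\<Sum>A\<in>vstrips n nu k. (-1) ^ inv_form n nu (ind A) * plactic n n (add_strip nu A))"
      by (simp only: sym_schur_esym_rev_shape[OF nu, symmetric] plactic_esym_rev[OF nu le_refl, symmetric])
    moreover have "(\<Sum>A\<in>vstrips n nu k - {{..<k}}. (-1) ^ inv_form n nu (ind A) * sym_schur n (add_strip nu A)) =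
      (\<Sum>A\<in>vstrips n nu k - {{..<k}}. (-1) ^ inv_form n nu (ind A) * plactic n n (add_strip nu A))"
      by (rule sum.cong) (simp_all add: eq)
    ultimately have "(-1) ^ inv_form n nu (ind {..<k}) * sym_schur n (add_strip nu {..<k}) =
      (-1) ^ inv_form n nu (ind {..<k}) * plactic n n (add_strip nu {..<k})"
      by (simp only: sum.remove[OF finite_vstrips A0] add_right_cancel)
    then have "sym_schur n (add_strip nu {..<k}) = plactic n n (add_strip nu {..<k})"
      by (rule sign_mult_cancel)
    then show ?thesis by (simp only: lam[symmetric])
  qed
qed

section \<open>Products of complete functions and weighted Kostka numbers\<close>

text \<open>The generating function by inversions of the tableaux of shape \<open>lam\<close> whose content is the reversed list
(\<open>sum_tableaux_inversions\<close>). The weight \<open>e\<close> is -1 for the odd Kostka numbers and 1 for plain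
counting.\<close>

primrec wkostka :: "int \<Rightarrow> nat \<Rightarrow> nat list \<Rightarrow> (nat \<Rightarrow> nat) \<Rightarrow> int" where
  "wkostka e L [] lam = of_bool (lam = (\<lambda>_. 0))"
| "wkostka e L (m # ms) lam = (\<Sum>nu | hstrip nu lam \<and> size_upto L nu + m = size_upto L lam.
    e ^ skew_sign L lam nu * wkostka e L ms nu)"

definition shapes :: "nat \<Rightarrow> nat \<Rightarrow> (nat \<Rightarrow> nat) set"
  where "shapes L k = {lam. shape L lam \<and> size_upto L lam = k}"

lemma finite_shapes: "finite (shapes L k)"
proof (rule finite_subset[OF _ finite_bounded_fun])
  show "shapes L k \<subseteq> {f. (\<forall>i. f i \<le> k) \<and> (\<forall>i\<ge>L. f i = 0)}"
  proof (clarsimp simp: shapes_def shape_def)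
    fix lam :: "nat \<Rightarrow> nat" and i assume "\<forall>i\<ge>L. lam i = 0"
    then show "lam i \<le> size_upto L lam"
      using member_le_sum[of i "{..<L}" lam] by (cases "i < L") auto
  qed
qed

text \<open>Iterating the Pieri rule reproduces the recursion of the weighted Kostka numbers, because \<open>pieri_sign\<close>
and \<open>skew_sign\<close> differ only by the increment of the form against the constant 1.\<close>

lemma hsym_product:
  assumes "n \<le> L"
  shows "prod_list (map (hsym n) mu) = (\<Sum>lam\<in>shapes L (sum_list mu).
    of_int (wkostka (-1) L (rev mu) lam) * ((-1) ^ inv_form L lam (\<lambda>_. 1) * tab_sum L n lam))"
proof (induction mu rule: rev_induct)
  case Nil
  have "shapes L 0 = {\<lambda>_. 0}"
  proof
    show "shapes L 0 \<subseteq> {\<lambda>_. 0}"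
    proof
      fix lam assume "lam \<in> shapes L 0"
      then have "lam i = 0" for i
        by (cases "i < L") (auto simp: shapes_def shape_def)
      then show "lam \<in> {\<lambda>_. 0}" by (simp add: fun_eq_iff)
    qed
  qed (simp add: shapes_def shape_def)
  then show ?case by (simp add: tab_sum_zero)
next
  case (snoc m mu)
  let ?k = "sum_list mu"
  let ?c = "\<lambda>lam. wkostka (-1) L (rev mu) lam" and ?d = "\<lambda>lam. inv_form L lam (\<lambda>_. 1)"
  define f where "f = (\<lambda>(lam, kap). of_int (?c lam) * ((-1) ^ (?d lam + pieri_sign L lam kap) * tab_sum L n kap))"
  have pairs: "lam \<in> shapes L ?k \<and> kap \<in> hstrips_on L lam m \<longleftrightarrow>
    kap \<in> shapes L (?k + m) \<and> hstrip lam kap \<and> size_upto L lam + m = size_upto L kap" for lam kap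
    using hstrip_shape_lower[of lam kap L] hstrips_on_shape[of kap L lam m]
    by (auto simp: shapes_def hstrips_on_def) (auto simp: shape_def)
  let ?R = "\<lambda>lam kap. hstrip lam kap \<and> size_upto L lam + m = size_upto L kap"
  have strip_set: "hstrips_on L lam m = {kap. kap \<in> shapes L (?k + m) \<and> ?R lam kap}"
    if "lam \<in> shapes L ?k" for lam
    using pairs[of lam] that by blast
  have lower_set: "{lam. lam \<in> shapes L ?k \<and> ?R lam kap} = {lam. ?R lam kap}"
    if "kap \<in> shapes L (?k + m)" for kap
    using pairs[of _ kap] that by blast
  have "prod_list (map (hsym n) (mu @ [m])) =
      (\<Sum>lam\<in>shapes L ?k. of_int (?c lam) * ((-1) ^ ?d lam * (tab_sum L n lam * hsym n m)))"
    by (simp add: snoc sum_distrib_right mult.assoc)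
  also have "\<dots> = (\<Sum>lam\<in>shapes L ?k. \<Sum>kap\<in>hstrips_on L lam m. f (lam, kap))"
  proof (rule sum.cong[OF refl])
    fix lam assume "lam \<in> shapes L ?k"
    then show "of_int (?c lam) * ((-1) ^ ?d lam * (tab_sum L n lam * hsym n m)) =
        (\<Sum>kap\<in>hstrips_on L lam m. f (lam, kap))"
      using assms by (subst tab_sum_hsym) (simp_all add: shapes_def f_def sum_distrib_left power_add mult.assoc)
  qed
  also have "\<dots> = (\<Sum>lam\<in>shapes L ?k. \<Sum>kap | kap \<in> shapes L (?k + m) \<and> ?R lam kap. f (lam, kap))"
    by (intro sum.cong refl) (simp add: strip_set)
  also have "\<dots> = (\<Sum>kap\<in>shapes L (?k + m). \<Sum>lam | lam \<in> shapes L ?k \<and> ?R lam kap. f (lam, kap))"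
    by (rule sum.swap_restrict) (rule finite_shapes)+
  also have "\<dots> = (\<Sum>kap\<in>shapes L (?k + m). \<Sum>lam | ?R lam kap. f (lam, kap))"
    by (intro sum.cong refl) (simp add: lower_set)
  also have "\<dots> = (\<Sum>kap\<in>shapes L (?k + m). of_int (wkostka (-1) L (rev (mu @ [m])) kap) *
      ((-1) ^ ?d kap * tab_sum L n kap))"
  proof (rule sum.cong[OF refl])
    fix kap
    have *: "f (lam, kap) = of_int ((-1) ^ skew_sign L kap lam * ?c lam) * ((-1) ^ ?d kap * tab_sum L n kap)"
      if "hstrip lam kap" for lam
    proof -
      have "pieri_sign L lam kap = skew_sign L kap lam + inv_form L (\<lambda>i. kap i - lam i) (\<lambda>_. 1)"
        by (rule inv_form_add_right)
      moreover have "?d kap = ?d (\<lambda>i. lam i + (kap i - lam i))"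
        using hstrip_le[OF that] by (intro inv_form_cong) simp_all
      then have "?d kap = ?d lam + inv_form L (\<lambda>i. kap i - lam i) (\<lambda>_. 1)"
        by (simp only: inv_form_add_left)
      ultimately have "?d lam + pieri_sign L lam kap = skew_sign L kap lam + ?d kap" by simp
      then have "f (lam, kap) = of_int (?c lam) * ((-1) ^ (skew_sign L kap lam + ?d kap) * tab_sum L n kap)"
        by (simp only: f_def prod.case)
      then show ?thesis
        by (simp only: power_add of_int_mult of_int_power of_int_minus of_int_1
            sign_commute[of "of_int (?c lam)"] mult.assoc sign_left_commute[of "of_int (?c lam)"])
    qed
    show "(\<Sum>lam | hstrip lam kap \<and> size_upto L lam + m = size_upto L kap. f (lam, kap)) =
      of_int (wkostka (-1) L (rev (mu @ [m])) kap) * ((-1) ^ ?d kap * tab_sum L n kap)"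
      by (simp add: * sum_distrib_right del: of_int_mult of_int_power)
  qed
  finally show ?case by simp
qed

lemma wkostka_eq_0: "0 < lam (length ms) \<Longrightarrow> wkostka e L ms lam = 0"
proof (induction ms arbitrary: lam)
  case (Cons m ms)
  have "wkostka e L ms nu = 0" if "hstrip nu lam" for nu
    using Cons that by (intro Cons.IH) (auto simp: hstrip_def intro: less_le_trans)
  then show ?case by simp
qed auto

lemma wkostka_nonzero_cases:
  assumes "wkostka e L (m # ms) lam \<noteq> 0"
  obtains nu where "hstrip nu lam" and "size_upto L nu + m = size_upto L lam" and "wkostka e L ms nu \<noteq> 0"
proof -
  have "\<exists>nu. hstrip nu lam \<and> size_upto L nu + m = size_upto L lam \<and> wkostka e L ms nu \<noteq> 0"
  proof (rule ccontr)
    assume "\<not> ?thesis"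
    then have "wkostka e L (m # ms) lam = 0" unfolding wkostka.simps by (intro sum.neutral) auto
    with assms show False ..
  qed
  with that show thesis by blast
qed

lemma wkostka_size: "wkostka e L ms lam \<noteq> 0 \<Longrightarrow> size_upto L lam = sum_list ms"
proof (induction ms arbitrary: lam)
  case (Cons m ms)
  obtain nu where "size_upto L nu + m = size_upto L lam" "wkostka e L ms nu \<noteq> 0"
    using Cons.prems by (rule wkostka_nonzero_cases)
  then show ?case using Cons.IH[of nu] by simp
qed (auto split: if_splits)

lemma size_upto_support:
  assumes "\<forall>i\<ge>L. lam i = 0" and "\<forall>i\<ge>r. lam i = 0"
  shows "size_upto r lam = size_upto L (lam :: nat \<Rightarrow> nat)"
proof -
  have "size_upto r lam = (\<Sum>i<max r L. lam i)" "size_upto L lam = (\<Sum>i<max r L. lam i)"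
    by (rule sum.mono_neutral_left; use assms in auto)+
  then show ?thesis by simp
qed

text \<open>The first \<open>i\<close> letters only occur in the first \<open>i\<close> rows.\<close>

lemma wkostka_dominance:
  assumes "shape L lam" and "wkostka e L (rev mu) lam \<noteq> 0"
  shows "sum_list (take i mu) \<le> size_upto i lam"
  using assms
proof (induction mu arbitrary: lam i rule: rev_induct)
  case (snoc m mu)
  show ?case
  proof (cases "i \<le> length mu")
    case True
    obtain nu where nu: "hstrip nu lam" "wkostka e L (rev mu) nu \<noteq> 0"
      using snoc.prems(2) unfolding rev.simps rev_append append.simps by (rule wkostka_nonzero_cases)
    then have "sum_list (take i mu) \<le> size_upto i nu"
      using snoc.prems hstrip_shape_lower by (intro snoc.IH) auto
    also have "\<dots> \<le> size_upto i lam" by (rule hstrip_size[OF nu(1)])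
    finally show ?thesis using True by simp
  next
    case False
    have "lam (Suc (length mu)) = 0"
      using wkostka_eq_0[of lam "rev (mu @ [m])" e L] snoc.prems(2) by fastforce
    then have "\<forall>j\<ge>i. lam j = 0"
      using False shape_antimono[OF snoc.prems(1), of "Suc (length mu)"] by fastforce
    then have "size_upto i lam = size_upto L lam"
      using snoc.prems(1) by (intro size_upto_support) (auto simp: shape_def)
    also have "\<dots> = sum_list (mu @ [m])"
      using wkostka_size[OF snoc.prems(2)] by (simp add: sum_list_rev)
    finally show ?thesis using False by simp
  qed
qed simp

text \<open>When content and shape agree, every strip in the recursion must be a full row, so a single term
survives.\<close>

lemma wkostka_self:
  assumes "shape L lam" and "\<forall>i\<ge>r. lam i = 0"
  shows "wkostka e L (rev (map lam [0..<r])) lam = e ^ inv_form L lam lam"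
  using assms
proof (induction r arbitrary: lam)
  case 0
  then have "lam = (\<lambda>_. 0)" by auto
  then show ?case by simp
next
  case (Suc r)
  let ?nu = "lam(r := 0)"
  have shape: "shape L ?nu" "hstrip ?nu lam"
    using Suc.prems by (auto simp: shape_def hstrip_def)
  have size: "size_upto L ?nu + lam r = size_upto L lam"
  proof (cases "r < L")
    case True
    have "size_upto L lam = (\<Sum>i<L. ?nu i + (if i = r then lam r else 0))"
      by (rule sum.cong) auto
    then show ?thesis
      using True by (simp only: sum.distrib) simp
  next
    case False
    then have "lam r = 0" using Suc.prems by (simp add: shape_def)
    then show ?thesis by (simp add: fun_upd_idem)
  qed
  have *: "wkostka e L (rev (map lam [0..<r])) nu = 0"
    if nu: "hstrip nu lam" "size_upto L nu + lam r = size_upto L lam" "nu \<noteq> ?nu" for nu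
  proof (cases "nu r = 0")
    case True
    have le: "nu i \<le> ?nu i" for i
      using nu(1) True by (auto simp: hstrip_def)
    have "nu = ?nu"
    proof
      fix i
      show "nu i = ?nu i"
      proof (cases "i < L")
        case True
        have eq: "size_upto L nu = size_upto L ?nu" using nu(2) size by linarith
        show ?thesis
          by (rule sum_mono_inv[OF eq]) (use True le in \<open>simp_all only: lessThan_iff finite_lessThan\<close>)
      next
        case False
        then have "?nu i = 0" using shape(1) by (simp add: shape_def)
        then show ?thesis using le[of i] by simp
      qed
    qed
    with nu(3) show ?thesis by blast
  next
    case False
    then show ?thesis by (simp add: wkostka_eq_0)
  qed
  have "map lam [0..<r] = map ?nu [0..<r]" by simp
  moreover have "\<forall>i\<ge>r. ?nu i = 0"
    using Suc.prems(2) by (auto simp: le_Suc_eq Suc_le_eq)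
  ultimately have IH: "wkostka e L (rev (map lam [0..<r])) ?nu = e ^ inv_form L ?nu ?nu"
    using Suc.IH[OF shape(1)] by (simp only:)
  have "inv_form L lam lam = inv_form L (\<lambda>i. (lam i - ?nu i) + ?nu i) lam"
    by (rule inv_form_cong) auto
  also have "\<dots> = inv_form L (\<lambda>i. lam i - ?nu i) lam + inv_form L ?nu lam"
    by (rule inv_form_add_left)
  also have "inv_form L (\<lambda>i. lam i - ?nu i) lam = skew_sign L lam ?nu"
    unfolding inv_form_def by (intro sum.cong refl) auto
  also have "inv_form L ?nu lam = inv_form L ?nu ?nu"
    unfolding inv_form_def
  proof (rule sum.cong[OF refl])
    fix i
    show "?nu i * (\<Sum>j<i. lam j) = ?nu i * (\<Sum>j<i. ?nu j)"
    proof (cases "r < i")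
      case True
      then show ?thesis using Suc.prems(2) by simp
    next
      case False
      then show ?thesis by (intro arg_cong2[of _ _ _ _ "(*)"] sum.cong) auto
    qed
  qed
  finally have sign: "inv_form L lam lam = skew_sign L lam ?nu + inv_form L ?nu ?nu" .
  have fin: "finite {nu. hstrip nu lam \<and> size_upto L nu + lam r = size_upto L lam}"
    by (rule finite_subset[OF _ finite_hstrip[OF Suc.prems(1)]]) auto
  have "wkostka e L (rev (map lam [0..<Suc r])) lam =
      (\<Sum>nu | hstrip nu lam \<and> size_upto L nu + lam r = size_upto L lam.
        e ^ skew_sign L lam nu * wkostka e L (rev (map lam [0..<r])) nu)"
    by simp
  also have "\<dots> = (\<Sum>nu\<in>{?nu}. e ^ skew_sign L lam nu * wkostka e L (rev (map lam [0..<r])) nu)"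
    by (rule sum.mono_neutral_right[OF fin]) (use * shape size in auto)
  also have "\<dots> = e ^ inv_form L lam lam"
    by (simp only: sum.insert sum.empty finite.emptyI empty_iff not_False_eq_True IH sign power_add add_0_right)
  finally show ?case .
qed

section \<open>Removing the largest letter from a tableau\<close>

text \<open>The shape is a list of fixed length \<open>L\<close> that may contain zeros. Hence removing boxes never changes the
number of rows.\<close>

definition tableaux :: "nat \<Rightarrow> nat \<Rightarrow> (nat \<Rightarrow> nat) \<Rightarrow> nat list list set"
  where "tableaux L n lam = {T \<in> SSYT (map lam [0..<L]). set (row_word T) \<subseteq> {1..n}}"

lemma set_row_word: "set (row_word T) = (\<Union>r\<in>set T. set r)"
  by (simp add: row_word_def)

lemma tableaux_iff:
  "T \<in> tableaux L n lam \<longleftrightarrow> length T = L \<and>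
    (\<forall>r<L. length (T ! r) = lam r \<and> sorted (T ! r) \<and> set (T ! r) \<subseteq> {1..n}) \<and>
    (\<forall>r r' c. r < r' \<and> r' < L \<and> c < lam r \<and> c < lam r' \<longrightarrow> T ! r ! c < T ! r' ! c)"
proof (cases "map length T = map lam [0..<L]")
  case True
  then have L: "length T = L"
    by (metis length_map length_upt minus_nat.diff_0)
  then have len: "\<forall>r<L. length (T ! r) = lam r"
    using True by (metis length_map nth_map nth_upt add_0 diff_zero length_upt)
  have all: "(\<forall>r\<in>set T. P r) \<longleftrightarrow> (\<forall>r<L. P (T ! r))" for P
    using L by (metis in_set_conv_nth)
  have col: "(\<forall>r r' c. (r, c) \<in> boxes (map lam [0..<L]) \<and> (r', c) \<in> boxes (map lam [0..<L]) \<and> r < r' \<longrightarrow> T ! r ! c < T ! r' ! c)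
    \<longleftrightarrow> (\<forall>r r' c. r < r' \<and> r' < L \<and> c < lam r \<and> c < lam r' \<longrightarrow> T ! r ! c < T ! r' ! c)"
    by (auto simp: boxes_def)
  have ge1: "(\<forall>r\<in>set T. \<forall>a\<in>set r. 1 \<le> a) \<and> set (row_word T) \<subseteq> {1..n} \<longleftrightarrow> (\<forall>r\<in>set T. set r \<subseteq> {1..n})"
    unfolding set_row_word subset_iff atLeastAtMost_iff by blast
  show ?thesis
    using True L len ge1 unfolding tableaux_def SSYT_def mem_Collect_eq col all by blast
next
  case False
  have "\<not> (length T = L \<and> (\<forall>r<L. length (T ! r) = lam r))"
    using False by (auto intro!: nth_equalityI)
  with False show ?thesis by (auto simp: tableaux_def SSYT_def)
qed

lemma finite_tableaux: "finite (tableaux L n lam)"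
proof -
  let ?R = "\<Union>k\<in>lam ` {..<L}. {r. set r \<subseteq> {1..n} \<and> length r = k}"
  have "finite ?R" by (intro finite_UN_I finite_lists_length_eq) auto
  then have "finite {T. set T \<subseteq> ?R \<and> length T = L}" by (rule finite_lists_length_eq)
  then show ?thesis
    by (rule rev_finite_subset) (auto simp: tableaux_iff in_set_conv_nth subset_iff)
qed

lemma tableaux_0: "tableaux L 0 lam = (if \<forall>r<L. lam r = 0 then {replicate L []} else {})"
proof (rule Set.set_eqI)
  fix T :: "nat list list"
  have "(\<forall>r<L. length (T ! r) = lam r \<and> sorted (T ! r) \<and> set (T ! r) \<subseteq> {1..0}) \<longleftrightarrow>
    (\<forall>r<L. lam r = 0 \<and> T ! r = [])"
    by auto
  moreover have "T = replicate L [] \<longleftrightarrow> length T = L \<and> (\<forall>r<L. T ! r = [])"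
    by (auto intro: nth_equalityI)
  ultimately show "T \<in> tableaux L 0 lam \<longleftrightarrow> T \<in> (if \<forall>r<L. lam r = 0 then {replicate L []} else {})"
    unfolding tableaux_iff by auto
qed

definition row_join :: "nat \<Rightarrow> nat \<Rightarrow> (nat \<Rightarrow> nat) \<Rightarrow> nat list list \<Rightarrow> nat list list"
  where "row_join L N lam T = map (\<lambda>r. T ! r @ replicate (lam r - length (T ! r)) N) [0..<L]"

lemma sorted_split_max:
  assumes "sorted xs" and "\<forall>a\<in>set xs. a \<le> Suc n"
  shows "xs = filter (\<lambda>a. a \<le> n) xs @ replicate (length xs - length (filter (\<lambda>a. a \<le> n) xs)) (Suc n)"
  using assms
proof (induction xs)
  case (Cons x xs)
  show ?case
  proof (cases "x \<le> n")
    case True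
    then show ?thesis using Cons by auto
  next
    case False
    then have "x = Suc n" "\<forall>a\<in>set xs. a = Suc n" using Cons.prems by fastforce+
    moreover from this have "filter (\<lambda>a. a \<le> n) xs = []" by (auto simp: filter_empty_conv)
    moreover have "xs = replicate (length xs) (Suc n)"
      using \<open>\<forall>a\<in>set xs. a = Suc n\<close> by (simp add: replicate_eqI)
    ultimately show ?thesis by simp
  qed
qed simp

lemma row_join_tableaux:
  assumes lam: "shape L lam" and nu: "hstrip nu lam" and T: "T \<in> tableaux L n nu"
  shows "row_join L (Suc n) lam T \<in> tableaux L (Suc n) lam"
proof -
  note t = T[unfolded tableaux_iff]
  have le: "nu r \<le> lam r" "lam (Suc r) \<le> nu r" for r using nu by (auto simp: hstrip_def)
  have row: "row_join L (Suc n) lam T ! r = T ! r @ replicate (lam r - nu r) (Suc n)" if "r < L" for r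
    using that t by (simp add: row_join_def)
  have "row_join L (Suc n) lam T ! r ! c < row_join L (Suc n) lam T ! r' ! c"
    if "r < r'" "r' < L" "c < lam r'" for r r' c
  proof -
    have "lam r' \<le> lam (Suc r)" by (rule shape_antimono[OF lam]) (use that in simp)
    then have c: "c < nu r" using that le(2)[of r] by simp
    have r: "length (T ! r) = nu r" "length (T ! r') = nu r'" using t that by auto
    have lhs: "row_join L (Suc n) lam T ! r ! c = T ! r ! c"
      using row[of r] that c r by (simp add: nth_append)
    show ?thesis
    proof (cases "c < nu r'")
      case True
      then show ?thesis using row[of r'] that c r lhs t by (simp add: nth_append)
    next
      case False
      have "row_join L (Suc n) lam T ! r' ! c = Suc n"
        using row[of r'] that False r by (simp add: nth_append)
      moreover have "T ! r ! c \<in> set (T ! r)" using c r by simp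
      then have "T ! r ! c \<in> {1..n}" using t that by (meson less_trans subsetD)
      then have "T ! r ! c \<le> n" by simp
      ultimately show ?thesis using lhs by simp
    qed
  qed
  moreover have "length (row_join L (Suc n) lam T ! r) = lam r \<and> sorted (row_join L (Suc n) lam T ! r) \<and>
      set (row_join L (Suc n) lam T ! r) \<subseteq> {1..Suc n}" if "r < L" for r
  proof -
    have r: "length (T ! r) = nu r" "sorted (T ! r)" "set (T ! r) \<subseteq> {1..n}" using t that by auto
    then show ?thesis
      using row[OF that] le(1)[of r] by (auto simp: sorted_append)
  qed
  ultimately show ?thesis
    by (simp add: tableaux_iff row_join_def)
qed

definition row_strip :: "nat \<Rightarrow> nat list list \<Rightarrow> nat list list"
  where "row_strip n T = map (filter (\<lambda>a. a \<le> n)) T"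

definition strip_shape :: "nat \<Rightarrow> nat \<Rightarrow> nat list list \<Rightarrow> nat \<Rightarrow> nat"
  where "strip_shape L n T r = (if r < L then length (filter (\<lambda>a. a \<le> n) (T ! r)) else 0)"

lemma row_strip_tableaux:
  assumes lam: "shape L lam" and T: "T \<in> tableaux L (Suc n) lam"
  defines "nu \<equiv> strip_shape L n T"
  shows "hstrip nu lam" and "row_strip n T \<in> tableaux L n nu"
    and "row_join L (Suc n) lam (row_strip n T) = T"
proof -
  note t = T[unfolded tableaux_iff]
  have split: "T ! r = filter (\<lambda>a. a \<le> n) (T ! r) @ replicate (lam r - nu r) (Suc n)" if "r < L" for r
  proof -
    have "sorted (T ! r)" "set (T ! r) \<subseteq> {1..Suc n}" "length (T ! r) = lam r"
      using t that by blast+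
    moreover from this have "\<forall>a\<in>set (T ! r). a \<le> Suc n" by auto
    moreover have "nu r = length (filter (\<lambda>a. a \<le> n) (T ! r))"
      using that by (simp add: nu_def strip_shape_def)
    ultimately show ?thesis using sorted_split_max[of "T ! r" n] by simp
  qed
  have le: "nu r \<le> lam r" for r
    using t by (auto simp: nu_def strip_shape_def) (metis length_filter_le)
  have zero: "lam r = 0" "nu r = 0" if "L \<le> r" for r
    using that lam by (auto simp: shape_def nu_def strip_shape_def)
  have small: "c < nu r \<longleftrightarrow> T ! r ! c \<le> n" if "r < L" "c < lam r" for r c
  proof -
    have len: "length (filter (\<lambda>a. a \<le> n) (T ! r)) = nu r" using that by (simp add: nu_def strip_shape_def)
    show ?thesis
    proof (cases "c < nu r")
      case True
      then have "T ! r ! c = filter (\<lambda>a. a \<le> n) (T ! r) ! c"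
        using split[OF that(1)] len by (metis nth_append)
      also have "\<dots> \<in> set (filter (\<lambda>a. a \<le> n) (T ! r))" using True len by (intro nth_mem) simp
      finally show ?thesis using True by simp
    next
      case False
      then have "T ! r ! c = replicate (lam r - nu r) (Suc n) ! (c - nu r)"
        using split[OF that(1)] len by (metis nth_append)
      then show ?thesis using False that by simp
    qed
  qed
  have "lam (Suc r) \<le> nu r" for r
  proof (rule ccontr)
    assume "\<not> lam (Suc r) \<le> nu r"
    then have c: "nu r < lam (Suc r)" by simp
    then have r: "Suc r < L" using zero[of "Suc r"] by (cases "Suc r < L") auto
    have c': "nu r < lam r" using c lam by (auto simp: shape_def intro: less_le_trans)
    have "T ! r ! nu r < T ! Suc r ! nu r" using t r c c' by simp
    moreover have "T ! Suc r ! nu r \<in> set (T ! Suc r)" using t r c by simp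
    then have "T ! Suc r ! nu r \<in> {1..Suc n}" using t r by (meson subsetD)
    then have "T ! Suc r ! nu r \<le> Suc n" by simp
    ultimately have "T ! r ! nu r \<le> n" by simp
    then show False using small[of r "nu r"] r c' by simp
  qed
  then show hs: "hstrip nu lam" using le by (simp add: hstrip_def)
  have rows: "row_strip n T ! r = filter (\<lambda>a. a \<le> n) (T ! r)" if "r < L" for r
    using that t by (simp add: row_strip_def)
  have entry: "row_strip n T ! r ! c = T ! r ! c" if "r < L" "c < nu r" for r c
  proof -
    have "length (filter (\<lambda>a. a \<le> n) (T ! r)) = nu r" using that by (simp add: nu_def strip_shape_def)
    then show ?thesis using split[OF that(1)] rows[OF that(1)] that(2) by (metis nth_append)
  qed
  have "row_strip n T ! r ! c < row_strip n T ! r' ! c" if "r < r'" "r' < L" "c < nu r" "c < nu r'" for r r' c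
    using that le[of r] le[of r'] t by (simp add: entry less_le_trans)
  moreover have "length (row_strip n T ! r) = nu r \<and> sorted (row_strip n T ! r) \<and>
      set (row_strip n T ! r) \<subseteq> {1..n}" if "r < L" for r
  proof -
    have "sorted (T ! r)" "set (T ! r) \<subseteq> {1..Suc n}" using t that by blast+
    then show ?thesis
      using that by (auto simp: rows nu_def strip_shape_def sorted_wrt_filter)
  qed
  ultimately show "row_strip n T \<in> tableaux L n nu"
    using t by (simp add: tableaux_iff) (simp add: row_strip_def)
  show "row_join L (Suc n) lam (row_strip n T) = T"
  proof (rule nth_equalityI)
    show "length (row_join L (Suc n) lam (row_strip n T)) = length T" using t by (simp add: row_join_def)
    fix r assume "r < length (row_join L (Suc n) lam (row_strip n T))"
    then have r: "r < L" by (simp add: row_join_def)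
    then have "row_join L (Suc n) lam (row_strip n T) ! r =
        filter (\<lambda>a. a \<le> n) (T ! r) @ replicate (lam r - nu r) (Suc n)"
      by (simp add: row_join_def rows nu_def strip_shape_def)
    then show "row_join L (Suc n) lam (row_strip n T) ! r = T ! r"
      using split[OF r] by simp
  qed
qed

lemma row_strip_join:
  assumes "hstrip nu lam" and "shape L lam" and T: "T \<in> tableaux L n nu"
  shows "row_strip n (row_join L (Suc n) lam T) = T"
    and "strip_shape L n (row_join L (Suc n) lam T) = nu"
proof -
  note t = T[unfolded tableaux_iff]
  have f: "filter (\<lambda>a. a \<le> n) (row_join L (Suc n) lam T ! r) = T ! r" if "r < L" for r
  proof -
    have "filter (\<lambda>a. a \<le> n) (T ! r) = T ! r"
      using t that by (intro filter_True ballI) (meson atLeastAtMost_iff subsetD)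
    then show ?thesis using that by (simp add: row_join_def)
  qed
  show "row_strip n (row_join L (Suc n) lam T) = T"
    by (rule nth_equalityI) (use t f in \<open>simp_all add: row_strip_def row_join_def\<close>)
  have "nu r = 0" if "L \<le> r" for r
    using assms(1,2) that by (metis hstrip_le le_zero_eq shape_def)
  then show "strip_shape L n (row_join L (Suc n) lam T) = nu"
    using t f by (auto simp: strip_shape_def fun_eq_iff)
qed

text \<open>The letters \<open>n + 1\<close> of a tableau form a horizontal strip at the ends of its rows, and they may be put back
onto any tableau of the smaller shape.\<close>

lemma sum_tableaux_Suc:
  fixes F :: "nat list list \<Rightarrow> 'a::comm_monoid_add"
  assumes "shape L lam"
  shows "sum F (tableaux L (Suc n) lam) =
    (\<Sum>nu | hstrip nu lam. \<Sum>T\<in>tableaux L n nu. F (row_join L (Suc n) lam T))"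
proof -
  have "(\<Sum>nu | hstrip nu lam. \<Sum>T\<in>tableaux L n nu. F (row_join L (Suc n) lam T)) =
    (\<Sum>(nu, T)\<in>(SIGMA nu : {nu. hstrip nu lam}. tableaux L n nu). F (row_join L (Suc n) lam T))"
    by (rule sum.Sigma) (auto simp: finite_tableaux finite_hstrip[OF assms])
  also have "\<dots> = sum F (tableaux L (Suc n) lam)"
    by (rule sum.reindex_bij_witness[where
          i = "\<lambda>T. (strip_shape L n T, row_strip n T)" and j = "\<lambda>(nu, T). row_join L (Suc n) lam T"])
      (auto simp: row_strip_join[OF _ assms] row_strip_tableaux(1,3)[OF assms] row_join_tableaux[OF assms]
        intro: row_strip_tableaux(2)[OF assms])
  finally show ?thesis by simp
qed

section \<open>Signs and inversions of row words\<close>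

definition xt_word :: "nat list \<Rightarrow> skew_poly"
  where "xt_word w = prod_list (map xt w)"

lemma xt_word_append: "xt_word (u @ v) = xt_word u * xt_word v"
  by (simp add: xt_word_def)

lemma xt_word_replicate: "xt_word (replicate d a) = xt a ^ d"
  by (induction d) (simp_all add: xt_word_def)

lemma xt_power_word: "N \<notin> set w \<Longrightarrow> xt N ^ d * xt_word w = (-1) ^ (d * length w) * xt_word w * xt N ^ d"
proof (induction w)
  case (Cons a w)
  have anti: "xt N ^ d * xt a ^ 1 = (-1) ^ (d * 1) * xt a ^ 1 * xt N ^ d"
    by (rule power_anticommute, rule xt_anticommute) (use Cons.prems in auto)
  have "xt N ^ d * xt_word (a # w) = (xt N ^ d * xt a ^ 1) * xt_word w"
    by (simp add: xt_word_def mult.assoc)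
  also have "\<dots> = (-1) ^ d * (xt a * (xt N ^ d * xt_word w))"
    by (simp only: anti mult.assoc) simp
  also have "\<dots> = (-1) ^ d * (xt a * ((-1) ^ (d * length w) * xt_word w * xt N ^ d))"
    using Cons by simp
  also have "\<dots> = (-1) ^ (d + d * length w) * (xt a * xt_word w) * xt N ^ d"
    by (simp only: power_add mult.assoc sign_left_commute[of "xt a"])
  finally show ?case by (simp add: xt_word_def)
qed (simp add: xt_word_def)

lemma row_word_snoc: "row_word (T @ [r]) = r @ row_word T"
  by (simp add: row_word_def)

lemma length_row_word: "length (row_word (map f [0..<L])) = (\<Sum>r<L. length (f r))"
  by (induction L) (simp_all add: row_word_snoc, simp add: row_word_def)

text \<open>A letter \<open>N\<close> at the end of a row is moved past the letters of all rows above that are not \<open>N\<close>; with the other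
\<open>N\<close>s it commutes.\<close>

lemma xt_row_word_join:
  assumes "\<And>r. r < L \<Longrightarrow> N \<notin> set (f r)"
  shows "xt_word (row_word (map (\<lambda>r. f r @ replicate (d r) N) [0..<L])) =
    (-1) ^ inv_form L d (\<lambda>r. length (f r)) * xt_word (row_word (map f [0..<L])) * xt N ^ (\<Sum>r<L. d r)"
  using assms
proof (induction L)
  case 0
  show ?case by (simp add: row_word_def xt_word_def inv_form_def)
next
  case (Suc L)
  let ?W = "row_word (map f [0..<L])" and ?I = "inv_form L d (\<lambda>r. length (f r))"
  let ?n = "\<Sum>j<L. length (f j)"
  have N: "N \<notin> set ?W" using Suc.prems by (auto simp: set_row_word)
  have "xt_word (row_word (map (\<lambda>r. f r @ replicate (d r) N) [0..<Suc L])) =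
    xt_word (f L) * (xt N ^ d L * ((-1) ^ ?I * xt_word ?W * xt N ^ (\<Sum>r<L. d r)))"
    using Suc by (simp add: row_word_snoc xt_word_append xt_word_replicate mult.assoc)
  also have "\<dots> = (-1) ^ ?I * (xt_word (f L) * ((xt N ^ d L * xt_word ?W) * xt N ^ (\<Sum>r<L. d r)))"
    by (simp only: mult.assoc sign_left_commute[of "xt N ^ d L"] sign_left_commute[of "xt_word (f L)"])
  also have "\<dots> = (-1) ^ (?I + d L * ?n) * (xt_word (f L) * xt_word ?W) * (xt N ^ d L * xt N ^ (\<Sum>r<L. d r))"
    by (simp only: xt_power_word[OF N] length_row_word mult.assoc power_add sign_left_commute[of "xt_word (f L)"])
  also have "xt N ^ d L * xt N ^ (\<Sum>r<L. d r) = xt N ^ (\<Sum>r<Suc L. d r)"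
    by (simp add: add.commute flip: power_add)
  also have "?I + d L * ?n = inv_form (Suc L) d (\<lambda>r. length (f r))"
    by (simp add: inv_form_def)
  also have "xt_word (f L) * xt_word ?W = xt_word (row_word (map f [0..<Suc L]))"
    by (simp add: row_word_snoc xt_word_append)
  finally show ?case .
qed

fun inversions :: "nat list \<Rightarrow> nat" where
  "inversions [] = 0"
| "inversions (a # w) = length (filter (\<lambda>b. b < a) w) + inversions w"

lemma card_inversions: "card {(p, q). p < q \<and> q < length w \<and> w ! q < w ! p} = inversions w"
proof (induction w)
  case Nil
  show ?case by simp
next
  case (Cons a w)
  let ?I = "{(p, q). p < q \<and> q < length w \<and> w ! q < w ! p}"
  let ?J = "{q. q < length w \<and> w ! q < a}"
  have "{(p, q). p < q \<and> q < length (a # w) \<and> (a # w) ! q < (a # w) ! p} =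
      (\<lambda>q. (0, Suc q)) ` ?J \<union> map_prod Suc Suc ` ?I" (is "?L = ?R")
  proof (rule Set.set_eqI)
    fix x :: "nat \<times> nat"
    obtain p q where x: "x = (p, q)" by (cases x)
    show "x \<in> ?L \<longleftrightarrow> x \<in> ?R"
      unfolding x by (cases p; cases q) (auto simp: image_iff)
  qed
  moreover have fin: "finite ?I"
    by (rule finite_subset[of _ "{..<length w} \<times> {..<length w}"]) auto
  then have "card ((\<lambda>q. (0, Suc q)) ` ?J \<union> map_prod Suc Suc ` ?I) =
      card ((\<lambda>q. (0 :: nat, Suc q)) ` ?J) + card (map_prod Suc Suc ` ?I)"
    by (intro card_Un_disjoint) auto
  moreover have "card ((\<lambda>q. (0 :: nat, Suc q)) ` ?J) = length (filter (\<lambda>b. b < a) w)"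
    by (subst card_image) (auto simp: inj_on_def length_filter_conv_card)
  moreover have "card (map_prod Suc Suc ` ?I) = inversions w"
    by (subst card_image) (auto simp: inj_on_def Cons)
  ultimately show ?case by simp
qed

lemma word_sign_inversions: "word_sign w = (-1) ^ inversions w"
  by (simp add: word_sign_def card_inversions)

lemma inversions_append:
  "inversions (u @ v) = inversions u + inversions v + (\<Sum>a\<leftarrow>u. length (filter (\<lambda>b. b < a) v))"
  by (induction u) simp_all

lemma inversions_replicate: "inversions (replicate d N) = 0"
  by (induction d) (simp_all add: filter_empty_conv)

lemma filter_row_word_join:
  assumes "a \<le> N"
  shows "filter (\<lambda>b. b < a) (row_word (map (\<lambda>r. f r @ replicate (d r) N) [0..<L])) =
    filter (\<lambda>b. b < a) (row_word (map f [0..<L]))"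
proof (induction L)
  case (Suc L)
  have "filter (\<lambda>b. b < a) (replicate (d L) N) = []"
    using assms by (auto simp: filter_empty_conv)
  then show ?case using Suc by (simp add: row_word_snoc)
qed (simp add: row_word_def)

text \<open>The same count as in \<open>xt_row_word_join\<close>: when all other letters are smaller than \<open>N\<close>, these moves are
exactly the inversions that involve \<open>N\<close>.\<close>

lemma inversions_row_word_join:
  assumes "\<And>r. r < L \<Longrightarrow> \<forall>a\<in>set (f r). a < N"
  shows "inversions (row_word (map (\<lambda>r. f r @ replicate (d r) N) [0..<L])) =
    inv_form L d (\<lambda>r. length (f r)) + inversions (row_word (map f [0..<L]))"
  using assms
proof (induction L)
  case 0
  show ?case by (simp add: row_word_def inv_form_def)
next
  case (Suc L)
  let ?W = "row_word (map f [0..<L])" and ?V = "row_word (map (\<lambda>r. f r @ replicate (d r) N) [0..<L])"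
  have cross: "(\<Sum>a\<leftarrow>f L. length (filter (\<lambda>b. b < a) (replicate (d L) N @ ?V))) =
      (\<Sum>a\<leftarrow>f L. length (filter (\<lambda>b. b < a) ?W))"
  proof (rule arg_cong[of _ _ sum_list], rule map_cong[OF refl])
    fix a assume "a \<in> set (f L)"
    then have "a < N" using Suc.prems[of L] by blast
    then have "filter (\<lambda>b. b < a) (replicate (d L) N) = []" by (auto simp: filter_empty_conv)
    moreover have "filter (\<lambda>b. b < a) ?V = filter (\<lambda>b. b < a) ?W"
      using \<open>a < N\<close> by (intro filter_row_word_join) simp
    ultimately show "length (filter (\<lambda>b. b < a) (replicate (d L) N @ ?V)) = length (filter (\<lambda>b. b < a) ?W)"
      by simp
  qed
  have "filter (\<lambda>b. b < N) ?W = ?W"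
  proof (rule filter_True)
    show "\<forall>a\<in>set ?W. a < N"
      using Suc.prems[OF less_SucI] by (simp add: set_row_word)
  qed
  then have len: "length (filter (\<lambda>b. b < N) ?V) = (\<Sum>j<L. length (f j))"
    by (simp add: filter_row_word_join[of N] length_row_word)
  have "inversions (row_word (map (\<lambda>r. f r @ replicate (d r) N) [0..<Suc L])) =
    inversions (f L @ (replicate (d L) N @ ?V))"
    by (simp add: row_word_snoc)
  also have "\<dots> = inversions (f L) + (d L * (\<Sum>j<L. length (f j)) + inversions ?V) +
      (\<Sum>a\<leftarrow>f L. length (filter (\<lambda>b. b < a) ?W))"
    by (simp only: inversions_append[of "f L"] cross inversions_append[of "replicate (d L) N"])
      (simp add: inversions_replicate len sum_list_replicate)
  also have "inversions ?V = inv_form L d (\<lambda>r. length (f r)) + inversions ?W"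
    by (rule Suc.IH[OF Suc.prems[OF less_SucI]])
  finally show ?case
    by (simp add: row_word_snoc inversions_append inv_form_def)
qed

lemma count_row_word_join:
  "count_list (row_word (map (\<lambda>r. f r @ replicate (d r) N) [0..<L])) a =
    count_list (row_word (map f [0..<L])) a + (if a = N then \<Sum>r<L. d r else 0)"
proof (induction L)
  case (Suc L)
  have "count_list (replicate k N) a = (if a = N then k else 0)" for k
    by (induction k) auto
  then show ?case using Suc by (simp add: row_word_snoc)
qed (simp add: row_word_def)

lemma row_join_facts:
  assumes "hstrip nu lam" and T: "T \<in> tableaux L n nu"
  shows "xt_word (row_word (row_join L (Suc n) lam T)) = (-1) ^ skew_sign L lam nu *
      xt_word (row_word T) * xt (Suc n) ^ (size_upto L lam - size_upto L nu)"
    and "inversions (row_word (row_join L (Suc n) lam T)) =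
      skew_sign L lam nu + inversions (row_word T)"
    and "count_list (row_word (row_join L (Suc n) lam T)) a =
      count_list (row_word T) a + (if a = Suc n then size_upto L lam - size_upto L nu else 0)"
proof -
  note t = T[unfolded tableaux_iff]
  let ?d = "\<lambda>r. lam r - length (T ! r)"
  have T_eq: "T = map ((!) T) [0..<L]"
    using t by (metis map_nth)
  have small: "\<forall>a\<in>set (T ! r). a < Suc n" if "r < L" for r
  proof -
    have "set (T ! r) \<subseteq> {1..n}" using t that by blast
    then show ?thesis by auto
  qed
  then have notin: "Suc n \<notin> set (T ! r)" if "r < L" for r
    using that by blast
  have I: "inv_form L ?d (\<lambda>r. length (T ! r)) = skew_sign L lam nu"
    by (rule inv_form_cong) (use t in auto)
  have D: "(\<Sum>r<L. ?d r) = size_upto L lam - size_upto L nu"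
  proof -
    have "(\<Sum>r<L. ?d r) = (\<Sum>r<L. lam r - nu r)"
      by (rule sum.cong) (use t in auto)
    then show ?thesis
      using hstrip_le[OF assms(1)] by (simp add: sum_subtractf_nat)
  qed
  show "xt_word (row_word (row_join L (Suc n) lam T)) = (-1) ^ skew_sign L lam nu *
      xt_word (row_word T) * xt (Suc n) ^ (size_upto L lam - size_upto L nu)"
    unfolding row_join_def
    by (subst xt_row_word_join[OF notin]) (simp_all only: I D T_eq[symmetric])
  show "inversions (row_word (row_join L (Suc n) lam T)) = skew_sign L lam nu + inversions (row_word T)"
    unfolding row_join_def
    by (subst inversions_row_word_join[OF small]) (simp_all only: I T_eq[symmetric])
  show "count_list (row_word (row_join L (Suc n) lam T)) a =
      count_list (row_word T) a + (if a = Suc n then size_upto L lam - size_upto L nu else 0)"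
    unfolding row_join_def by (simp only: count_row_word_join D T_eq[symmetric])
qed

lemma tableaux_0_shape:
  assumes "shape L lam"
  shows "tableaux L 0 lam = (if lam = (\<lambda>_. 0) then {replicate L []} else {})"
proof -
  have "(\<forall>r<L. lam r = 0) \<longleftrightarrow> lam = (\<lambda>_. 0)"
    using assms unfolding shape_def fun_eq_iff by (meson not_le)
  then show ?thesis by (simp add: tableaux_0)
qed

theorem sum_tableaux_xt_word:
  assumes "shape L lam"
  shows "(\<Sum>T\<in>tableaux L n lam. xt_word (row_word T)) = tab_sum L n lam"
  using assms
proof (induction n arbitrary: lam)
  case 0
  then show ?case by (simp add: tableaux_0_shape row_word_def xt_word_def)
next
  case (Suc n)
  show ?case
    unfolding sum_tableaux_Suc[OF Suc.prems] tab_sum.simps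
  proof (rule sum.cong[OF refl])
    fix nu assume "nu \<in> {nu. hstrip nu lam}"
    then have nu: "hstrip nu lam" by simp
    then have "shape L nu" using Suc.prems hstrip_shape_lower by blast
    have "(\<Sum>T\<in>tableaux L n nu. xt_word (row_word (row_join L (Suc n) lam T))) =
      (\<Sum>T\<in>tableaux L n nu. (-1) ^ skew_sign L lam nu *
      xt_word (row_word T) * xt (Suc n) ^ (size_upto L lam - size_upto L nu))"
      by (rule sum.cong[OF refl]) (rule row_join_facts(1)[OF nu])
    then show "(\<Sum>T\<in>tableaux L n nu. xt_word (row_word (row_join L (Suc n) lam T))) =
      (-1) ^ skew_sign L lam nu * tab_sum L n nu * xt (Suc n) ^ (size_upto L lam - size_upto L nu)"
      by (simp only: Suc.IH[OF \<open>shape L nu\<close>, symmetric] sum_distrib_left sum_distrib_right)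
  qed
qed

theorem sum_tableaux_inversions:
  assumes "shape L lam"
  shows "(\<Sum>T | T \<in> tableaux L (length mu) lam \<and> (\<forall>i<length mu. count_list (row_word T) (Suc i) = mu ! i).
    e ^ inversions (row_word T)) = wkostka e L (rev mu) lam"
  using assms
proof (induction mu arbitrary: lam rule: rev_induct)
  case Nil
  then show ?case by (auto simp: tableaux_0_shape row_word_def)
next
  case (snoc m mu)
  let ?n = "length mu"
  define G :: "nat list \<Rightarrow> nat list list \<Rightarrow> int"
    where "G mu T = (if \<forall>i<length mu. count_list (row_word T) (Suc i) = mu ! i then e ^ inversions (row_word T) else 0)" for mu T
  have G: "(\<Sum>T | T \<in> tableaux L k lam \<and> (\<forall>i<length mu. count_list (row_word T) (Suc i) = mu ! i).
    e ^ inversions (row_word T)) = sum (G mu) (tableaux L k lam)" for k lam mu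
    unfolding G_def by (rule sum.inter_filter) (rule finite_tableaux)
  have step: "G (mu @ [m]) (row_join L (Suc ?n) lam T) =
      (if size_upto L nu + m = size_upto L lam then e ^ skew_sign L lam nu * G mu T else 0)"
    if nu: "hstrip nu lam" and T: "T \<in> tableaux L ?n nu" for nu T
  proof -
    have "Suc ?n \<notin> set (row_word T)"
      using T by (auto simp: tableaux_def)
    then have c0: "count_list (row_word T) (Suc ?n) = 0"
      by (simp add: count_list_0_iff)
    have "(\<forall>i<length (mu @ [m]). count_list (row_word (row_join L (Suc ?n) lam T)) (Suc i) = (mu @ [m]) ! i) \<longleftrightarrow>
      (\<forall>i<?n. count_list (row_word T) (Suc i) = mu ! i) \<and> size_upto L lam - size_upto L nu = m"
      unfolding row_join_facts(3)[OF nu T] using c0 by (auto simp: nth_append less_Suc_eq)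
    moreover have "size_upto L lam - size_upto L nu = m \<longleftrightarrow> size_upto L nu + m = size_upto L lam"
      using hstrip_size[OF nu, of L] by auto
    ultimately show ?thesis
      unfolding G_def by (simp only: row_join_facts(2)[OF nu T] power_add) auto
  qed
  have "sum (G (mu @ [m])) (tableaux L (Suc ?n) lam) =
    (\<Sum>nu | hstrip nu lam. \<Sum>T\<in>tableaux L ?n nu. G (mu @ [m]) (row_join L (Suc ?n) lam T))"
    by (rule sum_tableaux_Suc[OF snoc.prems])
  also have "\<dots> = (\<Sum>nu | hstrip nu lam.
      if size_upto L nu + m = size_upto L lam then e ^ skew_sign L lam nu * wkostka e L (rev mu) nu else 0)"
  proof (rule sum.cong[OF refl])
    fix nu assume "nu \<in> {nu. hstrip nu lam}"
    then have nu: "hstrip nu lam" by simp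
    then have shape: "shape L nu" using snoc.prems hstrip_shape_lower by blast
    have IH: "sum (G mu) (tableaux L ?n nu) = wkostka e L (rev mu) nu"
      using snoc.IH[OF shape] by (simp only: G)
    show "(\<Sum>T\<in>tableaux L ?n nu. G (mu @ [m]) (row_join L (Suc ?n) lam T)) =
      (if size_upto L nu + m = size_upto L lam then e ^ skew_sign L lam nu * wkostka e L (rev mu) nu else 0)"
      by (simp add: step[OF nu] sum_distrib_left flip: IH)
  qed
  also have "\<dots> = (\<Sum>nu | hstrip nu lam \<and> size_upto L nu + m = size_upto L lam.
      e ^ skew_sign L lam nu * wkostka e L (rev mu) nu)"
    using sum.inter_filter[OF finite_hstrip[OF snoc.prems], symmetric] by simp
  finally show ?case
    unfolding G by simp
qed

lemma inv_form_extend: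
  assumes "\<And>i. L \<le> i \<Longrightarrow> a i = 0" and "L \<le> L'"
  shows "inv_form L' a b = inv_form L a b"
  unfolding inv_form_def by (rule sum.mono_neutral_right) (use assms in auto)

lemma size_upto_extend:
  assumes "shape L lam" and "L \<le> L'"
  shows "size_upto L' lam = size_upto L lam"
  by (rule size_upto_support) (use assms in \<open>auto simp: shape_def\<close>)

lemma tab_sum_extend:
  assumes "shape L lam" and "L \<le> L'"
  shows "tab_sum L' n lam = tab_sum L n lam"
  using assms(1)
proof (induction n arbitrary: lam)
  case (Suc n)
  show ?case
    unfolding tab_sum.simps
  proof (rule sum.cong[OF refl])
    fix nu assume "nu \<in> {nu. hstrip nu lam}"
    then have nu: "shape L nu" using Suc.prems hstrip_shape_lower by blast
    have "skew_sign L' lam nu = skew_sign L lam nu"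
      by (rule inv_form_extend) (use Suc.prems assms in \<open>auto simp: shape_def\<close>)
    then show "(-1) ^ skew_sign L' lam nu * tab_sum L' n nu * xt (Suc n) ^ (size_upto L' lam - size_upto L' nu) =
      (-1) ^ skew_sign L lam nu * tab_sum L n nu * xt (Suc n) ^ (size_upto L lam - size_upto L nu)"
      by (simp only: Suc.IH[OF nu] size_upto_extend[OF nu assms(2)] size_upto_extend[OF Suc.prems assms(2)])
  qed
qed simp

lemma wkostka_extend:
  assumes "shape L lam" and "L \<le> L'"
  shows "wkostka e L' ms lam = wkostka e L ms lam"
  using assms(1)
proof (induction ms arbitrary: lam)
  case (Cons m ms)
  show ?case
    unfolding wkostka.simps
  proof (rule sum.cong)
    show "{nu. hstrip nu lam \<and> size_upto L' nu + m = size_upto L' lam} =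
        {nu. hstrip nu lam \<and> size_upto L nu + m = size_upto L lam}"
    proof -
      have "size_upto L' nu = size_upto L nu" if "hstrip nu lam" for nu
        by (rule size_upto_extend[OF hstrip_shape_lower[OF that Cons.prems] assms(2)])
      then show ?thesis
        using size_upto_extend[OF Cons.prems assms(2)] by auto
    qed
    fix nu assume "nu \<in> {nu. hstrip nu lam \<and> size_upto L nu + m = size_upto L lam}"
    then have nu: "shape L nu" using Cons.prems hstrip_shape_lower by blast
    have "skew_sign L' lam nu = skew_sign L lam nu"
      by (rule inv_form_extend) (use Cons.prems assms in \<open>auto simp: shape_def\<close>)
    then show "e ^ skew_sign L' lam nu * wkostka e L' ms nu = e ^ skew_sign L lam nu * wkostka e L ms nu"
      using nu Cons.IH by simp
  qed
qed simp

section \<open>The quotient ring inside the infinite one\<close>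

lemma free_ring_simps [simp]:
  "mult (free_ring n) = (*)" "one (free_ring n) = 1" "zero (free_ring n) = 0" "add (free_ring n) = (+)"
  by (simp_all add: free_ring_def)

lemma carrier_free_ring:
  "f \<in> carrier (free_ring n) \<longleftrightarrow> (\<forall>w\<in>Poly_Mapping.keys f. set (letters w) \<subseteq> {1..n})"
  by (simp add: free_ring_def)

lemma free_ring_closed:
  "0 \<in> carrier (free_ring n)" "1 \<in> carrier (free_ring n)"
  "f \<in> carrier (free_ring n) \<Longrightarrow> g \<in> carrier (free_ring n) \<Longrightarrow> f + g \<in> carrier (free_ring n)"
  "f \<in> carrier (free_ring n) \<Longrightarrow> g \<in> carrier (free_ring n) \<Longrightarrow> f * g \<in> carrier (free_ring n)"
  "f \<in> carrier (free_ring n) \<Longrightarrow> - f \<in> carrier (free_ring n)"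
  "f \<in> carrier (free_ring n) \<Longrightarrow> g \<in> carrier (free_ring n) \<Longrightarrow> f - g \<in> carrier (free_ring n)"
  "i \<in> {1..n} \<Longrightarrow> free_var i \<in> carrier (free_ring n)"
proof -
  show "0 \<in> carrier (free_ring n)" by (simp add: carrier_free_ring)
  show "1 \<in> carrier (free_ring n)" by (simp add: carrier_free_ring zero_fword_def)
  show "f \<in> carrier (free_ring n) \<Longrightarrow> g \<in> carrier (free_ring n) \<Longrightarrow> f + g \<in> carrier (free_ring n)"
    unfolding carrier_free_ring using keys_add[of f g] by blast
  show "f \<in> carrier (free_ring n) \<Longrightarrow> g \<in> carrier (free_ring n) \<Longrightarrow> f - g \<in> carrier (free_ring n)"
    unfolding carrier_free_ring using keys_diff[of f g] by blast
  show "f \<in> carrier (free_ring n) \<Longrightarrow> - f \<in> carrier (free_ring n)"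
    by (simp add: carrier_free_ring)
  show "i \<in> {1..n} \<Longrightarrow> free_var i \<in> carrier (free_ring n)"
    by (simp add: carrier_free_ring free_var_def)
  show "f \<in> carrier (free_ring n) \<Longrightarrow> g \<in> carrier (free_ring n) \<Longrightarrow> f * g \<in> carrier (free_ring n)"
    unfolding carrier_free_ring
  proof
    fix w assume f: "\<forall>w\<in>Poly_Mapping.keys f. set (letters w) \<subseteq> {1..n}"
      and g: "\<forall>w\<in>Poly_Mapping.keys g. set (letters w) \<subseteq> {1..n}" and "w \<in> Poly_Mapping.keys (f * g)"
    then obtain u v where "w = u + v" "u \<in> Poly_Mapping.keys f" "v \<in> Poly_Mapping.keys g"
      using keys_mult[of f g] by blast
    moreover from this f g have "set (letters u) \<subseteq> {1..n}" "set (letters v) \<subseteq> {1..n}" by blast+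
    ultimately show "set (letters w) \<subseteq> {1..n}"
      by (simp add: plus_fword_def)
  qed
qed

lemma ring_free_ring: "ring (free_ring n)"
proof (rule ringI)
  show "abelian_group (free_ring n)"
  proof (rule abelian_groupI)
    fix x assume "x \<in> carrier (free_ring n)"
    then show "\<exists>y\<in>carrier (free_ring n). y \<oplus>\<^bsub>free_ring n\<^esub> x = \<zero>\<^bsub>free_ring n\<^esub>"
      by (intro bexI[of _ "- x"]) (simp_all add: free_ring_closed)
  qed (simp_all add: free_ring_closed add.assoc add.commute)
  show "monoid (free_ring n)"
    by (rule monoidI) (simp_all add: free_ring_closed mult.assoc)
qed (simp_all add: distrib_left distrib_right)

definition skew_ring :: "skew_poly ring"
  where "skew_ring = \<lparr>carrier = UNIV, mult = (*), one = 1, zero = 0, add = (+)\<rparr>"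

lemma skew_ring_simps [simp]:
  "carrier skew_ring = UNIV" "mult skew_ring = (*)" "one skew_ring = 1" "zero skew_ring = 0"
  "add skew_ring = (+)"
  by (simp_all add: skew_ring_def)

lemma ring_skew_ring: "ring skew_ring"
proof (rule ringI)
  show "abelian_group skew_ring"
  proof (rule abelian_groupI)
    fix x show "\<exists>y\<in>carrier skew_ring. y \<oplus>\<^bsub>skew_ring\<^esub> x = \<zero>\<^bsub>skew_ring\<^esub>"
      by (intro bexI[of _ "- x"]) simp_all
  qed (simp_all add: add.assoc add.commute)
  show "monoid skew_ring"
    by (rule monoidI) (simp_all add: mult.assoc)
qed (simp_all add: distrib_left distrib_right)

lemma abs_skew_ring_hom: "ring_hom_ring (free_ring n) skew_ring abs_skew"
  by (intro ring_hom_ringI2 ring_free_ring ring_skew_ring ring_hom_memI) (simp_all add: abs_skew_hom)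

definition opol_gens :: "nat \<Rightarrow> free_poly set"
  where "opol_gens n = {free_var i * free_var j + free_var j * free_var i | i j.
    i \<in> {1..n} \<and> j \<in> {1..n} \<and> i \<noteq> j}"

lemma opol_gens_carrier: "opol_gens n \<subseteq> carrier (free_ring n)"
  by (auto simp: opol_gens_def intro!: free_ring_closed)

lemma ideal_opol_ideal: "ideal (opol_ideal n) (free_ring n)"
  unfolding opol_ideal_def opol_gens_def[symmetric]
  by (rule ring.genideal_ideal[OF ring_free_ring opol_gens_carrier])

lemma opol_ideal_closed:
  "0 \<in> opol_ideal n"
  "f \<in> opol_ideal n \<Longrightarrow> g \<in> opol_ideal n \<Longrightarrow> f + g \<in> opol_ideal n"
  using additive_subgroup.zero_closed[OF ideal.axioms(1)[OF ideal_opol_ideal]]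
    additive_subgroup.a_closed[OF ideal.axioms(1)[OF ideal_opol_ideal]] by auto

definition restrict_vars :: "nat \<Rightarrow> free_poly \<Rightarrow> free_poly"
  where "restrict_vars n = free_eval (\<lambda>i. if i \<in> {1..n} then free_var i else 0)"

lemma restrict_vars_carrier: "restrict_vars n f \<in> carrier (free_ring n)"
proof (induction f rule: free_poly_induct)
  case (word w)
  have "prod_list (map (\<lambda>i. if i \<in> {1..n} then free_var i else 0) xs) \<in> carrier (free_ring n)" for xs
    by (induction xs) (auto intro!: free_ring_closed)
  then show ?case by (simp add: restrict_vars_def free_eval_word)
qed (simp_all add: restrict_vars_def free_eval_diff free_ring_closed)

lemma restrict_vars_id: "f \<in> carrier (free_ring n) \<Longrightarrow> restrict_vars n f = f"
  unfolding restrict_vars_def using free_eval_cong[of f n _ free_var] by (simp add: free_eval_free_var)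

lemma restrict_vars_skew_ideal: "f \<in> skew_ideal \<Longrightarrow> restrict_vars n f \<in> opol_ideal n"
proof (induction rule: skew_ideal.induct)
  interpret I: ideal "opol_ideal n" "free_ring n" by (rule ideal_opol_ideal)
  {
    case (gen i j a b)
    have k: "restrict_vars n (a * (free_var i * free_var j + free_var j * free_var i) * b) =
        restrict_vars n a * (restrict_vars n (free_var i) * restrict_vars n (free_var j) + restrict_vars n (free_var j) * restrict_vars n (free_var i)) * restrict_vars n b"
      by (simp add: restrict_vars_def free_eval_mult free_eval_add)
    show ?case
    proof (cases "i \<in> {1..n} \<and> j \<in> {1..n}")
      case True
      then have "free_var i * free_var j + free_var j * free_var i \<in> opol_gens n"
        using gen by (auto simp: opol_gens_def)
      then have "free_var i * free_var j + free_var j * free_var i \<in> opol_ideal n"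
        unfolding opol_ideal_def opol_gens_def[symmetric]
        using ring.genideal_self[OF ring_free_ring opol_gens_carrier] by blast
      then have "restrict_vars n a * (free_var i * free_var j + free_var j * free_var i) * restrict_vars n b \<in> opol_ideal n"
        using I.I_l_closed[of _ "restrict_vars n a"] I.I_r_closed[of _ "restrict_vars n b"] restrict_vars_carrier by simp
      moreover have "restrict_vars n (free_var i) = free_var i" "restrict_vars n (free_var j) = free_var j"
        using True by (simp_all add: restrict_vars_id free_ring_closed)
      ultimately show ?thesis by (simp only: k)
    next
      case False
      then have "restrict_vars n (free_var i) = 0 \<or> restrict_vars n (free_var j) = 0"
        by (auto simp: restrict_vars_def)
      then have "restrict_vars n (a * (free_var i * free_var j + free_var j * free_var i) * b) = 0"
        unfolding k by auto
      then show ?thesis by (simp only: opol_ideal_closed)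
    qed
  next
    case zero
    show ?case by (simp add: restrict_vars_def opol_ideal_closed)
  next
    case (add f g)
    then show ?case by (simp add: restrict_vars_def free_eval_add opol_ideal_closed)
  }
qed

text \<open>A relation among odd polynomials in \<open>1..n\<close> that holds in the infinite ring already holds in \<open>OPol n\<close>:
setting the other variables to zero maps a proof of the former to a proof of the latter.\<close>

lemma opol_ideal_eq_kernel: "opol_ideal n = a_kernel (free_ring n) skew_ring abs_skew"
proof
  interpret h: ring_hom_ring "free_ring n" skew_ring abs_skew by (rule abs_skew_ring_hom)
  have "X i * X j + X j * X i = 0" if "i \<noteq> j" for i j
    using X_anticommute[OF that] by simp
  then have "opol_gens n \<subseteq> a_kernel (free_ring n) skew_ring abs_skew"
    unfolding a_kernel_def'
    by (auto simp: opol_gens_def abs_skew_hom intro!: free_ring_closed simp flip: X_def)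
  then show "opol_ideal n \<subseteq> a_kernel (free_ring n) skew_ring abs_skew"
    unfolding opol_ideal_def opol_gens_def[symmetric]
    by (rule ring.genideal_minimal[OF ring_free_ring h.kernel_is_ideal])
  show "a_kernel (free_ring n) skew_ring abs_skew \<subseteq> opol_ideal n"
  proof
    fix f assume "f \<in> a_kernel (free_ring n) skew_ring abs_skew"
    then have f: "f \<in> carrier (free_ring n)" "abs_skew f = 0"
      unfolding a_kernel_def' by simp_all
    then have "restrict_vars n f \<in> opol_ideal n"
      by (intro restrict_vars_skew_ideal) (simp add: abs_skew_eq_0_iff)
    then show "f \<in> opol_ideal n" by (simp add: restrict_vars_id f)
  qed
qed

lemma ring_OPol: "ring (OPol n)"
  unfolding OPol_def by (rule ideal.quotient_is_ring[OF ideal_opol_ideal])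

text \<open>The embedding of \<open>OPol n\<close> into the infinite ring, as a relation: an identity in \<open>OPol n\<close> follows once both
sides represent the same element, and every operation has a rule that computes what it represents.\<close>

definition represents :: "nat \<Rightarrow> free_poly set \<Rightarrow> skew_poly \<Rightarrow> bool"
  where "represents n A p \<longleftrightarrow> A \<in> carrier (OPol n) \<and> the_elem (abs_skew ` A) = p"

lemma represents_unique: "represents n A p \<Longrightarrow> represents n B p \<Longrightarrow> A = B"
  unfolding represents_def OPol_def opol_ideal_eq_kernel
  using ring_hom_ring.the_elem_inj[OF abs_skew_ring_hom] by metis

lemma represents_fun: "represents n A p \<Longrightarrow> represents n A q \<Longrightarrow> p = q"
  by (simp add: represents_def)

lemma represents_ex: "A \<in> carrier (OPol n) \<Longrightarrow> represents n A (the_elem (abs_skew ` A))"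
  by (simp add: represents_def)

lemma represents_carrier: "represents n A p \<Longrightarrow> A \<in> carrier (OPol n)"
  by (simp add: represents_def)

lemma value_ring_hom: "(\<lambda>A. the_elem (abs_skew ` A)) \<in> ring_hom (OPol n) skew_ring"
  using ring_hom_ring.the_elem_hom[OF abs_skew_ring_hom[of n]]
  by (simp only: OPol_def opol_ideal_eq_kernel)

lemma represents_coset:
  assumes "f \<in> carrier (free_ring n)"
  shows "represents n (opol_ideal n +>\<^bsub>free_ring n\<^esub> f) (abs_skew f)"
  using ring_hom_ring.the_elem_simp[OF abs_skew_ring_hom assms]
    ring_hom_closed[OF ideal.rcos_ring_hom[OF ideal_opol_ideal] assms]
  by (simp add: represents_def OPol_def flip: opol_ideal_eq_kernel)

lemma represents_x: "i \<in> {1..n} \<Longrightarrow> represents n (opol_x n i) (X i)"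
  unfolding opol_x_def X_def by (rule represents_coset) (rule free_ring_closed)

lemma represents_add:
  assumes "represents n A p" and "represents n B q"
  shows "represents n (A \<oplus>\<^bsub>OPol n\<^esub> B) (p + q)"
proof -
  interpret ring "OPol n" by (rule ring_OPol)
  show ?thesis
    using assms ring_hom_add[OF value_ring_hom, of A n B] add.m_closed[of A B]
    unfolding represents_def by simp
qed

lemma represents_mult:
  assumes "represents n A p" and "represents n B q"
  shows "represents n (A \<otimes>\<^bsub>OPol n\<^esub> B) (p * q)"
proof -
  interpret ring "OPol n" by (rule ring_OPol)
  show ?thesis
    using assms ring_hom_mult[OF value_ring_hom, of A n B] m_closed[of A B]
    unfolding represents_def by simp
qed

lemma represents_zero: "represents n \<zero>\<^bsub>OPol n\<^esub> 0"
  using ring_hom_zero[OF value_ring_hom ring_OPol ring_skew_ring] ring.ring_simprules(2)[OF ring_OPol]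
  unfolding represents_def by simp

lemma represents_one: "represents n \<one>\<^bsub>OPol n\<^esub> 1"
  using ring_hom_one[OF value_ring_hom] ring.ring_simprules(6)[OF ring_OPol]
  unfolding represents_def by simp

lemma represents_uminus:
  assumes "represents n A p"
  shows "represents n (\<ominus>\<^bsub>OPol n\<^esub> A) (- p)"
proof -
  interpret ring "OPol n" by (rule ring_OPol)
  have A: "A \<in> carrier (OPol n)" using assms by (rule represents_carrier)
  obtain q where q: "represents n (\<ominus>\<^bsub>OPol n\<^esub> A) q"
    using represents_ex[OF a_inv_closed[OF A]] by blast
  have "represents n \<zero>\<^bsub>OPol n\<^esub> (q + p)"
    using represents_add[OF q assms] by (simp add: l_neg A)
  then have "q + p = 0" using represents_zero represents_fun by blast
  with q show ?thesis by (simp add: eq_neg_iff_add_eq_0[symmetric])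
qed

lemma represents_scale:
  assumes "represents n A p"
  shows "represents n ([(z :: int)] \<cdot>\<^bsub>OPol n\<^esub> A) (of_int z * p)"
proof -
  interpret ring "OPol n" by (rule ring_OPol)
  have nat: "represents n ([(k :: nat)] \<cdot>\<^bsub>OPol n\<^esub> A) (of_nat k * p)" for k
  proof (induction k)
    case 0
    show ?case using represents_zero by simp
  next
    case (Suc k)
    have "represents n ([k] \<cdot>\<^bsub>OPol n\<^esub> A \<oplus>\<^bsub>OPol n\<^esub> A) (of_nat k * p + p)"
      by (rule represents_add[OF Suc assms])
    then show ?case by (simp add: distrib_right add.commute)
  qed
  show ?thesis
  proof (cases "0 \<le> z")
    case True
    then show ?thesis using nat[of "nat z"] by (simp add: add_pow_int_ge of_nat_nat)
  next
    case False
    then have "(of_nat (nat (- z)) :: skew_poly) = - of_int z" by (simp add: of_nat_nat)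
    then show ?thesis
      using represents_uminus[OF nat[of "nat (- z)"]] False by (simp add: add_pow_int_lt)
  qed
qed

lemma represents_sum:
  assumes "finite I" and "\<And>i. i \<in> I \<Longrightarrow> represents n (A i) (p i)"
  shows "represents n (\<Oplus>\<^bsub>OPol n\<^esub> i\<in>I. A i) (\<Sum>i\<in>I. p i)"
  using assms
proof (induction I rule: finite_induct)
  case empty
  interpret ring "OPol n" by (rule ring_OPol)
  show ?case using represents_zero by simp
next
  case (insert i I)
  interpret ring "OPol n" by (rule ring_OPol)
  have "A \<in> I \<rightarrow> carrier (OPol n)" "A i \<in> carrier (OPol n)"
    using insert.prems represents_carrier by blast+
  then show ?case
    using insert represents_add by simp
qed

lemma represents_ordered_prod:
  "list_all2 (represents n) As ps \<Longrightarrow> represents n (ordered_prod (OPol n) As) (prod_list ps)"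
  unfolding ordered_prod_def
  by (induction rule: list_all2_induct) (simp_all add: represents_one represents_mult)

lemma represents_ordered_prod_map:
  assumes "\<And>i. i \<in> set xs \<Longrightarrow> represents n (A i) (p i)"
  shows "represents n (ordered_prod (OPol n) (map A xs)) (prod_list (map p xs))"
  by (rule represents_ordered_prod) (use assms in \<open>auto simp: list_all2_map1 list_all2_map2 list_all2_same\<close>)

lemma represents_power:
  assumes "represents n A p"
  shows "represents n (A [^]\<^bsub>OPol n\<^esub> (k :: nat)) (p ^ k)"
proof (induction k)
  interpret ring "OPol n" by (rule ring_OPol)
  case 0
  show ?case using represents_one by simp
next
  interpret ring "OPol n" by (rule ring_OPol)
  case (Suc k)
  show ?case using represents_mult[OF Suc assms] by (simp add: power_commutes)
qed

lemma represents_xt: "i \<in> {1..n} \<Longrightarrow> represents n (opol_xt n i) (xt i)"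
  using represents_scale[OF represents_x, of i n "(-1) ^ (i - 1)"] by (simp add: opol_xt_def xt_def)

lemma represents_xt_word:
  "set w \<subseteq> {1..n} \<Longrightarrow> represents n (opol_xt_word n w) (xt_word w)"
  unfolding opol_xt_word_def xt_word_def by (rule represents_ordered_prod_map) (use represents_xt in blast)

lemma free_ring_induct [consumes 1, case_names zero one var_mult add uminus]:
  assumes "f \<in> carrier (free_ring n)"
    and zero: "P 0" and one: "P 1" and var_mult: "\<And>i g. i \<in> {1..n} \<Longrightarrow> g \<in> carrier (free_ring n) \<Longrightarrow> P g \<Longrightarrow> P (free_var i * g)"
    and add: "\<And>g h. g \<in> carrier (free_ring n) \<Longrightarrow> h \<in> carrier (free_ring n) \<Longrightarrow> P g \<Longrightarrow> P h \<Longrightarrow> P (g + h)"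
    and uminus: "\<And>g. g \<in> carrier (free_ring n) \<Longrightarrow> P g \<Longrightarrow> P (- g)"
  shows "P f"
proof -
  have word: "prod_list (map free_var xs) \<in> carrier (free_ring n) \<and> P (prod_list (map free_var xs))"
    if "set xs \<subseteq> {1..n}" for xs
    using that by (induction xs) (auto intro!: free_ring_closed one var_mult)
  have "Poly_Mapping.keys f \<subseteq> {w. set (letters w) \<subseteq> {1..n}}"
    using assms(1) by (auto simp: carrier_free_ring)
  then have "f \<in> carrier (free_ring n) \<and> P f"
  proof (induction rule: frag_induction)
    case zero
    show ?case by (simp add: free_ring_closed assms(2))
  next
    case (one w)
    then show ?case using word[of "letters w"] by (simp only: single_word mem_Collect_eq)
  next
    case (diff a b)
    then show ?case
      using add[of a "- b"] uminus[of b] by (simp add: free_ring_closed)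
  qed
  then show ?thesis ..
qed

lemma OPol_induct [consumes 1, case_names zero one var_mult add uminus]:
  assumes A: "A \<in> carrier (OPol n)"
    and zero: "P \<zero>\<^bsub>OPol n\<^esub>" and one: "P \<one>\<^bsub>OPol n\<^esub>"
    and var_mult: "\<And>i B. i \<in> {1..n} \<Longrightarrow> B \<in> carrier (OPol n) \<Longrightarrow> P B \<Longrightarrow> P (opol_x n i \<otimes>\<^bsub>OPol n\<^esub> B)"
    and add: "\<And>B C. B \<in> carrier (OPol n) \<Longrightarrow> C \<in> carrier (OPol n) \<Longrightarrow> P B \<Longrightarrow> P C \<Longrightarrow> P (B \<oplus>\<^bsub>OPol n\<^esub> C)"
    and uminus: "\<And>B. B \<in> carrier (OPol n) \<Longrightarrow> P B \<Longrightarrow> P (\<ominus>\<^bsub>OPol n\<^esub> B)"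
  shows "P A"
proof -
  let ?c = "\<lambda>f. opol_ideal n +>\<^bsub>free_ring n\<^esub> f"
  have coset: "P (?c f)" if "f \<in> carrier (free_ring n)" for f
    using that
  proof (induction f rule: free_ring_induct)
    case zero
    have "represents n (?c 0) 0"
      using represents_coset[OF free_ring_closed(1), of n] by (simp only: abs_skew_hom)
    then have "?c 0 = \<zero>\<^bsub>OPol n\<^esub>"
      by (rule represents_unique[OF _ represents_zero])
    then show ?case using assms(2) by simp
  next
    case one
    have "represents n (?c 1) 1"
      using represents_coset[OF free_ring_closed(2), of n] by (simp only: abs_skew_hom)
    then have "?c 1 = \<one>\<^bsub>OPol n\<^esub>"
      by (rule represents_unique[OF _ represents_one])
    then show ?case using assms(3) by simp
  next
    case (var_mult i g)
    have "represents n (?c (free_var i * g)) (X i * abs_skew g)"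
      using represents_coset[of "free_var i * g" n] var_mult by (simp add: abs_skew_hom X_def free_ring_closed)
    then have "?c (free_var i * g) = opol_x n i \<otimes>\<^bsub>OPol n\<^esub> ?c g"
      by (rule represents_unique) (intro represents_mult represents_x represents_coset; fact var_mult)
    then show ?case
      using assms(4)[of i "?c g"] var_mult represents_carrier[OF represents_coset] by simp
  next
    case (add g h)
    have "represents n (?c (g + h)) (abs_skew g + abs_skew h)"
      using represents_coset[of "g + h" n] add by (simp add: abs_skew_hom free_ring_closed)
    then have "?c (g + h) = ?c g \<oplus>\<^bsub>OPol n\<^esub> ?c h"
      by (rule represents_unique) (intro represents_add represents_coset; fact add)
    then show ?case
      using assms(5)[of "?c g" "?c h"] add represents_carrier[OF represents_coset] by simp
  next
    case (uminus g)
    have "represents n (?c (- g)) (- abs_skew g)"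
      using represents_coset[of "- g" n] uminus abs_skew_hom(2)[of 0 g] by (simp add: abs_skew_hom(5) free_ring_closed)
    then have "?c (- g) = \<ominus>\<^bsub>OPol n\<^esub> ?c g"
      by (rule represents_unique) (intro represents_uminus represents_coset; fact uminus)
    then show ?case
      using assms(6)[of "?c g"] uminus represents_carrier[OF represents_coset] by simp
  qed
  from A obtain f where "f \<in> carrier (free_ring n)" "A = ?c f"
    using ring_hom_ring.quot_mem[OF abs_skew_ring_hom, of A n]
    by (auto simp: OPol_def opol_ideal_eq_kernel)
  then show ?thesis using coset by simp
qed

section \<open>The operators on the quotient ring\<close>

lemma represents_preimage:
  assumes "represents n A p"
  shows "the_elem (abs_skew ` A) = p"
  using assms by (simp add: represents_def)

text \<open>The conditions determine the map on the generators and hence everywhere; this gives uniqueness.\<close>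

lemma is_opol_s_represents:
  assumes s: "is_opol_s n i \<sigma>" and i: "1 \<le> i" "i < n" and A: "A \<in> carrier (OPol n)"
  shows "represents n (\<sigma> A) (sact i (the_elem (abs_skew ` A)))"
  using A
proof (induction A rule: OPol_induct)
  have hom: "\<sigma> \<in> ring_hom (OPol n) (OPol n)" using s by (simp add: is_opol_s_def)
  note psi = represents_preimage
  {
    case zero
    have "\<sigma> \<zero>\<^bsub>OPol n\<^esub> = \<zero>\<^bsub>OPol n\<^esub>"
      by (rule ring_hom_zero[OF hom ring_OPol ring_OPol])
    then show ?case using represents_zero by (simp add: psi[OF represents_zero])
  next
    case one
    have "\<sigma> \<one>\<^bsub>OPol n\<^esub> = \<one>\<^bsub>OPol n\<^esub>"
      by (rule ring_hom_one[OF hom])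
    then show ?case using represents_one by (simp add: psi[OF represents_one])
  next
    case (var_mult j B)
    have x: "represents n (opol_x n j) (X j)" using var_mult by (intro represents_x)
    have "represents n (\<sigma> (opol_x n j)) (sact i (X j))"
    proof -
      consider "j = i" | "j = i + 1" | "j \<noteq> i" "j \<noteq> i + 1" by blast
      then show ?thesis
      proof cases
        case 1
        then have "\<sigma> (opol_x n j) = \<ominus>\<^bsub>OPol n\<^esub> opol_x n (i + 1)" using s by (simp add: is_opol_s_def)
        then show ?thesis
          using represents_uminus[OF represents_x[of "i + 1" n]] 1 i by (simp add: sact_X)
      next
        case 2
        then have "\<sigma> (opol_x n j) = \<ominus>\<^bsub>OPol n\<^esub> opol_x n i" using s by (simp add: is_opol_s_def)
        then show ?thesis
          using represents_uminus[OF represents_x[of i n]] 2 i by (simp add: sact_X)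
      next
        case 3
        then have "\<sigma> (opol_x n j) = \<ominus>\<^bsub>OPol n\<^esub> opol_x n j"
          using s var_mult by (simp add: is_opol_s_def)
        then show ?thesis
          using represents_uminus[OF x] 3 by (simp add: sact_X transpose_def)
      qed
    qed
    moreover have "\<sigma> (opol_x n j \<otimes>\<^bsub>OPol n\<^esub> B) = \<sigma> (opol_x n j) \<otimes>\<^bsub>OPol n\<^esub> \<sigma> B"
      using var_mult represents_carrier[OF x] by (intro ring_hom_mult[OF hom])
    ultimately show ?case
      using represents_mult var_mult psi[OF represents_mult[OF x represents_ex[OF var_mult(2)]]]
      by simp
  next
    case (add B C)
    have "\<sigma> (B \<oplus>\<^bsub>OPol n\<^esub> C) = \<sigma> B \<oplus>\<^bsub>OPol n\<^esub> \<sigma> C"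
      using add by (intro ring_hom_add[OF hom])
    then show ?case
      using represents_add[OF add.IH] psi[OF represents_add[OF represents_ex[OF add(1)] represents_ex[OF add(2)]]]
      by simp
  next
    case (uminus B)
    interpret h: ring_hom_ring "OPol n" "OPol n" \<sigma>
      by (intro ring_hom_ringI2 ring_OPol hom)
    have "\<sigma> (\<ominus>\<^bsub>OPol n\<^esub> B) = \<ominus>\<^bsub>OPol n\<^esub> \<sigma> B"
      using uminus(1) by (rule h.hom_a_inv)
    then show ?case
      using represents_uminus[OF uminus.IH] psi[OF represents_uminus[OF represents_ex[OF uminus(1)]]]
      by simp
  }
qed

text \<open>For \<open>i < n\<close> the action does not leave the subring of the variables \<open>1..n\<close>.\<close>

lemma sact_ex_represents:
  assumes i: "1 \<le> i" "i < n" and "A \<in> carrier (OPol n)"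
  shows "\<exists>B. represents n B (sact i (the_elem (abs_skew ` A)))"
  using assms(3)
proof (induction A rule: OPol_induct)
  note psi = represents_preimage
  {
    case zero
    show ?case using represents_zero by (auto simp: psi[OF represents_zero])
  next
    case one
    show ?case using represents_one by (auto simp: psi[OF represents_one])
  next
    case (var_mult j B)
    have x: "represents n (opol_x n j) (X j)" using var_mult by (intro represents_x)
    have "transpose i (i + 1) j \<in> {1..n}" using var_mult(1) i by (auto simp: transpose_def)
    then have "represents n (\<ominus>\<^bsub>OPol n\<^esub> opol_x n (transpose i (i + 1) j)) (sact i (X j))"
      unfolding sact_X by (intro represents_uminus represents_x)
    then show ?case
      using represents_mult var_mult.IH psi[OF represents_mult[OF x represents_ex[OF var_mult(2)]]]
      unfolding sact_hom by (metis sact_hom(3))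
  next
    case (add B C)
    then show ?case
      using represents_add psi[OF represents_add[OF represents_ex[OF add(1)] represents_ex[OF add(2)]]]
      by (metis sact_hom(1))
  next
    case (uminus B)
    then show ?case
      using represents_uminus psi[OF represents_uminus[OF represents_ex[OF uminus(1)]]]
      by (metis sact_uminus)
  }
qed

lemma the_represents:
  assumes "\<exists>B. represents n B p"
  shows "represents n (THE B. represents n B p) p"
  using assms represents_unique by (metis theI)

lemma is_opol_s_ex:
  assumes i: "1 \<le> i" "i < n"
  shows "\<exists>\<sigma>. is_opol_s n i \<sigma>"
proof -
  define \<sigma> where "\<sigma> = restrict (\<lambda>A. THE B. represents n B (sact i (the_elem (abs_skew ` A)))) (carrier (OPol n))"
  have rep: "represents n (\<sigma> A) (sact i p)" if "represents n A p" for A p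
    using that the_represents[OF sact_ex_represents[OF i represents_carrier[OF that]]]
      represents_carrier[OF that] by (simp add: \<sigma>_def represents_preimage[OF that])
  have eq: "\<sigma> A = B" if "represents n A p" "represents n B q" "sact i p = q" for A B p q
    using represents_unique[of n _ q] rep[OF that(1)] that by blast
  have "\<sigma> \<in> ring_hom (OPol n) (OPol n)"
  proof (rule ring_hom_memI)
    fix A B assume AB: "A \<in> carrier (OPol n)" "B \<in> carrier (OPol n)"
    note rA = represents_ex[OF AB(1)] and rB = represents_ex[OF AB(2)]
    show "\<sigma> A \<in> carrier (OPol n)" using rep[OF rA] by (rule represents_carrier)
    show "\<sigma> (A \<otimes>\<^bsub>OPol n\<^esub> B) = \<sigma> A \<otimes>\<^bsub>OPol n\<^esub> \<sigma> B"
      by (rule eq[OF represents_mult[OF rA rB] represents_mult[OF rep[OF rA] rep[OF rB]]]) simp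
    show "\<sigma> (A \<oplus>\<^bsub>OPol n\<^esub> B) = \<sigma> A \<oplus>\<^bsub>OPol n\<^esub> \<sigma> B"
      by (rule eq[OF represents_add[OF rA rB] represents_add[OF rep[OF rA] rep[OF rB]]]) simp
  next
    show "\<sigma> \<one>\<^bsub>OPol n\<^esub> = \<one>\<^bsub>OPol n\<^esub>"
      by (rule eq[OF represents_one represents_one]) simp
  qed
  moreover have "\<sigma> \<in> extensional (carrier (OPol n))"
    by (simp add: \<sigma>_def)
  moreover have x: "\<sigma> (opol_x n j) = \<ominus>\<^bsub>OPol n\<^esub> opol_x n (transpose i (i + 1) j)" if "j \<in> {1..n}" for j
  proof (rule eq[OF represents_x[OF that] _ sact_X])
    have "transpose i (i + 1) j \<in> {1..n}" using that i by (auto simp: transpose_def)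
    then show "represents n (\<ominus>\<^bsub>OPol n\<^esub> opol_x n (transpose i (i + 1) j)) (- X (transpose i (i + 1) j))"
      by (intro represents_uminus represents_x)
  qed
  ultimately have "is_opol_s n i \<sigma>"
    using i by (simp add: is_opol_s_def x transpose_def)
  then show ?thesis by blast
qed

lemma represents_opol_s:
  assumes i: "1 \<le> i" "i < n" and A: "represents n A p"
  shows "represents n (opol_s n i A) (sact i p)"
proof -
  obtain \<sigma> where \<sigma>: "is_opol_s n i \<sigma>" using is_opol_s_ex[OF i] by blast
  have unique: "\<tau> = \<sigma>" if \<tau>: "is_opol_s n i \<tau>" for \<tau>
  proof (rule extensionalityI)
    show "\<tau> \<in> extensional (carrier (OPol n))" "\<sigma> \<in> extensional (carrier (OPol n))"
      using \<sigma> \<tau> by (simp_all add: is_opol_s_def)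
    show "\<tau> A = \<sigma> A" if "A \<in> carrier (OPol n)" for A
      using is_opol_s_represents[OF \<tau> i that] is_opol_s_represents[OF \<sigma> i that]
      by (rule represents_unique)
  qed
  have "is_opol_s n i (opol_s n i)"
    unfolding opol_s_def by (rule theI[of "is_opol_s n i", OF \<sigma>]) (rule unique)
  from is_opol_s_represents[OF this i represents_carrier[OF A]] show ?thesis
    by (simp add: represents_preimage[OF A])
qed

text \<open>The Leibniz rule also forces the value 0 on the unit, so the map is determined on all products of
variables; this gives uniqueness.\<close>

lemma is_odd_divided_difference_represents:
  assumes D: "is_odd_divided_difference n i D" and i: "1 \<le> i" "i < n" and A: "A \<in> carrier (OPol n)"
  shows "represents n (D A) (ddiff i (the_elem (abs_skew ` A)))"
proof -
  note psi = represents_preimage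
  define d where "d A = the_elem (abs_skew ` D A)" for A
  have rep: "represents n (D A) (d A)" if "A \<in> carrier (OPol n)" for A
    using D that by (auto simp: is_odd_divided_difference_def d_def intro!: represents_ex)
  have d_add: "d (A \<oplus>\<^bsub>OPol n\<^esub> B) = d A + d B" if "A \<in> carrier (OPol n)" "B \<in> carrier (OPol n)" for A B
  proof -
    have "D (A \<oplus>\<^bsub>OPol n\<^esub> B) = D A \<oplus>\<^bsub>OPol n\<^esub> D B"
      using D that by (simp add: is_odd_divided_difference_def)
    then show ?thesis
      using represents_add[OF rep[OF that(1)] rep[OF that(2)]] by (simp add: d_def represents_def)
  qed
  have d_mult: "d (A \<otimes>\<^bsub>OPol n\<^esub> B) = d A * q + sact i p * d B"
    if A: "represents n A p" and B: "represents n B q" for A B p q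
  proof -
    note cA = represents_carrier[OF A] and cB = represents_carrier[OF B]
    have "D (A \<otimes>\<^bsub>OPol n\<^esub> B) = (D A \<otimes>\<^bsub>OPol n\<^esub> B) \<oplus>\<^bsub>OPol n\<^esub> (opol_s n i A \<otimes>\<^bsub>OPol n\<^esub> D B)"
      using D cA cB by (simp add: is_odd_divided_difference_def)
    moreover have "represents n \<dots> (d A * q + sact i p * d B)"
      by (intro represents_add represents_mult represents_opol_s rep i A B cA cB)
    ultimately show ?thesis by (simp add: d_def represents_def)
  qed
  have "d A = ddiff i (the_elem (abs_skew ` A))"
    using A
  proof (induction A rule: OPol_induct)
    case zero
    have "\<zero>\<^bsub>OPol n\<^esub> \<oplus>\<^bsub>OPol n\<^esub> \<zero>\<^bsub>OPol n\<^esub> = \<zero>\<^bsub>OPol n\<^esub>"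
      by (rule represents_unique[OF represents_add[OF represents_zero represents_zero]])
        (simp add: represents_zero)
    then have "d \<zero>\<^bsub>OPol n\<^esub> = 0"
      using d_add[OF represents_carrier[OF represents_zero] represents_carrier[OF represents_zero]] by simp
    then show ?case by (simp add: psi[OF represents_zero])
  next
    case one
    have "\<one>\<^bsub>OPol n\<^esub> \<otimes>\<^bsub>OPol n\<^esub> \<one>\<^bsub>OPol n\<^esub> = \<one>\<^bsub>OPol n\<^esub>"
      by (rule represents_unique[OF represents_mult[OF represents_one represents_one]])
        (simp add: represents_one)
    then have "d \<one>\<^bsub>OPol n\<^esub> = 0"
      using d_mult[OF represents_one represents_one] by simp
    then show ?case by (simp add: psi[OF represents_one])
  next
    case (var_mult j B)
    have x: "represents n (opol_x n j) (X j)" using var_mult by (intro represents_x)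
    have "D (opol_x n j) = (if j \<in> {i, i + 1} then \<one>\<^bsub>OPol n\<^esub> else \<zero>\<^bsub>OPol n\<^esub>)"
      using D var_mult(1) by (simp add: is_odd_divided_difference_def)
    then have "d (opol_x n j) = ddiff i (X j)"
      by (simp add: d_def psi[OF represents_one] psi[OF represents_zero] ddiff_X)
    then show ?case
      using d_mult[OF x represents_ex[OF var_mult(2)]] var_mult.IH
      by (simp add: psi[OF represents_mult[OF x represents_ex[OF var_mult(2)]]] ddiff_mult)
  next
    case (add B C)
    then show ?case
      by (simp add: d_add psi[OF represents_add[OF represents_ex[OF add(1)] represents_ex[OF add(2)]]])
  next
    case (uminus B)
    note rB = represents_ex[OF uminus(1)]
    have "\<ominus>\<^bsub>OPol n\<^esub> B \<oplus>\<^bsub>OPol n\<^esub> (B \<oplus>\<^bsub>OPol n\<^esub> B) = B"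
      by (rule represents_unique[OF represents_add[OF represents_uminus[OF rB] represents_add[OF rB rB]]])
        (simp add: rB)
    then have "d B = d (\<ominus>\<^bsub>OPol n\<^esub> B) + (d B + d B)"
      using d_add[OF represents_carrier[OF represents_uminus[OF rB]] represents_carrier[OF represents_add[OF rB rB]]]
        d_add[OF uminus(1) uminus(1)] by simp
    then have "d (\<ominus>\<^bsub>OPol n\<^esub> B) = - d B" by (simp add: eq_neg_iff_add_eq_0 flip: add.assoc)
    then show ?case
      using uminus.IH by (simp add: psi[OF represents_uminus[OF rB]])
  qed
  then show ?thesis using rep[OF A] by simp
qed

lemma ddiff_ex_represents:
  assumes i: "1 \<le> i" "i < n" and "A \<in> carrier (OPol n)"
  shows "\<exists>B. represents n B (ddiff i (the_elem (abs_skew ` A)))"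
  using assms(3)
proof (induction A rule: OPol_induct)
  note psi = represents_preimage
  {
    case zero
    show ?case using represents_zero by (auto simp: psi[OF represents_zero])
  next
    case one
    show ?case using represents_zero by (auto simp: psi[OF represents_one])
  next
    case (var_mult j B)
    have x: "represents n (opol_x n j) (X j)" using var_mult by (intro represents_x)
    obtain C where C: "represents n C (ddiff i (the_elem (abs_skew ` B)))" using var_mult.IH by blast
    obtain E where E: "represents n E (ddiff i (X j))"
      using represents_one represents_zero unfolding ddiff_X by (cases "j = i \<or> j = i + 1") auto
    show ?case
      unfolding psi[OF represents_mult[OF x represents_ex[OF var_mult(2)]]] ddiff_mult
      using represents_add[OF represents_mult[OF E represents_ex[OF var_mult(2)]]
          represents_mult[OF represents_opol_s[OF i x] C]] by blast
  next
    case (add B C)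
    then show ?case
      using represents_add psi[OF represents_add[OF represents_ex[OF add(1)] represents_ex[OF add(2)]]]
      by (metis ddiff_linear(1))
  next
    case (uminus B)
    then show ?case
      using represents_uminus psi[OF represents_uminus[OF represents_ex[OF uminus(1)]]]
      by (metis ddiff_uminus)
  }
qed

lemma is_odd_divided_difference_ex:
  assumes i: "1 \<le> i" "i < n"
  shows "\<exists>D. is_odd_divided_difference n i D"
proof -
  define D where "D = restrict (\<lambda>A. THE B. represents n B (ddiff i (the_elem (abs_skew ` A)))) (carrier (OPol n))"
  have rep: "represents n (D A) (ddiff i p)" if "represents n A p" for A p
    using that the_represents[OF ddiff_ex_represents[OF i represents_carrier[OF that]]]
      represents_carrier[OF that] by (simp add: D_def represents_preimage[OF that])
  have eq: "D A = B" if "represents n A p" "represents n B q" "ddiff i p = q" for A B p q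
    using represents_unique[of n _ q] rep[OF that(1)] that by blast
  have "D \<in> carrier (OPol n) \<rightarrow>\<^sub>E carrier (OPol n)"
    using represents_carrier[OF rep[OF represents_ex]] by (auto simp: D_def)
  moreover have "D (f \<oplus>\<^bsub>OPol n\<^esub> g) = D f \<oplus>\<^bsub>OPol n\<^esub> D g"
    if "f \<in> carrier (OPol n)" "g \<in> carrier (OPol n)" for f g
    by (rule eq[OF represents_add[OF represents_ex represents_ex] represents_add[OF rep rep]])
      (use that in \<open>auto intro: represents_ex\<close>)
  moreover have "D (opol_x n j) = (if j \<in> {i, i + 1} then \<one>\<^bsub>OPol n\<^esub> else \<zero>\<^bsub>OPol n\<^esub>)" if "j \<in> {1..n}" for j
    by (rule eq[OF represents_x[OF that] _ ddiff_X]) (simp add: represents_one represents_zero)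
  moreover have "D (f \<otimes>\<^bsub>OPol n\<^esub> g) = (D f \<otimes>\<^bsub>OPol n\<^esub> g) \<oplus>\<^bsub>OPol n\<^esub> (opol_s n i f \<otimes>\<^bsub>OPol n\<^esub> D g)"
    if fg: "f \<in> carrier (OPol n)" "g \<in> carrier (OPol n)" for f g
  proof -
    note f = represents_ex[OF fg(1)] and g = represents_ex[OF fg(2)]
    show ?thesis
      by (rule eq[OF represents_mult[OF f g] represents_add[OF represents_mult[OF rep[OF f] g]
              represents_mult[OF represents_opol_s[OF i f] rep[OF g]]] ddiff_mult])
  qed
  ultimately have "is_odd_divided_difference n i D"
    by (simp add: is_odd_divided_difference_def)
  then show ?thesis by blast
qed

lemma represents_odd_divided_difference:
  assumes i: "1 \<le> i" "i < n" and A: "represents n A p"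
  shows "represents n (odd_divided_difference n i A) (ddiff i p)"
proof -
  obtain D where D: "is_odd_divided_difference n i D" using is_odd_divided_difference_ex[OF i] by blast
  have unique: "E = D" if E: "is_odd_divided_difference n i E" for E
  proof (rule extensionalityI)
    show "E \<in> extensional (carrier (OPol n))" "D \<in> extensional (carrier (OPol n))"
      using D E by (auto simp: is_odd_divided_difference_def PiE_def)
    show "E A = D A" if "A \<in> carrier (OPol n)" for A
      using is_odd_divided_difference_represents[OF E i that] is_odd_divided_difference_represents[OF D i that]
      by (rule represents_unique)
  qed
  have "is_odd_divided_difference n i (odd_divided_difference n i)"
    unfolding odd_divided_difference_def
    by (rule theI[of "is_odd_divided_difference n i", OF D]) (rule unique)
  from is_odd_divided_difference_represents[OF this i represents_carrier[OF A]] show ?thesis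
    by (simp add: represents_preimage[OF A])
qed

lemma represents_dw0:
  assumes "represents n A p"
  shows "represents n (odd_divided_difference_w0 n A) (dw0 n p)"
proof -
  have "represents n (foldr (odd_divided_difference n) w A) (foldr ddiff w p)"
    if "set w \<subseteq> {1..<n}" for w
    using that by (induction w) (auto simp: assms intro!: represents_odd_divided_difference)
  from this[of "w0_word n"] show ?thesis
    by (simp add: odd_divided_difference_w0_def dw0_def set_w0_word)
qed

lemma represents_sw0:
  assumes "represents n A p"
  shows "represents n (opol_w0 n A) (sw0 n p)"
proof -
  have "represents n (foldr (opol_s n) w A) (foldr sact w p)" if "set w \<subseteq> {1..<n}" for w
    using that by (induction w) (auto simp: assms intro!: represents_opol_s)
  from this[of "w0_word n"] show ?thesis
    by (simp add: opol_w0_def sw0_def set_w0_word)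
qed

lemma represents_monom: "represents n (opol_monom n e) (xmon n (\<lambda>i. e (Suc i)))"
proof -
  have "prod_list (map (\<lambda>i. X i ^ e i) [1..<Suc m]) = xmon m (\<lambda>i. e (Suc i))" for m
    by (induction m) simp_all
  moreover have "represents n (opol_monom n e) (prod_list (map (\<lambda>i. X i ^ e i) [1..<Suc n]))"
    unfolding opol_monom_def
    by (intro represents_ordered_prod_map represents_power represents_x) auto
  ultimately show ?thesis by simp
qed

section \<open>Partitions as shapes\<close>

definition padded :: "nat list \<Rightarrow> nat \<Rightarrow> nat"
  where "padded lam i = (if i < length lam then lam ! i else 0)"

lemma part_Suc: "part lam (Suc i) = padded lam i"
  by (simp add: part_def padded_def)

lemma map_padded: "map (padded lam) [0..<length lam] = lam"
  by (rule nth_equalityI) (simp_all add: padded_def)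

lemma shape_padded:
  assumes "is_partition lam" and "length lam \<le> L"
  shows "shape L (padded lam)"
  using assms by (auto simp: shape_def padded_def is_partition_def sorted_wrt_iff_nth_less)

lemma size_padded: "length lam \<le> L \<Longrightarrow> size_upto L (padded lam) = sum_list lam"
proof -
  assume L: "length lam \<le> L"
  have "size_upto L (padded lam) = size_upto (length lam) (padded lam)"
    by (rule sum.mono_neutral_right) (use L in \<open>auto simp: padded_def\<close>)
  also have "\<dots> = sum_list lam"
    by (simp add: sum_list_sum_nth padded_def atLeast0LessThan)
  finally show ?thesis .
qed

theorem represents_schur_s: "represents n (schur_s n lam) (sym_schur n (padded lam))"
proof -
  have "represents n (schur_s n lam) (of_int ((-1) ^ (n choose 3)) * sw0 n (dw0 n
      (xmon n (\<lambda>i. part lam (Suc i)) * xmon n (\<lambda>i. n - Suc i))))"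
    unfolding schur_s_def
    by (intro represents_scale represents_sw0 represents_dw0 represents_mult represents_monom)
  then show ?thesis
    by (simp add: sym_schur_def part_Suc)
qed

lemma N_stat_padded: "N_stat lam = inv_form (length lam) (padded lam) (padded lam)"
proof -
  have boxes: "boxes lam = (SIGMA r : {..<length lam}. {..<lam ! r})"
    by (auto simp: boxes_def)
  have above: "card {C \<in> boxes lam. fst C < r} = (\<Sum>j<r. padded lam j)" if "r < length lam" for r
  proof -
    have "{C \<in> boxes lam. fst C < r} = (SIGMA j : {..<r}. {..<lam ! j})"
      using that by (auto simp: boxes_def)
    then show ?thesis using that by (simp add: padded_def)
  qed
  have "N_stat lam = (\<Sum>(r, c)\<in>(SIGMA r : {..<length lam}. {..<lam ! r}).
      card {C \<in> boxes lam. fst C < r})"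
    by (simp add: N_stat_def boxes split_def)
  also have "\<dots> = (\<Sum>r<length lam. \<Sum>c<lam ! r. card {C \<in> boxes lam. fst C < r})"
    by (rule sum.Sigma[symmetric]) auto
  also have "\<dots> = inv_form (length lam) (padded lam) (padded lam)"
    by (simp add: above inv_form_def padded_def)
  finally show ?thesis .
qed

lemma dN_stat_padded:
  assumes "is_partition lam"
  shows "dN_stat lam = inv_form (length lam) (padded lam) (\<lambda>_. 1)"
proof -
  have boxes: "boxes lam = (SIGMA r : {..<length lam}. {..<lam ! r})"
    by (auto simp: boxes_def)
  have above: "card {C \<in> boxes lam. snd C = c \<and> fst C < r} = r" if "r < length lam" "c < lam ! r" for r c
  proof -
    have "c < lam ! j" if "j < r" for j
      using assms \<open>r < length lam\<close> \<open>c < lam ! r\<close> that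
      by (auto simp: is_partition_def sorted_wrt_iff_nth_less intro: less_le_trans)
    then have "{C \<in> boxes lam. snd C = c \<and> fst C < r} = (\<lambda>j. (j, c)) ` {..<r}"
      using that by (auto simp: boxes_def)
    then show ?thesis by (simp add: card_image inj_on_def)
  qed
  have "dN_stat lam = (\<Sum>(r, c)\<in>(SIGMA r : {..<length lam}. {..<lam ! r}).
      card {C \<in> boxes lam. snd C = c \<and> fst C < r})"
    by (simp add: dN_stat_def boxes split_def)
  also have "\<dots> = (\<Sum>r<length lam. \<Sum>c<lam ! r. card {C \<in> boxes lam. snd C = c \<and> fst C < r})"
    by (rule sum.Sigma[symmetric]) auto
  also have "\<dots> = (\<Sum>r<length lam. \<Sum>c<lam ! r. r)"
    by (intro sum.cong refl above) auto
  also have "\<dots> = inv_form (length lam) (padded lam) (\<lambda>_. 1)"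
    by (simp add: inv_form_def padded_def)
  finally show ?thesis .
qed

lemma plactic_extend:
  assumes "shape L lam" and "L \<le> L'"
  shows "plactic L' n lam = plactic L n lam"
proof -
  have "inv_form L' lam (\<lambda>i. lam i + 1) = inv_form L lam (\<lambda>i. lam i + 1)"
    by (rule inv_form_extend) (use assms in \<open>auto simp: shape_def\<close>)
  then show ?thesis by (simp only: plactic_def tab_sum_extend[OF assms])
qed

section \<open>The plactic and the complete functions in the quotient ring\<close>

theorem represents_schur_p:
  assumes "is_partition lam"
  shows "represents n (schur_p n lam) (plactic (length lam) n (padded lam))"
proof -
  let ?L = "length lam" and ?lam = "padded lam"
  have set: "{T \<in> SSYT lam. set (row_word T) \<subseteq> {1..n}} = tableaux ?L n ?lam"
    by (simp add: tableaux_def map_padded)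
  have "represents n (schur_p n lam) (of_int ((-1) ^ (dN_stat lam + N_stat lam)) *
      (\<Sum>T\<in>tableaux ?L n ?lam. xt_word (row_word T)))"
    unfolding schur_p_def set
    by (intro represents_scale represents_sum finite_tableaux represents_xt_word) (simp add: tableaux_def)
  also have "of_int ((-1) ^ (dN_stat lam + N_stat lam)) * (\<Sum>T\<in>tableaux ?L n ?lam. xt_word (row_word T)) =
      plactic ?L n ?lam"
  proof -
    have "dN_stat lam + N_stat lam = inv_form ?L ?lam (\<lambda>i. ?lam i + 1)"
      unfolding inv_form_add_right by (simp only: N_stat_padded dN_stat_padded[OF assms] add.commute)
    then show ?thesis
      by (simp add: plactic_def sum_tableaux_xt_word[OF shape_padded[OF assms order_refl]])
  qed
  finally show ?thesis .
qed

text \<open>The sorted words of length \<open>k\<close> are the row words of the tableaux with a single row of length \<open>k\<close>, and the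
Pieri rule for the empty shape identifies their sum with the recursively defined function.\<close>

lemma represents_opol_h: "represents n (opol_h n k) (hsym n k)"
proof -
  let ?W = "{w. length w = k \<and> sorted w \<and> set w \<subseteq> {1..n}}"
  define row where "row i = (if i = 0 then k else 0)" for i :: nat
  have shape: "shape 1 row" "shape (Suc n) (\<lambda>_. 0)" by (auto simp: shape_def row_def)
  have fin: "finite ?W"
    by (rule finite_subset[OF _ finite_lists_length_eq[of "{1..n}" k]]) auto
  have strips: "hstrips_on (Suc n) (\<lambda>_. 0) k = {row}"
  proof (intro equalityI subsetI)
    fix mu assume "mu \<in> hstrips_on (Suc n) (\<lambda>_. 0) k"
    then have mu: "mu (Suc i) = 0" "size_upto (Suc n) mu = k" for i
      by (auto simp: hstrips_on_def hstrip_def)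
    then have "mu 0 = k" by (simp add: sum.lessThan_Suc_shift del: sum.lessThan_Suc)
    then have "mu i = row i" for i using mu(1) by (cases i) (simp_all add: row_def)
    then show "mu \<in> {row}" by auto
  next
    fix mu assume "mu \<in> {row}"
    then show "mu \<in> hstrips_on (Suc n) (\<lambda>_. 0) k"
      by (auto simp: hstrips_on_def hstrip_def row_def sum.lessThan_Suc_shift simp del: sum.lessThan_Suc)
  qed
  have sign: "pieri_sign (Suc n) (\<lambda>_. 0) row = 0"
    by (auto simp: inv_form_def row_def)
  \<comment> \<open>The Pieri rule needs at least as many rows as variables; the shape is cut down to one row afterwards.\<close>
  have "hsym n k = tab_sum (Suc n) n (\<lambda>_. 0) * hsym n k"
    by (simp add: tab_sum_zero)
  also have "\<dots> = (\<Sum>mu\<in>hstrips_on (Suc n) (\<lambda>_. 0) k.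
      (-1) ^ pieri_sign (Suc n) (\<lambda>_. 0) mu * tab_sum (Suc n) n mu)"
    by (rule tab_sum_hsym[OF shape(2)]) simp
  also have "\<dots> = tab_sum (Suc n) n row"
    unfolding strips by (simp only: sum.insert sum.empty finite.emptyI empty_iff not_False_eq_True sign) simp
  also have "\<dots> = tab_sum 1 n row"
    by (rule tab_sum_extend[OF shape(1)]) simp
  also have "\<dots> = (\<Sum>T\<in>tableaux 1 n row. xt_word (row_word T))"
    by (rule sum_tableaux_xt_word[OF shape(1), symmetric])
  also have "\<dots> = (\<Sum>w\<in>?W. xt_word w)"
  proof (rule sum.reindex_bij_witness[where i = "\<lambda>w. [w]" and j = hd])
    fix T assume "T \<in> tableaux 1 n row"
    then have T: "length T = 1" "length (T ! 0) = k" "sorted (T ! 0)" "set (T ! 0) \<subseteq> {1..n}"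
      by (auto simp: tableaux_iff row_def)
    then obtain w where "T = [w]" by (auto simp: length_Suc_conv)
    then show "[hd T] = T" "hd T \<in> ?W" "xt_word (hd T) = xt_word (row_word T)"
      using T by (simp_all add: row_word_def)
  qed (auto simp: tableaux_iff row_def)
  finally have "hsym n k = (\<Sum>w\<in>?W. xt_word w)" .
  moreover have "represents n (opol_h n k) (\<Sum>w\<in>?W. xt_word w)"
    unfolding opol_h_def by (intro represents_sum fin represents_xt_word) simp
  ultimately show ?thesis by simp
qed

lemma represents_opol_h_prod: "represents n (opol_h_prod n mu) (prod_list (map (hsym n) mu))"
  unfolding opol_h_prod_def by (rule represents_ordered_prod_map) (rule represents_opol_h)

section \<open>The odd Kostka matrix and its inverse\<close>

text \<open>A prescribed content bounds the entries by the number of parts.\<close>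

lemma SSYT_content_tableaux:
  "SSYT_content lam mu = {T \<in> tableaux (length lam) (length mu) (padded lam).
    \<forall>i<length mu. count_list (row_word T) (Suc i) = mu ! i}"
proof (intro equalityI subsetI)
  fix T assume "T \<in> SSYT_content lam mu"
  then have T: "T \<in> SSYT lam" "\<And>i. count_list (row_word T) i = part mu i"
    by (auto simp: SSYT_content_def)
  have "set (row_word T) \<subseteq> {1..length mu}"
  proof
    fix a assume "a \<in> set (row_word T)"
    then have "count_list (row_word T) a \<noteq> 0" by (simp add: count_list_0_iff)
    then show "a \<in> {1..length mu}" unfolding T(2) part_def by (auto split: if_splits)
  qed
  then show "T \<in> {T \<in> tableaux (length lam) (length mu) (padded lam).
      \<forall>i<length mu. count_list (row_word T) (Suc i) = mu ! i}"
    using T by (simp add: tableaux_def map_padded part_def)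
next
  fix T assume "T \<in> {T \<in> tableaux (length lam) (length mu) (padded lam).
    \<forall>i<length mu. count_list (row_word T) (Suc i) = mu ! i}"
  then have T: "T \<in> SSYT lam" "set (row_word T) \<subseteq> {1..length mu}"
      "\<And>i. i < length mu \<Longrightarrow> count_list (row_word T) (Suc i) = mu ! i"
    by (auto simp: tableaux_def map_padded)
  have "count_list (row_word T) i = part mu i" for i
  proof (cases "1 \<le> i \<and> i \<le> length mu")
    case True
    then obtain j where "i = Suc j" "j < length mu" by (cases i) auto
    then show ?thesis using T(3)[of j] by (simp add: part_def)
  next
    case False
    then have "i \<notin> set (row_word T)" using T(2) by auto
    moreover have "part mu i = 0" using False by (auto simp: part_def)
    ultimately show ?thesis by (simp add: count_list_0_iff)
  qed
  with T(1) show "T \<in> SSYT_content lam mu" by (simp add: SSYT_content_def)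
qed

lemma sum_SSYT_content:
  assumes "is_partition lam"
  shows "(\<Sum>T\<in>SSYT_content lam mu. e ^ inversions (row_word T)) = wkostka e (length lam) (rev mu) (padded lam)"
  using sum_tableaux_inversions[OF shape_padded[OF assms order_refl], where mu = mu and e = e]
  by (simp add: SSYT_content_tableaux)

lemma wkostka_padded_self:
  assumes "is_partition lam"
  shows "wkostka e (length lam) (rev lam) (padded lam) = e ^ N_stat lam"
  using wkostka_self[OF shape_padded[OF assms order_refl], of "length lam" e]
  by (simp add: map_padded N_stat_padded) (simp add: padded_def)

text \<open>The weight 1 shows that there is only one tableau whose shape and content agree, and the weight -1
computes its sign.\<close>

lemma odd_Kostka_wkostka:
  assumes "is_partition lam"
  shows "odd_Kostka lam mu = (-1) ^ N_stat lam * wkostka (-1) (length lam) (rev mu) (padded lam)"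
proof -
  have "int (card (SSYT_content lam lam)) = 1"
    using sum_SSYT_content[OF assms, of 1 lam] by (simp add: wkostka_padded_self[OF assms])
  then obtain T where T: "SSYT_content lam lam = {T}" by (auto simp: card_1_singleton_iff)
  have "canonical_tableau lam = T"
    unfolding canonical_tableau_def T by simp
  moreover have "tableau_sign T = (-1) ^ N_stat lam"
    using sum_SSYT_content[OF assms, of "-1" lam]
    by (simp add: T wkostka_padded_self[OF assms] tableau_sign_def word_sign_inversions)
  ultimately show ?thesis
    using sum_SSYT_content[OF assms, of "-1" mu]
    by (simp add: odd_Kostka_def tableau_sign_def word_sign_inversions)
qed

lemma odd_Kostka_self: "is_partition lam \<Longrightarrow> odd_Kostka lam lam = 1"
  by (simp add: odd_Kostka_wkostka wkostka_padded_self flip: power_add)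

lemma padded_inject:
  assumes "is_partition lam" "is_partition mu" and "padded lam = padded mu"
  shows "lam = mu"
proof -
  have len: "i < length lam \<longleftrightarrow> padded lam i \<noteq> 0" if "is_partition lam" for lam i
    using that by (auto simp: padded_def is_partition_def in_set_conv_nth)
  have "length lam = length mu"
    using len[OF assms(1)] len[OF assms(2)] assms(3) by (metis linorder_neqE_nat less_irrefl)
  then show ?thesis
    using map_padded[of lam] map_padded[of mu] assms(3) by metis
qed

lemma length_le_sum_list: "0 \<notin> set lam \<Longrightarrow> length lam \<le> sum_list (lam :: nat list)"
  by (induction lam) (auto simp: Suc_le_eq)

lemma partitions_length: "lam \<in> partitions k \<Longrightarrow> length lam \<le> k"
  using length_le_sum_list by (auto simp: partitions_def is_partition_def)

lemma finite_partitions: "finite (partitions k)"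
proof (rule finite_subset)
  show "partitions k \<subseteq> {lam. set lam \<subseteq> {..k} \<and> length lam \<le> k}"
    using partitions_length member_le_sum_list by (fastforce simp: partitions_def)
qed (rule finite_lists_length_le, simp)

text \<open>A numerical measure that is strictly monotone for the dominance order on the partitions of \<open>k\<close>.\<close>

definition dominance_rank :: "nat \<Rightarrow> nat list \<Rightarrow> nat"
  where "dominance_rank k lam = (\<Sum>i\<le>k. size_upto i (padded lam))"

lemma odd_Kostka_triangular:
  assumes lam: "lam \<in> partitions k" and mu: "mu \<in> partitions k" and nz: "odd_Kostka lam mu \<noteq> 0"
  shows "lam = mu \<or> dominance_rank k mu < dominance_rank k lam"
proof -
  have p: "is_partition lam" "is_partition mu" using lam mu by (auto simp: partitions_def)
  have le: "size_upto i (padded mu) \<le> size_upto i (padded lam)" for i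
  proof -
    have "size_upto i (padded mu) = sum_list (take i mu)"
    proof -
      have "size_upto i (padded mu) = (\<Sum>j<min i (length mu). padded mu j)"
        by (rule sum.mono_neutral_right) (auto simp: padded_def)
      then show ?thesis by (simp add: sum_list_sum_nth padded_def atLeast0LessThan min.commute)
    qed
    also have "\<dots> \<le> size_upto i (padded lam)"
      by (rule wkostka_dominance[OF shape_padded[OF p(1) order_refl]])
        (use nz in \<open>auto simp: odd_Kostka_wkostka[OF p(1)]\<close>)
    finally show ?thesis .
  qed
  show ?thesis
  proof (cases "dominance_rank k mu = dominance_rank k lam")
    case True
    have eq: "size_upto i (padded mu) = size_upto i (padded lam)" if "i \<le> k" for i
      by (rule sum_mono_inv[OF True[unfolded dominance_rank_def]]) (use le that in auto)
    have "padded mu i = padded lam i" for i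
    proof (cases "i < k")
      case True
      then show ?thesis using eq[of i] eq[of "Suc i"] by simp
    next
      case False
      then show ?thesis using partitions_length[OF lam] partitions_length[OF mu] by (simp add: padded_def)
    qed
    then have "padded lam = padded mu" by (intro ext) (rule sym)
    then show ?thesis using padded_inject[OF p] by blast
  next
    case False
    moreover have "dominance_rank k mu \<le> dominance_rank k lam"
      unfolding dominance_rank_def by (rule sum_mono) (rule le)
    ultimately show ?thesis by simp
  qed
qed

text \<open>Forward substitution; \<open>r\<close> takes integer values so that the lemma also applies to the transposed matrix with
the opposite ranking.\<close>

lemma triangular_solvable:
  fixes A :: "'a \<Rightarrow> 'a \<Rightarrow> int" and r :: "'a \<Rightarrow> int"
  assumes "finite P" and "\<And>p. p \<in> P \<Longrightarrow> A p p = 1"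
    and "\<And>p q. p \<in> P \<Longrightarrow> q \<in> P \<Longrightarrow> A p q \<noteq> 0 \<Longrightarrow> p = q \<or> r q < r p"
  shows "\<exists>v. \<forall>p\<in>P. (\<Sum>q\<in>P. A p q * v q) = b p"
  using assms
proof (induction P rule: finite_ranking_induct[where f = r])
  case empty
  then show ?case by simp
next
  case (insert x S)
  obtain v where v: "\<forall>p\<in>S. (\<Sum>q\<in>S. A p q * v q) = b p"
    using insert.IH insert.prems by blast
  show ?case
  proof (cases "x \<in> S")
    case True
    then show ?thesis using v by (auto simp: insert_absorb)
  next
    case False
    let ?v = "v(x := b x - (\<Sum>q\<in>S. A x q * v q))"
    have same: "(\<Sum>q\<in>S. A p q * ?v q) = (\<Sum>q\<in>S. A p q * v q)" for p
      by (rule sum.cong) (use False in auto)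
    have "(\<Sum>q\<in>insert x S. A p q * ?v q) = b p" if "p \<in> insert x S" for p
    proof (cases "p = x")
      case True
      then show ?thesis
        using insert.prems(1)[of x] False insert.hyps(1) by (simp add: same del: fun_upd_apply) simp
    next
      case p: False
      then have "A p x = 0"
        using that insert.prems(2)[of p x] insert.hyps(2)[of p] by force
      then show ?thesis
        using p that v False insert.hyps(1) by (simp add: same del: fun_upd_apply)
    qed
    then show ?thesis by blast
  qed
qed

text \<open>Forward substitution in the matrix and in its transpose yields a right and a left inverse, which agree by
associativity.\<close>

lemma odd_Kostka_inverse_ex: "\<exists>M. is_odd_Kostka_inverse k M"
proof -
  let ?P = "partitions k" and ?r = "\<lambda>lam. int (dominance_rank k lam)"
  have diag: "odd_Kostka p p = 1" if "p \<in> ?P" for p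
    using that by (simp add: partitions_def odd_Kostka_self)
  have "\<exists>v. \<forall>p\<in>?P. (\<Sum>q\<in>?P. odd_Kostka p q * v q) = of_bool (p = s)" for s
    by (rule triangular_solvable[where r = ?r])
      (use finite_partitions diag odd_Kostka_triangular in auto)
  then obtain R where R: "\<And>p s. p \<in> ?P \<Longrightarrow> (\<Sum>q\<in>?P. odd_Kostka p q * R s q) = of_bool (p = s)"
    by metis
  have "\<exists>v. \<forall>p\<in>?P. (\<Sum>q\<in>?P. odd_Kostka q p * v q) = of_bool (p = s)" for s
    by (rule triangular_solvable[where r = "\<lambda>p. - ?r p"])
      (use finite_partitions diag odd_Kostka_triangular in force)+
  then obtain Q where Q: "\<And>p s. p \<in> ?P \<Longrightarrow> (\<Sum>q\<in>?P. odd_Kostka q p * Q s q) = of_bool (p = s)"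
    by metis
  have QR: "Q s t = R t s" if s: "s \<in> ?P" and t: "t \<in> ?P" for s t
  proof -
    have "Q s t = (\<Sum>q\<in>?P. Q s q * of_bool (q = t))"
      using t by (simp add: finite_partitions of_bool_def if_distrib cong: if_cong)
    also have "\<dots> = (\<Sum>q\<in>?P. Q s q * (\<Sum>p\<in>?P. odd_Kostka q p * R t p))"
      by (rule sum.cong) (simp_all add: R)
    also have "\<dots> = (\<Sum>p\<in>?P. (\<Sum>q\<in>?P. odd_Kostka q p * Q s q) * R t p)"
      unfolding sum_distrib_left sum_distrib_right by (subst sum.swap) (simp add: mult_ac)
    also have "\<dots> = (\<Sum>p\<in>?P. of_bool (p = s) * R t p)"
      by (rule sum.cong) (simp_all add: Q)
    also have "\<dots> = R t s"
      using s by (simp add: finite_partitions of_bool_def if_distrib[of "\<lambda>x. x * y" for y] cong: if_cong)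
    finally show ?thesis .
  qed
  have "is_odd_Kostka_inverse k (\<lambda>mu nu. R nu mu)"
    unfolding is_odd_Kostka_inverse_def
  proof (intro ballI conjI)
    fix lam nu assume "lam \<in> ?P" "nu \<in> ?P"
    then show "(\<Sum>mu\<in>?P. odd_Kostka lam mu * R nu mu) = (if lam = nu then 1 else 0)"
      by (simp add: R)
    have "(\<Sum>mu\<in>?P. R mu lam * odd_Kostka mu nu) = (\<Sum>mu\<in>?P. odd_Kostka mu nu * Q lam mu)"
      by (rule sum.cong) (use QR \<open>lam \<in> ?P\<close> in auto)
    then show "(\<Sum>mu\<in>?P. R mu lam * odd_Kostka mu nu) = (if lam = nu then 1 else 0)"
      using Q[OF \<open>nu \<in> ?P\<close>, of lam] by auto
  qed
  then show ?thesis by blast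
qed

lemma bij_betw_padded:
  assumes "k \<le> L"
  shows "bij_betw padded (partitions k) (shapes L k)"
proof (rule bij_betw_imageI)
  show "inj_on padded (partitions k)"
    by (rule inj_onI) (auto simp: partitions_def intro: padded_inject)
  show "padded ` partitions k = shapes L k"
  proof (intro equalityI subsetI)
    fix f assume "f \<in> padded ` partitions k"
    then obtain lam where lam: "f = padded lam" "lam \<in> partitions k" by blast
    then have "length lam \<le> L" using partitions_length assms by fastforce
    then show "f \<in> shapes L k"
      using lam shape_padded size_padded by (auto simp: shapes_def partitions_def)
  next
    fix f assume "f \<in> shapes L k"
    then have f: "shape L f" "size_upto L f = k" by (auto simp: shapes_def)
    let ?lam = "map f [0..<rows L f]"
    have nz: "i < rows L f \<longleftrightarrow> f i \<noteq> 0" for i by (rule less_rows_iff[OF f(1)])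
    then have pad: "padded ?lam = f" by (auto simp: padded_def fun_eq_iff)
    have "f j \<le> f i" if "i < j" for i j
      by (rule shape_antimono[OF f(1)]) (use that in simp)
    then have "sorted_wrt (\<ge>) ?lam" by (simp add: sorted_wrt_iff_nth_less)
    moreover have "0 \<notin> set ?lam" using nz by (metis (no_types, lifting) atLeastLessThan_iff imageE list.set_map set_upt)
    ultimately have "is_partition ?lam" by (simp add: is_partition_def)
    moreover have "sum_list ?lam = k"
      using size_padded[of ?lam L] rows_le[of L f] f(2) by (simp add: pad)
    ultimately show "f \<in> padded ` partitions k"
      using pad by (intro image_eqI[of _ _ ?lam]) (simp_all add: partitions_def)
  qed
qed

section \<open>The three odd Schur functions coincide\<close>

text \<open>The sign of the normalization of the odd Kostka number and the sign \<open>(-1)\<^sup>N\<close> of the plactic function cancel, so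
the coefficients are exactly the odd Kostka numbers.\<close>

theorem hsym_product_plactic:
  assumes "mu \<in> partitions k"
  shows "prod_list (map (hsym n) mu) =
    (\<Sum>lam\<in>partitions k. of_int (odd_Kostka lam mu) * plactic (length lam) n (padded lam))"
proof -
  \<comment> \<open>Enough rows for the Pieri rule in \<open>n\<close> variables and for all partitions of \<open>k\<close>.\<close>
  define L where "L = max n k"
  have sum: "sum_list mu = k" using assms by (simp add: partitions_def)
  have "prod_list (map (hsym n) mu) = (\<Sum>lam\<in>shapes L k.
      of_int (wkostka (-1) L (rev mu) lam) * ((-1) ^ inv_form L lam (\<lambda>_. 1) * tab_sum L n lam))"
    using hsym_product[of n L mu] by (simp add: sum L_def)
  also have "\<dots> = (\<Sum>lam\<in>partitions k. of_int (wkostka (-1) L (rev mu) (padded lam)) *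
      ((-1) ^ inv_form L (padded lam) (\<lambda>_. 1) * tab_sum L n (padded lam)))"
    by (rule sum.reindex_bij_betw[OF bij_betw_padded, symmetric]) (simp add: L_def)
  also have "\<dots> = (\<Sum>lam\<in>partitions k. of_int (odd_Kostka lam mu) * plactic (length lam) n (padded lam))"
  proof (rule sum.cong[OF refl])
    fix lam assume lam: "lam \<in> partitions k"
    then have p: "is_partition lam" by (simp add: partitions_def)
    have le: "length lam \<le> L" using partitions_length[OF lam] by (simp add: L_def)
    note shape = shape_padded[OF p order_refl]
    let ?N = "N_stat lam" and ?d = "inv_form (length lam) (padded lam) (\<lambda>_. 1)"
    let ?k = "wkostka (-1) (length lam) (rev mu) (padded lam)"
    have ext: "inv_form L (padded lam) (\<lambda>_. 1) = ?d"
      by (rule inv_form_extend) (use le in \<open>auto simp: padded_def\<close>)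
    have "of_int (odd_Kostka lam mu) * plactic (length lam) n (padded lam) =
        of_int ?k * ((-1) ^ ?N * (-1) ^ (?N + ?d) * tab_sum (length lam) n (padded lam))"
      unfolding plactic_def odd_Kostka_wkostka[OF p] inv_form_add_right N_stat_padded
      by (simp add: mult.assoc sign_left_commute[of "of_int ?k"])
    also have "(-1 :: skew_poly) ^ ?N * (-1) ^ (?N + ?d) = (-1) ^ ?d"
      unfolding power_add[symmetric] by (rule minus_one_power_cong) auto
    finally show "of_int (wkostka (-1) L (rev mu) (padded lam)) *
        ((-1) ^ inv_form L (padded lam) (\<lambda>_. 1) * tab_sum L n (padded lam)) =
      of_int (odd_Kostka lam mu) * plactic (length lam) n (padded lam)"
      by (simp only: wkostka_extend[OF shape le] tab_sum_extend[OF shape le] ext)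
  qed
  finally show ?thesis .
qed

theorem represents_schur_K:
  assumes "is_partition lam"
  shows "represents n (schur_K n lam) (plactic (length lam) n (padded lam))"
proof -
  let ?P = "partitions (sum_list lam)"
  define M where "M = odd_Kostka_inverse (sum_list lam)"
  have lam: "lam \<in> ?P" using assms by (simp add: partitions_def)
  have inv: "is_odd_Kostka_inverse (sum_list lam) M"
    unfolding M_def odd_Kostka_inverse_def using odd_Kostka_inverse_ex by (rule someI_ex)
  have rep: "represents n (schur_K n lam) (\<Sum>mu\<in>?P. of_int (M mu lam) * prod_list (map (hsym n) mu))"
    unfolding schur_K_def M_def
    by (intro represents_sum finite_partitions represents_scale represents_opol_h_prod)
  have scale_scale: "of_int a * (of_int b * p) = of_int (b * a) * p" for a b and p :: skew_poly
    by (simp only: mult.assoc[symmetric] of_int_mult[symmetric] mult.commute[of a b])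
  note rep
  also have "(\<Sum>mu\<in>?P. of_int (M mu lam) * prod_list (map (hsym n) mu)) =
      (\<Sum>mu\<in>?P. \<Sum>nu\<in>?P. of_int (odd_Kostka nu mu * M mu lam) * plactic (length nu) n (padded nu))"
    by (rule sum.cong[OF refl]) (simp only: hsym_product_plactic sum_distrib_left scale_scale)
  also have "\<dots> = (\<Sum>nu\<in>?P. of_int (\<Sum>mu\<in>?P. odd_Kostka nu mu * M mu lam) * plactic (length nu) n (padded nu))"
    by (subst sum.swap) (simp add: sum_distrib_right)
  also have "\<dots> = (\<Sum>nu\<in>?P. (if nu = lam then 1 else 0) * plactic (length nu) n (padded nu))"
    using inv lam by (intro sum.cong refl) (simp add: is_odd_Kostka_inverse_def)
  also have "\<dots> = plactic (length lam) n (padded lam)"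
    using lam by (simp add: finite_partitions if_distrib[of "\<lambda>x. x * y" for y] cong: if_cong)
  finally show ?thesis .
qed

theorem theorem3p8:
  fixes n :: nat and lam :: "nat list"
  assumes "n \<ge> 1" and "is_partition lam"
  shows "schur_K n lam = schur_p n lam \<and>
    (length lam \<le> n \<longrightarrow> schur_K n lam = schur_p n lam \<and> schur_p n lam = schur_s n lam)"
proof -
  have Kp: "schur_K n lam = schur_p n lam"
    by (rule represents_unique[OF represents_schur_K represents_schur_p]) (rule assms)+
  have "schur_p n lam = schur_s n lam" if "length lam \<le> n"
  proof (rule represents_unique[OF represents_schur_p[OF assms(2)]])
    have "sym_schur n (padded lam) = plactic (length lam) n (padded lam)"
      using sym_schur_eq_plactic[OF shape_padded[OF assms(2) that]]
        plactic_extend[OF shape_padded[OF assms(2) order_refl] that] by simp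
    then show "represents n (schur_s n lam) (plactic (length lam) n (padded lam))"
      using represents_schur_s[of n lam] by simp
  qed
  with Kp show ?thesis by simp
qed

end
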